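(* For every positive integer $d$, the $d$-sos-profile $\mathcal S_d$ is a basic semialgebraic set in $\mathbb{R}^s_{\ge0}$ (where $s=|\mathcal V_d|$) containing the graph profile $\mathcal G_{\mathcal V_d}$, and its tropicalization $\operatorname{trop}(\mathcal S_d)$ is the rational polyhedral cone $\log(S^{2\times2}_{\tilde{\mathcal M}_d})$.
   Context: Graphs are finite, simple. $t(H;G)$ is the probability that a uniformly random map $V(H)\to V(G)$ maps edges to edges. A partially labeled graph is a graph without isolated vertices in which some vertices receive distinct labels from $\{1,2,\ldots\}$ (unlabeled if none); the empty graph is denoted $1$. A graph combination is a finite formal $\mathbb R$-linear combination of partially labeled graphs. The product $H_1H_2$ glues vertices with equal labels (keeping one copy of doubled edges), extended bilinearly; $[[\cdot]]$ (unlabeling) removes all labels. For unlabeled $a=\sum\alpha_iH_i$, $a(G)=\sum\alpha_it(H_i;G)$. A $d$-sos graph combination is $\sum_j[[a_j^2]]$ where each constituent graph of each $a_j$ has at most $d$ edges. Fix an integer $\ell(d)$ such that every $d$-sos graph combination can be written with all $a_j$ using only labels in $\{1,\ldots,\ell(d)\}$. $\mathcal B_d$ is the set consisting of $1$ and all partially labeled graphs with labels in $\{1,\ldots,\ell(d)\}$, at most $d$ edges and no isolated vertices; $\mathcal V_d=\{[[AB]]\text{ connected}: A,B\in\mathcal B_d\}\setminus\{1\}$, $s=|\mathcal V_d|$. Every unlabeled graph appearing in a $d$-sos combination or as $[[AB]]$ ($A,B\in\mathcal B_d$) is a disjoint union of graphs in $\mathcal V_d$, hence a monomial in variables $x_C$,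 $C\in\mathcal V_d$; a graph combination is evaluated at $\mathbf v\in\mathbb{R}^s$ by substituting $v_C$ for $x_C$. $\mathcal S_d=\{\mathbf v\in\mathbb{R}^s_{\ge0}: a(\mathbf v)\ge0 \text{ for every } d\text{-sos graph combination } a\}$. The graph profile $\mathcal G_{\mathcal V_d}$ is the closure of $\{(t(C;G))_{C\in\mathcal V_d}\}$ over all graphs $G$. $\tilde{\mathcal B}_d\subseteq\mathcal B_d$ consists of $1$ and all graphs in $\mathcal B_d$ with no unlabeled connected component; $\tilde{\mathcal M}_d$ is the symmetric matrix indexed by $\tilde{\mathcal B}_d$ with $(A,B)$ entry the monomial $[[AB]]$. For a symmetric matrix $M$ of monomials in $x_C$, $S^{2\times2}_M=\{\mathbf v\in\mathbb{R}^s_{\ge0}: \text{all }2\times2\text{ principal minors of }M(\mathbf v)\text{ are}\ge0\}$. $\log(\mathcal S)$ is the image of $\mathcal S\cap\mathbb{R}^s_{>0}$ under coordinatewise natural log; $\operatorname{trop}(\mathcal S)$ is the set of $\mathbf y$ for which there are $\tau_k\in(0,1)$, $\tau_k\to0$, $\mathbf y(k)\in\mathcal S\cap\mathbb{R}^s_{>0}$ with $\frac{-1}{\log_e\tau_k}\log(\mathbf y(k))\to\mathbf y$. *)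

theory Defs
  imports "HOL-Analysis.Analysis" "HOL-Library.Poly_Mapping" "HOL-Library.Multiset"
begin

section \<open>Partially labeled graphs\<close>

text \<open>
  A graph without isolated vertices is determined by its edge set. The vertex carrying label \<open>i\<close>
  is taken to be \<open>Lab i\<close> itself, so distinct vertices carry distinct labels, and gluing along
  equal labels is the union of the edge sets once the unlabeled vertices have been made disjoint.
  Graphs are identified up to isomorphisms that preserve labels (and the absence of labels).
\<close>

datatype vertex = Lab nat | Unl nat

definition pl_edges :: "vertex set set \<Rightarrow> bool" where
  "pl_edges E \<longleftrightarrow> finite E \<and> (\<forall>e\<in>E. card e = 2) \<and> Lab 0 \<notin> \<Union>E"

definition pl_iso_via :: "(vertex \<Rightarrow> vertex) \<Rightarrow> vertex set set \<Rightarrow> vertex set set \<Rightarrow> bool" where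
  "pl_iso_via f E F \<longleftrightarrow>
     inj_on f (\<Union>E) \<and> (\<forall>v\<in>\<Union>E. \<forall>i. f v = Lab i \<longleftrightarrow> v = Lab i) \<and> F = (\<lambda>e. f ` e) ` E"

definition pl_iso :: "vertex set set \<Rightarrow> vertex set set \<Rightarrow> bool" where
  "pl_iso E F \<longleftrightarrow> pl_edges E \<and> pl_edges F \<and> (\<exists>f. pl_iso_via f E F)"

lemma pl_iso_via_Union: "pl_iso_via f E F \<Longrightarrow> \<Union>F = f ` \<Union>E"
  by (auto simp: pl_iso_via_def)

lemma pl_iso_via_inj: "pl_iso_via f E F \<Longrightarrow> inj_on f (\<Union>E)"
  unfolding pl_iso_via_def by (rule conjunct1)

lemma pl_iso_via_Lab: "pl_iso_via f E F \<Longrightarrow> v \<in> \<Union>E \<Longrightarrow> f v = Lab i \<longleftrightarrow> v = Lab i"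
  unfolding pl_iso_via_def by blast

lemma pl_iso_via_edges: "pl_iso_via f E F \<Longrightarrow> F = (\<lambda>e. f ` e) ` E"
  unfolding pl_iso_via_def by blast

lemma pl_iso_via_trans:
  assumes "pl_iso_via f E F" "pl_iso_via g F G"
  shows "pl_iso_via (g \<circ> f) E G"
proof -
  have U: "\<Union>F = f ` \<Union>E" using assms(1) by (rule pl_iso_via_Union)
  have "inj_on (g \<circ> f) (\<Union>E)"
    using comp_inj_on[OF pl_iso_via_inj[OF assms(1)]] pl_iso_via_inj[OF assms(2)]
    unfolding U by blast
  moreover have "\<forall>v\<in>\<Union>E. \<forall>i. (g \<circ> f) v = Lab i \<longleftrightarrow> v = Lab i"
  proof (intro ballI allI)
    fix v i assume v: "v \<in> \<Union>E"
    then have fv: "f v \<in> \<Union>F" unfolding U by (rule imageI)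
    show "(g \<circ> f) v = Lab i \<longleftrightarrow> v = Lab i"
      by (simp only: comp_apply pl_iso_via_Lab[OF assms(2) fv] pl_iso_via_Lab[OF assms(1) v])
  qed
  moreover have "G = (\<lambda>e. (g \<circ> f) ` e) ` E"
    unfolding pl_iso_via_edges[OF assms(2)] pl_iso_via_edges[OF assms(1)] image_image comp_def ..
  ultimately show ?thesis by (simp add: pl_iso_via_def)
qed

lemma pl_iso_via_inv:
  assumes "pl_iso_via f E F"
  shows "pl_iso_via (inv_into (\<Union>E) f) F E"
proof -
  let ?g = "inv_into (\<Union>E) f"
  have U: "\<Union>F = f ` \<Union>E" using assms by (rule pl_iso_via_Union)
  have inj: "inj_on f (\<Union>E)" using assms by (simp add: pl_iso_via_def)
  have gf: "?g (f v) = v" if "v \<in> \<Union>E" for v using inj that by (rule inv_into_f_f)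
  have "inj_on ?g (\<Union>F)" unfolding U by (rule inj_on_inv_into) simp
  moreover have "\<forall>w\<in>\<Union>F. \<forall>i. ?g w = Lab i \<longleftrightarrow> w = Lab i"
    unfolding U using assms gf by (simp add: pl_iso_via_def)
  moreover have "E = (\<lambda>e. ?g ` e) ` F"
  proof -
    have "?g ` f ` e = e" if "e \<in> E" for e
      using gf that by (force simp: image_image)
    then have "(\<lambda>e. ?g ` f ` e) ` E = (\<lambda>e. e) ` E" by (intro image_cong) auto
    then show ?thesis using assms by (simp add: pl_iso_via_def image_image)
  qed
  ultimately show ?thesis by (simp add: pl_iso_via_def)
qed

lemma pl_iso_via_id: "pl_iso_via id E E"
  by (simp add: pl_iso_via_def)

quotient_type plgraph = "vertex set set" / partial: pl_iso
proof (rule part_equivpI)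
  show "\<exists>E. pl_iso E E"
    using pl_iso_via_id by (intro exI[of _ "{}"]) (auto simp: pl_iso_def pl_edges_def)
  show "symp pl_iso"
    using pl_iso_via_inv by (force simp: symp_def pl_iso_def)
  show "transp pl_iso"
    using pl_iso_via_trans by (force simp: transp_def pl_iso_def)
qed

lift_definition empty_graph :: plgraph is "{}"
  using pl_iso_via_id by (auto simp: pl_iso_def pl_edges_def)

lift_definition num_edges :: "plgraph \<Rightarrow> nat" is card
proof -
  fix E F :: "vertex set set"
  assume "pl_iso E F"
  then obtain f where f: "pl_iso_via f E F" by (auto simp: pl_iso_def)
  have "inj_on (\<lambda>e. f ` e) E"
    using pl_iso_via_inj[OF f] by (rule inj_on_image)
  then show "card E = card F" using f by (simp add: pl_iso_via_def card_image)
qed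

lift_definition labels :: "plgraph \<Rightarrow> nat set" is "\<lambda>E. {i. Lab i \<in> \<Union>E}"
proof -
  fix E F :: "vertex set set"
  assume "pl_iso E F"
  then obtain f where f: "pl_iso_via f E F" by (auto simp: pl_iso_def)
  then have "\<Union>F = f ` \<Union>E" by (rule pl_iso_via_Union)
  moreover have "\<forall>v\<in>\<Union>E. \<forall>i. f v = Lab i \<longleftrightarrow> v = Lab i" using f by (simp add: pl_iso_via_def)
  ultimately show "{i. Lab i \<in> \<Union>E} = {i. Lab i \<in> \<Union>F}"
    by (metis (no_types, lifting) image_iff)
qed


subsection \<open>Gluing and unlabeling\<close>

fun tag0 :: "vertex \<Rightarrow> vertex" where
  "tag0 (Lab i) = Lab i"
| "tag0 (Unl j) = Unl (2 * j)"

fun tag1 :: "vertex \<Rightarrow> vertex" where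
  "tag1 (Lab i) = Lab i"
| "tag1 (Unl j) = Unl (2 * j + 1)"

definition glue_edges :: "vertex set set \<Rightarrow> vertex set set \<Rightarrow> vertex set set" where
  "glue_edges E F = (\<lambda>e. tag0 ` e) ` E \<union> (\<lambda>e. tag1 ` e) ` F"

fun unl :: "vertex \<Rightarrow> vertex" where
  "unl (Lab i) = Unl (2 * i)"
| "unl (Unl j) = Unl (2 * j + 1)"

lemma tag0_Lab: "tag0 v = Lab i \<longleftrightarrow> v = Lab i" by (cases v) auto
lemma tag1_Lab: "tag1 v = Lab i \<longleftrightarrow> v = Lab i" by (cases v) auto
lemma tag0_inj: "inj tag0" by (rule injI, rename_tac x y, case_tac x; case_tac y; simp)
lemma tag1_inj: "inj tag1" by (rule injI, rename_tac x y, case_tac x; case_tac y; simp)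
lemma unl_inj: "inj unl" by (rule injI, rename_tac x y, case_tac x; case_tac y; simp; presburger)

lemma tag0_eq_tag1: "tag0 v = tag1 w \<longleftrightarrow> (\<exists>i. v = Lab i \<and> w = Lab i)"
  by (cases v; cases w) (auto, presburger)

lemma pl_edges_glue:
  assumes "pl_edges E" "pl_edges F"
  shows "pl_edges (glue_edges E F)"
proof -
  have "card (tag0 ` e) = card e" "card (tag1 ` e) = card e" for e
    by (auto intro!: card_image inj_on_subset[OF tag0_inj] inj_on_subset[OF tag1_inj])
  then show ?thesis
    using assms tag0_Lab tag1_Lab unfolding pl_edges_def glue_edges_def by (force simp: eq_commute)
qed

lemma pl_edges_unl:
  assumes "pl_edges E"
  shows "pl_edges ((\<lambda>e. unl ` e) ` E)"
proof -
  have "card (unl ` e) = card e" for e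
    by (auto intro!: card_image inj_on_subset[OF unl_inj])
  moreover have "unl v \<noteq> Lab i" for v i by (cases v) auto
  ultimately show ?thesis
    using assms unfolding pl_edges_def by (force simp: eq_commute)
qed

lift_definition glue :: "plgraph \<Rightarrow> plgraph \<Rightarrow> plgraph" is glue_edges
proof -
  fix E E' F F' :: "vertex set set"
  assume EE: "pl_iso E E'" and FF: "pl_iso F F'"
  then obtain f g where f: "pl_iso_via f E E'" and g: "pl_iso_via g F F'"
    by (auto simp: pl_iso_def)
  define h where "h w = (if w \<in> tag0 ` \<Union>E then tag0 (f (inv tag0 w))
                         else tag1 (g (inv tag1 w)))" for w
  have flab: "f v = Lab i \<longleftrightarrow> v = Lab i" if "v \<in> \<Union>E" for v i
    using f that by (rule pl_iso_via_Lab)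
  have glab: "g v = Lab i \<longleftrightarrow> v = Lab i" if "v \<in> \<Union>F" for v i
    using g that by (rule pl_iso_via_Lab)
  have h0: "h (tag0 v) = tag0 (f v)" if "v \<in> \<Union>E" for v
    using imageI[OF that, of tag0] by (simp only: h_def if_P inv_f_f[OF tag0_inj])
  have h1: "h (tag1 v) = tag1 (g v)" if v: "v \<in> \<Union>F" for v
  proof (cases "tag1 v \<in> tag0 ` \<Union>E")
    case True
    then obtain u where u: "u \<in> \<Union>E" "tag0 u = tag1 v" by force
    then obtain i where "u = Lab i" "v = Lab i" using tag0_eq_tag1 by blast
    then have "f u = Lab i" "g v = Lab i" using flab[OF u(1)] glab[OF v] by blast+
    then show ?thesis using h0[OF u(1)] u(2) by simp
  next
    case False
    then show ?thesis by (simp only: h_def if_False inv_f_f[OF tag1_inj])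
  qed
  have U: "\<Union>(glue_edges E F) = tag0 ` \<Union>E \<union> tag1 ` \<Union>F"
    by (auto simp: glue_edges_def)
  have injf: "inj_on f (\<Union>E)" and injg: "inj_on g (\<Union>F)"
    using f g by (simp_all add: pl_iso_via_def)
  have cross: "tag0 u = tag1 w" if "u \<in> \<Union>E" "w \<in> \<Union>F" "h (tag0 u) = h (tag1 w)" for u w
  proof -
    have "tag0 (f u) = tag1 (g w)" using that h0 h1 by simp
    then obtain i where "f u = Lab i" "g w = Lab i" using tag0_eq_tag1 by blast
    then have "u = Lab i" "w = Lab i" using that flab glab by auto
    then show ?thesis by simp
  qed
  have "inj_on h (\<Union>(glue_edges E F))"
  proof (rule inj_onI)
    fix x y assume x: "x \<in> \<Union>(glue_edges E F)" and y: "y \<in> \<Union>(glue_edges E F)" and e: "h x = h y"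
    have same0: "tag0 u = tag0 w" if "u \<in> \<Union>E" "w \<in> \<Union>E" "h (tag0 u) = h (tag0 w)" for u w
      using that h0 injD[OF tag0_inj] inj_onD[OF injf] by metis
    have same1: "tag1 u = tag1 w" if "u \<in> \<Union>F" "w \<in> \<Union>F" "h (tag1 u) = h (tag1 w)" for u w
      using that h1 injD[OF tag1_inj] inj_onD[OF injg] by metis
    from x y e show "x = y"
      unfolding U using same0 same1 cross by (elim UnE imageE) metis+
  qed
  moreover have "\<forall>v\<in>\<Union>(glue_edges E F). \<forall>i. h v = Lab i \<longleftrightarrow> v = Lab i"
  proof (intro ballI allI)
    fix v i assume "v \<in> \<Union>(glue_edges E F)"
    then consider u where "u \<in> \<Union>E" "v = tag0 u" | u where "u \<in> \<Union>F" "v = tag1 u"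
      unfolding U by blast
    then show "h v = Lab i \<longleftrightarrow> v = Lab i"
    proof cases
      case 1
      show ?thesis by (simp only: 1(2) h0[OF 1(1)] tag0_Lab flab[OF 1(1)])
    next
      case 2
      show ?thesis by (simp only: 2(2) h1[OF 2(1)] tag1_Lab glab[OF 2(1)])
    qed
  qed
  moreover have "glue_edges E' F' = (\<lambda>e. h ` e) ` glue_edges E F"
  proof -
    have a: "h ` tag0 ` e = tag0 ` f ` e" if "e \<in> E" for e
      unfolding image_image using h0 that by (intro image_cong) auto
    have b: "h ` tag1 ` e = tag1 ` g ` e" if "e \<in> F" for e
      unfolding image_image using h1 that by (intro image_cong) auto
    have "(\<lambda>e. h ` e) ` glue_edges E F = (\<lambda>e. h ` tag0 ` e) ` E \<union> (\<lambda>e. h ` tag1 ` e) ` F"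
      by (simp add: glue_edges_def image_Un image_image)
    also have "\<dots> = (\<lambda>e. tag0 ` f ` e) ` E \<union> (\<lambda>e. tag1 ` g ` e) ` F"
      by (intro arg_cong2[where f = "(\<union>)"] image_cong[OF refl a] image_cong[OF refl b])
    also have "\<dots> = glue_edges E' F'"
      unfolding pl_iso_via_edges[OF f] pl_iso_via_edges[OF g] glue_edges_def image_image ..
    finally show ?thesis by simp
  qed
  ultimately have "pl_iso_via h (glue_edges E F) (glue_edges E' F')"
    by (simp add: pl_iso_via_def)
  then show "pl_iso (glue_edges E F) (glue_edges E' F')"
    using EE FF pl_edges_glue by (auto simp: pl_iso_def)
qed

lift_definition unlabel :: "plgraph \<Rightarrow> plgraph" is "\<lambda>E. (\<lambda>e. unl ` e) ` E"
proof -
  fix E F :: "vertex set set"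
  assume EF: "pl_iso E F"
  then obtain f where f: "pl_iso_via f E F" by (auto simp: pl_iso_def)
  define h where "h w = unl (f (inv unl w))" for w
  have h: "h (unl v) = unl (f v)" for v using unl_inj by (simp add: h_def)
  have nl: "unl v \<noteq> Lab i" for v i by (cases v) auto
  have U: "\<Union>((\<lambda>e. unl ` e) ` E) = unl ` \<Union>E" by auto
  have "inj_on h (unl ` \<Union>E)"
    using comp_inj_on[OF pl_iso_via_inj[OF f] inj_on_subset[OF unl_inj subset_UNIV]]
    by (intro inj_on_imageI) (simp add: comp_def h)
  moreover have "\<forall>v\<in>unl ` \<Union>E. \<forall>i. h v = Lab i \<longleftrightarrow> v = Lab i"
    using h nl by auto
  moreover have "(\<lambda>e. unl ` e) ` F = (\<lambda>e. h ` e) ` (\<lambda>e. unl ` e) ` E"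
    using f by (simp add: pl_iso_via_def image_image h)
  ultimately have "pl_iso_via h ((\<lambda>e. unl ` e) ` E) ((\<lambda>e. unl ` e) ` F)"
    unfolding pl_iso_via_def U by blast
  then show "pl_iso ((\<lambda>e. unl ` e) ` E) ((\<lambda>e. unl ` e) ` F)"
    using EF pl_edges_unl by (auto simp: pl_iso_def)
qed


subsection \<open>Connectedness and connected components\<close>

definition reach :: "vertex set set \<Rightarrow> (vertex \<times> vertex) set" where
  "reach E = {(u, v). {u, v} \<in> E}\<^sup>*"

definition component_edges :: "vertex set set \<Rightarrow> vertex \<Rightarrow> vertex set set" where
  "component_edges E u = {e \<in> E. \<forall>w\<in>e. (u, w) \<in> reach E}"

lemma reach_iso:
  assumes "pl_iso_via f E F" "(u, v) \<in> reach E"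
  shows "(f u, f v) \<in> reach F"
  using assms(2) unfolding reach_def
proof (induction rule: rtrancl_induct)
  case (step y z)
  then have "f ` {y, z} \<in> F" unfolding pl_iso_via_edges[OF assms(1)] by blast
  then have "(f y, f z) \<in> {(u, v). {u, v} \<in> F}" by simp
  with step.IH show ?case by (simp add: rtrancl.rtrancl_into_rtrancl)
qed simp

lemma reach_iso_iff:
  assumes f: "pl_iso_via f E F" and u: "u \<in> \<Union>E" and v: "v \<in> \<Union>E"
  shows "(f u, f v) \<in> reach F \<longleftrightarrow> (u, v) \<in> reach E"
proof
  assume "(f u, f v) \<in> reach F"
  then have "(inv_into (\<Union>E) f (f u), inv_into (\<Union>E) f (f v)) \<in> reach E"
    by (rule reach_iso[OF pl_iso_via_inv[OF f]])
  then show "(u, v) \<in> reach E"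
    using f u v by (simp add: pl_iso_via_def inv_into_f_f del: Union_iff)
qed (rule reach_iso[OF f])

lemma component_edges_iso:
  assumes f: "pl_iso_via f E F" and u: "u \<in> \<Union>E"
  shows "component_edges F (f u) = (\<lambda>e. f ` e) ` component_edges E u"
proof -
  have "F = (\<lambda>e. f ` e) ` E" using f by (simp add: pl_iso_via_def)
  moreover have "(\<forall>w\<in>f ` e. (f u, w) \<in> reach F) \<longleftrightarrow> (\<forall>w\<in>e. (u, w) \<in> reach E)" if "e \<in> E" for e
    using reach_iso_iff[OF f u] that by blast
  ultimately show ?thesis unfolding component_edges_def by blast
qed

lift_definition connected_graph :: "plgraph \<Rightarrow> bool" is
  "\<lambda>E. \<forall>u\<in>\<Union>E. \<forall>v\<in>\<Union>E. (u, v) \<in> reach E"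
proof -
  fix E F :: "vertex set set"
  assume "pl_iso E F"
  then obtain f where f: "pl_iso_via f E F" by (auto simp: pl_iso_def)
  show "(\<forall>u\<in>\<Union>E. \<forall>v\<in>\<Union>E. (u, v) \<in> reach E) = (\<forall>u\<in>\<Union>F. \<forall>v\<in>\<Union>F. (u, v) \<in> reach F)"
    unfolding pl_iso_via_Union[OF f] using reach_iso_iff[OF f] by blast
qed

lift_definition graph_components :: "plgraph \<Rightarrow> plgraph multiset" is
  "\<lambda>E. image_mset abs_plgraph (mset_set (component_edges E ` \<Union>E))"
proof -
  fix E F :: "vertex set set"
  assume EF: "pl_iso E F"
  then obtain f where f: "pl_iso_via f E F" by (auto simp: pl_iso_def)
  let ?C = "component_edges E ` \<Union>E" and ?\<phi> = "\<lambda>c. (\<lambda>e. f ` e) ` c"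
  have sub: "c \<subseteq> E" if "c \<in> ?C" for c using that by (auto simp: component_edges_def)
  have "inj_on (\<lambda>e. f ` e) E"
    using pl_iso_via_inj[OF f] by (rule inj_on_image)
  then have inj: "inj_on ?\<phi> ?C"
    using sub by (intro inj_onI) (metis inj_on_image_eq_iff)
  have "component_edges F ` \<Union>F = ?\<phi> ` ?C"
    unfolding pl_iso_via_Union[OF f] image_image
    using component_edges_iso[OF f] by (intro image_cong) auto
  then have eq: "mset_set (component_edges F ` \<Union>F) = image_mset ?\<phi> (mset_set ?C)"
    using image_mset_mset_set[OF inj] by simp
  have abs: "abs_plgraph (?\<phi> c) = abs_plgraph c" if "c \<in> ?C" for c
  proof -
    have cE: "c \<subseteq> E" using sub that by blast
    then have "pl_iso_via f c (?\<phi> c)"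
      using f unfolding pl_iso_via_def by (meson Union_mono inj_on_subset subsetD)
    moreover have "?\<phi> c \<subseteq> F" using cE f by (auto simp: pl_iso_via_def)
    then have "pl_edges c" "pl_edges (?\<phi> c)"
      using EF cE unfolding pl_iso_def pl_edges_def by (meson Union_mono finite_subset subsetD)+
    ultimately have "pl_iso c (?\<phi> c)" by (auto simp: pl_iso_def)
    then show ?thesis by (rule Quotient3_rel_abs[OF Quotient3_plgraph, symmetric])
  qed
  have "image_mset abs_plgraph (mset_set ?C) = image_mset (\<lambda>c. abs_plgraph (?\<phi> c)) (mset_set ?C)"
  proof (rule image_mset_cong)
    fix c assume "c \<in># mset_set ?C"
    then have "c \<in> ?C" using elem_mset_set by (cases "finite ?C") fastforce+
    then show "abs_plgraph c = abs_plgraph (?\<phi> c)" using abs by simp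
  qed
  then show "image_mset abs_plgraph (mset_set ?C)
           = image_mset abs_plgraph (mset_set (component_edges F ` \<Union>F))"
    unfolding eq by (simp add: image_mset.compositionality comp_def)
qed


subsection \<open>Homomorphism densities\<close>

definition simple_graph :: "nat set \<Rightarrow> nat set set \<Rightarrow> bool" where
  "simple_graph W D \<longleftrightarrow> finite W \<and> W \<noteq> {} \<and> D \<subseteq> {e. e \<subseteq> W \<and> card e = 2}"

lift_definition hom_density :: "plgraph \<Rightarrow> nat set \<Rightarrow> nat set set \<Rightarrow> real" is
  "\<lambda>E W D. real (card {\<phi> \<in> \<Union>E \<rightarrow>\<^sub>E W. \<forall>e\<in>E. \<phi> ` e \<in> D}) / real (card (\<Union>E \<rightarrow>\<^sub>E W))"
proof (intro ext)
  fix E F :: "vertex set set" and W :: "nat set" and D :: "nat set set"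
  assume "pl_iso E F"
  then obtain f where f: "pl_iso_via f E F" by (auto simp: pl_iso_def)
  let ?r = "\<lambda>\<psi>. restrict (\<psi> \<circ> f) (\<Union>E)"
  have U: "\<Union>F = f ` \<Union>E" by (rule pl_iso_via_Union[OF f])
  have bij: "bij_betw f (\<Union>E) (\<Union>F)" using f U by (simp add: bij_betw_def pl_iso_via_def)
  have b: "bij_betw ?r (\<Union>F \<rightarrow>\<^sub>E W) (\<Union>E \<rightarrow>\<^sub>E W)"
  proof (rule bij_betw_byWitness[where f' = "\<lambda>\<phi>. restrict (\<phi> \<circ> inv_into (\<Union>E) f) (\<Union>F)"])
    have gf: "inv_into (\<Union>E) f (f v) = v" if "v \<in> \<Union>E" for v
      using bij that by (simp add: bij_betw_def inv_into_f_f del: Union_iff)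
    have fg: "f (inv_into (\<Union>E) f w) = w" "inv_into (\<Union>E) f w \<in> \<Union>E" if "w \<in> \<Union>F" for w
      using that unfolding U by (simp_all add: f_inv_into_f inv_into_into del: Union_iff UN_iff)
    have fv: "f v \<in> \<Union>F" if "v \<in> \<Union>E" for v using that unfolding U by (rule imageI)
    show "\<forall>\<psi>\<in>\<Union>F \<rightarrow>\<^sub>E W. restrict (?r \<psi> \<circ> inv_into (\<Union>E) f) (\<Union>F) = \<psi>"
      using fg by (auto simp: fun_eq_iff PiE_iff extensional_def simp del: Union_iff)
    show "\<forall>\<phi>\<in>\<Union>E \<rightarrow>\<^sub>E W. ?r (restrict (\<phi> \<circ> inv_into (\<Union>E) f) (\<Union>F)) = \<phi>"
      using gf fv by (auto simp: fun_eq_iff PiE_iff extensional_def simp del: Union_iff)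
    show "?r ` (\<Union>F \<rightarrow>\<^sub>E W) \<subseteq> \<Union>E \<rightarrow>\<^sub>E W"
      unfolding image_subset_iff restrict_PiE_iff comp_apply
      using fv by (blast dest: PiE_mem)
    show "(\<lambda>\<phi>. restrict (\<phi> \<circ> inv_into (\<Union>E) f) (\<Union>F)) ` (\<Union>E \<rightarrow>\<^sub>E W) \<subseteq> \<Union>F \<rightarrow>\<^sub>E W"
      unfolding image_subset_iff restrict_PiE_iff comp_apply
      using fg(2) by (blast dest: PiE_mem)
  qed
  have im: "?r \<psi> ` e = \<psi> ` f ` e" if "e \<in> E" for e \<psi>
    using that unfolding image_image by (intro image_cong) auto
  have iff: "(\<forall>e\<in>E. ?r \<psi> ` e \<in> D) \<longleftrightarrow> (\<forall>e\<in>F. \<psi> ` e \<in> D)" for \<psi>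
    unfolding pl_iso_via_edges[OF f] by (simp only: ball_simps(9) im cong: ball_cong)
  have "bij_betw ?r {\<psi> \<in> \<Union>F \<rightarrow>\<^sub>E W. \<forall>e\<in>F. \<psi> ` e \<in> D} {\<phi> \<in> \<Union>E \<rightarrow>\<^sub>E W. \<forall>e\<in>E. \<phi> ` e \<in> D}"
  proof (rule bij_betw_subset[OF b])
    have "{\<phi> \<in> \<Union>E \<rightarrow>\<^sub>E W. \<forall>e\<in>E. \<phi> ` e \<in> D} = {\<phi> \<in> ?r ` (\<Union>F \<rightarrow>\<^sub>E W). \<forall>e\<in>E. \<phi> ` e \<in> D}"
      unfolding bij_betw_imp_surj_on[OF b] ..
    also have "\<dots> = ?r ` {\<psi> \<in> \<Union>F \<rightarrow>\<^sub>E W. \<forall>e\<in>E. ?r \<psi> ` e \<in> D}"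
      by (rule Compr_image_eq)
    finally show "?r ` {\<psi> \<in> \<Union>F \<rightarrow>\<^sub>E W. \<forall>e\<in>F. \<psi> ` e \<in> D} = {\<phi> \<in> \<Union>E \<rightarrow>\<^sub>E W. \<forall>e\<in>E. \<phi> ` e \<in> D}"
      unfolding iff by (rule sym)
  qed auto
  from bij_betw_same_card[OF this] bij_betw_same_card[OF b]
  show "real (card {\<phi> \<in> \<Union>E \<rightarrow>\<^sub>E W. \<forall>e\<in>E. \<phi> ` e \<in> D}) / real (card (\<Union>E \<rightarrow>\<^sub>E W))
      = real (card {\<phi> \<in> \<Union>F \<rightarrow>\<^sub>E W. \<forall>e\<in>F. \<phi> ` e \<in> D}) / real (card (\<Union>F \<rightarrow>\<^sub>E W))"
    by simp
qed


section \<open>Graph combinations and sums of squares\<close>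

type_synonym graph_comb = "plgraph \<Rightarrow>\<^sub>0 real"

definition comb_mult :: "graph_comb \<Rightarrow> graph_comb \<Rightarrow> graph_comb" where
  "comb_mult a b = (\<Sum>A\<in>Poly_Mapping.keys a. \<Sum>B\<in>Poly_Mapping.keys b.
     Poly_Mapping.single (glue A B) (Poly_Mapping.lookup a A * Poly_Mapping.lookup b B))"

definition comb_unlabel :: "graph_comb \<Rightarrow> graph_comb" where
  "comb_unlabel a =
     (\<Sum>A\<in>Poly_Mapping.keys a. Poly_Mapping.single (unlabel A) (Poly_Mapping.lookup a A))"

definition sos_comb :: "graph_comb list \<Rightarrow> graph_comb" where
  "sos_comb bs = (\<Sum>b\<leftarrow>bs. comb_unlabel (comb_mult b b))"

definition is_sos :: "nat \<Rightarrow> graph_comb \<Rightarrow> bool" where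
  "is_sos d a \<longleftrightarrow>
     (\<exists>bs. (\<forall>b\<in>set bs. \<forall>H\<in>Poly_Mapping.keys b. num_edges H \<le> d) \<and> a = sos_comb bs)"

definition label_bound :: "nat \<Rightarrow> nat \<Rightarrow> bool" where
  "label_bound d l \<longleftrightarrow> (\<forall>a. is_sos d a \<longrightarrow>
     (\<exists>bs. (\<forall>b\<in>set bs. \<forall>H\<in>Poly_Mapping.keys b. num_edges H \<le> d \<and> labels H \<subseteq> {1..l})
         \<and> a = sos_comb bs))"

definition basis :: "nat \<Rightarrow> nat \<Rightarrow> plgraph set" where
  "basis d l = insert empty_graph {A. num_edges A \<le> d \<and> labels A \<subseteq> {1..l}}"

definition reduced_basis :: "nat \<Rightarrow> nat \<Rightarrow> plgraph set" where
  "reduced_basis d l =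
     insert empty_graph {A \<in> basis d l. \<forall>C\<in>#graph_components A. labels C \<noteq> {}}"

definition variables :: "nat \<Rightarrow> nat \<Rightarrow> plgraph set" where
  "variables d l = {unlabel (glue A B) | A B.
     A \<in> basis d l \<and> B \<in> basis d l \<and> connected_graph (unlabel (glue A B))} - {empty_graph}"

text \<open>
  A monomial in the variables \<open>x\<^sub>C\<close> is the multiset of its factors. The space \<open>\<real>\<^sup>V\<close> for a finite set \<open>V\<close>
  of graphs is \<open>V \<rightarrow>\<^sub>E UNIV\<close>, with the topology \<open>powertop_real V\<close>.
\<close>

definition eval_monomial :: "plgraph multiset \<Rightarrow> (plgraph \<Rightarrow> real) \<Rightarrow> real" where
  "eval_monomial m v = (\<Prod>C\<in>#m. v C)"

definition eval_comb :: "graph_comb \<Rightarrow> (plgraph \<Rightarrow> real) \<Rightarrow> real" where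
  "eval_comb a v = (\<Sum>H\<in>Poly_Mapping.keys a.
     Poly_Mapping.lookup a H * eval_monomial (graph_components H) v)"

definition nonneg_orthant :: "plgraph set \<Rightarrow> (plgraph \<Rightarrow> real) set" where
  "nonneg_orthant V = V \<rightarrow>\<^sub>E {0..}"

definition pos_orthant :: "plgraph set \<Rightarrow> (plgraph \<Rightarrow> real) set" where
  "pos_orthant V = V \<rightarrow>\<^sub>E {0<..}"

definition sos_profile :: "nat \<Rightarrow> nat \<Rightarrow> (plgraph \<Rightarrow> real) set" where
  "sos_profile d l =
     {v \<in> nonneg_orthant (variables d l). \<forall>a. is_sos d a \<longrightarrow> eval_comb a v \<ge> 0}"

definition graph_profile :: "plgraph set \<Rightarrow> (plgraph \<Rightarrow> real) set" where
  "graph_profile V =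
     powertop_real V closure_of {(\<lambda>C\<in>V. hom_density C W D) | W D. simple_graph W D}"

definition moment_matrix :: "plgraph \<Rightarrow> plgraph \<Rightarrow> plgraph multiset" where
  "moment_matrix A B = graph_components (unlabel (glue A B))"

definition minors22 ::
  "plgraph set \<Rightarrow> 'i set \<Rightarrow> ('i \<Rightarrow> 'i \<Rightarrow> plgraph multiset) \<Rightarrow> (plgraph \<Rightarrow> real) set" where
  "minors22 V I M = {v \<in> nonneg_orthant V. \<forall>i\<in>I. \<forall>j\<in>I. i \<noteq> j \<longrightarrow>
     eval_monomial (M i i) v * eval_monomial (M j j) v
       - eval_monomial (M i j) v * eval_monomial (M j i) v \<ge> 0}"


section \<open>Semialgebraic sets, tropicalization and rational cones\<close>

text \<open>A polynomial over \<open>\<real>\<close> is a finitely supported map from exponent vectors to coefficients.\<close>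

definition eval_poly :: "(('v \<Rightarrow>\<^sub>0 nat) \<Rightarrow>\<^sub>0 real) \<Rightarrow> ('v \<Rightarrow> real) \<Rightarrow> real" where
  "eval_poly p v = (\<Sum>m\<in>Poly_Mapping.keys p. Poly_Mapping.lookup p m *
     (\<Prod>x\<in>Poly_Mapping.keys m. v x ^ Poly_Mapping.lookup m x))"

definition basic_semialgebraic :: "plgraph set \<Rightarrow> (plgraph \<Rightarrow> real) set \<Rightarrow> bool" where
  "basic_semialgebraic V S \<longleftrightarrow> (\<exists>P. finite P
     \<and> (\<forall>p\<in>P. \<forall>m\<in>Poly_Mapping.keys p. Poly_Mapping.keys m \<subseteq> V)
     \<and> S = {v \<in> nonneg_orthant V. \<forall>p\<in>P. eval_poly p v \<ge> 0})"

definition log_set :: "plgraph set \<Rightarrow> (plgraph \<Rightarrow> real) set \<Rightarrow> (plgraph \<Rightarrow> real) set" where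
  "log_set V S = (\<lambda>v. \<lambda>C\<in>V. ln (v C)) ` (S \<inter> pos_orthant V)"

definition trop :: "plgraph set \<Rightarrow> (plgraph \<Rightarrow> real) set \<Rightarrow> (plgraph \<Rightarrow> real) set" where
  "trop V S = {y. \<exists>(\<tau> :: nat \<Rightarrow> real) w.
     (\<forall>k. \<tau> k \<in> {0<..<1}) \<and> \<tau> \<longlonglongrightarrow> 0 \<and> (\<forall>k. w k \<in> S \<inter> pos_orthant V)
     \<and> limitin (powertop_real V) (\<lambda>k. \<lambda>C\<in>V. (- 1 / ln (\<tau> k)) * ln (w k C)) y sequentially}"

definition rational_polyhedral_cone :: "plgraph set \<Rightarrow> (plgraph \<Rightarrow> real) set \<Rightarrow> bool" where
  "rational_polyhedral_cone V K \<longleftrightarrow> (\<exists>F :: (plgraph \<Rightarrow> rat) set. finite F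
     \<and> K = {y \<in> V \<rightarrow>\<^sub>E UNIV. \<forall>c\<in>F. (\<Sum>C\<in>V. of_rat (c C) * y C) \<ge> 0})"

end

theory Submission
  imports Defs
begin

text \<open>
  Splitting off unlabeled components is a congruence of the moment matrix, so the sums-of-squares
  profile consists of the nonnegative points at which the matrix \<open>M\<close> indexed by the reduced basis is positive
  semidefinite. For the density vector of a graph, \<open>M\<close> is an average of rank one matrices over all
  placements of the labels, which puts the graph profile inside.

  The \<open>2 \<times> 2\<close> minors of \<open>M\<close> are binomials, so their logarithms cut out a rational cone containing the
  tropicalization. Conversely, if all the inequalities of the cone are strict at \<open>y\<close>, then for large \<open>s\<close>
  the matrix \<open>M\<close> at \<open>exp (s y)\<close> is, after scaling the diagonal to 1, close to the identity, hence positive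
  definite. It remains to find one strict point. For two distinct graphs \<open>A\<close>, \<open>B\<close> of the reduced basis
  the logarithm of the density in a looped graph \<open>G\<close> works, unless the numbers of homomorphisms to \<open>G\<close> with
  prescribed labels are proportional for \<open>A\<close> and \<open>B\<close>. Adding an isolated looped vertex to \<open>G\<close> forces the
  factor 1, and by Lovasz' argument equality for all \<open>G\<close> would make \<open>A\<close> and \<open>B\<close> isomorphic. The sum of
  these logarithms over all pairs is strict everywhere.
\<close>

section \<open>Positive semidefinite matrices and polynomial inequalities\<close>

text \<open>The reduced basis is what makes strict points possible. If \<open>B\<close> is
  \<open>A\<close> with an unlabeled component H added, then [[AB]] = H [[AA]] and [[BB]] = H^2
  [[AA]] as monomials, so the minor of this pair vanishes identically and no point is strict for it.
  Loops are allowed in the targets because they make every density positive, so that logarithms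
  exist. The resulting density vectors need not come from simple graphs, which is harmless since
  they only serve as exponents. The sum over all pairs is strict because each target already
  satisfies every weak inequality, its moment matrix being an average of Gram matrices; one strict
  target per pair therefore survives the summation. Boundary points of the cone are reached by
  adding a vanishing multiple of the strict point before scaling. The label bound enters at one
  place, where arbitrary sums of squares are turned into quadratic forms indexed by finitely many
  graphs.\<close>

definition psd_on :: "'i set \<Rightarrow> ('i \<Rightarrow> 'i \<Rightarrow> real) \<Rightarrow> bool" where
  "psd_on I M \<longleftrightarrow> (\<forall>x. (\<Sum>i\<in>I. \<Sum>j\<in>I. x i * x j * M i j) \<ge> 0)"

lemma psd_onD: "psd_on I M \<Longrightarrow> (\<Sum>i\<in>I. \<Sum>j\<in>I. x i * x j * M i j) \<ge> 0"
  by (simp add: psd_on_def)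

lemma psd_on_cong:
  "(\<And>i j. i \<in> I \<Longrightarrow> j \<in> I \<Longrightarrow> M i j = N i j) \<Longrightarrow> psd_on I M \<longleftrightarrow> psd_on I N"
  unfolding psd_on_def by (intro arg_cong[where f = All] ext) (simp cong: sum.cong)

lemma quadratic_form_split:
  fixes M :: "'i \<Rightarrow> 'i \<Rightarrow> real"
  assumes "finite I" "i \<in> I" and sym: "\<And>j. j \<in> I \<Longrightarrow> M j i = M i j"
  shows "(\<Sum>j\<in>I. \<Sum>k\<in>I. x j * x k * M j k) =
    M i i * (x i)\<^sup>2 + 2 * x i * (\<Sum>j\<in>I-{i}. x j * M i j)
      + (\<Sum>j\<in>I-{i}. \<Sum>k\<in>I-{i}. x j * x k * M j k)"
proof -
  have "(\<Sum>j\<in>I-{i}. x j * x i * M j i) = x i * (\<Sum>j\<in>I-{i}. x j * M i j)"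
    unfolding sum_distrib_left by (rule sum.cong) (auto simp: sym)
  moreover have "(\<Sum>j\<in>I-{i}. x i * x j * M i j) = x i * (\<Sum>j\<in>I-{i}. x j * M i j)"
    unfolding sum_distrib_left by (rule sum.cong) auto
  ultimately show ?thesis
    using assms(1,2)
    by (simp add: sum.remove[of I i] sum.distrib algebra_simps power2_eq_square)
qed

text \<open>Schur complement of the pivot \<open>M i i\<close>, multiplied by the pivot to avoid
  division; its entries thus stay polynomial in those of \<open>M\<close>.\<close>

lemma schur_quadratic_form:
  fixes M :: "'i \<Rightarrow> 'i \<Rightarrow> real"
  shows "(\<Sum>j\<in>J. \<Sum>k\<in>J. x j * x k * (M i i * M j k - M i j * M i k)) =
    M i i * (\<Sum>j\<in>J. \<Sum>k\<in>J. x j * x k * M j k) - (\<Sum>j\<in>J. x j * M i j)\<^sup>2"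
proof -
  have "(\<Sum>j\<in>J. \<Sum>k\<in>J. x j * x k * (M i i * M j k - M i j * M i k)) =
      (\<Sum>j\<in>J. \<Sum>k\<in>J. M i i * (x j * x k * M j k) - (x j * M i j) * (x k * M i k))"
    by (intro sum.cong refl) (simp add: algebra_simps)
  then show ?thesis
    unfolding power2_eq_square sum_product by (simp only: sum_subtractf sum_distrib_left)
qed

lemma nonneg_quadratic_discriminant:
  fixes a b c :: real
  assumes "a \<ge> 0" "\<And>t. a * t\<^sup>2 + 2 * t * b + c \<ge> 0"
  shows "b\<^sup>2 \<le> a * c"
proof (cases "a = 0")
  case True
  have "b = 0"
  proof (rule ccontr)
    assume "b \<noteq> 0"
    \<comment> \<open>With \<open>a = 0\<close> the expression is affine in \<open>t\<close>, and
      this \<open>t\<close> gives it the value -1.\<close>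
    then show False using assms(2)[of "- (c + 1) / (2 * b)"] True by (simp add: field_simps)
  qed
  then show ?thesis using True by simp
next
  case False
  then have "a > 0" using assms(1) by simp
  then show ?thesis
    using assms(2)[of "- b / a"] by (simp add: field_simps power2_eq_square)
qed

lemma psd_on_diag:
  assumes "finite I" "psd_on I M" "i \<in> I"
  shows "M i i \<ge> 0"
proof -
  have "(\<Sum>j\<in>I. \<Sum>k\<in>I. of_bool (j = i) * of_bool (k = i) * M j k)
      = (\<Sum>j\<in>I. if j = i then \<Sum>k\<in>I. if k = i then M i i else 0 else 0)"
    by (intro sum.cong refl) (auto intro!: sum.cong)
  also have "\<dots> = M i i" using assms by simp
  finally show ?thesis using psd_onD[OF assms(2), of "\<lambda>j. of_bool (j = i)"] by simp
qed

text \<open>With \<open>x\<close> fixed off \<open>i\<close>, the form is a nonnegative quadratic in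
  the coordinate at \<open>i\<close>; its discriminant inequality is the claim.\<close>

lemma psd_on_schur:
  assumes fin: "finite I" and psd: "psd_on I M" and i: "i \<in> I"
    and sym: "\<And>j k. j \<in> I \<Longrightarrow> k \<in> I \<Longrightarrow> M j k = M k j"
  shows "psd_on (I - {i}) (\<lambda>j k. M i i * M j k - M i j * M i k)"
  unfolding psd_on_def schur_quadratic_form
proof
  fix x
  let ?b = "\<Sum>j\<in>I-{i}. x j * M i j" and ?c = "\<Sum>j\<in>I-{i}. \<Sum>k\<in>I-{i}. x j * x k * M j k"
  have "M i i * t\<^sup>2 + 2 * t * ?b + ?c \<ge> 0" for t
  proof -
    have "(\<Sum>j\<in>I-{i}. (x(i := t)) j * M i j) = ?b"
      by (rule sum.cong) auto
    moreover have "(\<Sum>j\<in>I-{i}. \<Sum>k\<in>I-{i}. (x(i := t)) j * (x(i := t)) k * M j k) = ?c"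
      by (intro sum.cong refl) auto
    ultimately show ?thesis
      using psd_onD[OF psd, of "x(i := t)"] quadratic_form_split[OF fin i, of M "x(i := t)"] sym i
      by simp
  qed
  then have "?b\<^sup>2 \<le> M i i * ?c"
    by (rule nonneg_quadratic_discriminant[OF psd_on_diag[OF fin psd i]])
  then show "0 \<le> M i i * ?c - ?b\<^sup>2" by simp
qed

text \<open>Completing the square: the pivot times the form is a square plus the Schur form, and a
  positive pivot can be cancelled.\<close>

lemma psd_on_of_schur:
  assumes fin: "finite I" and i: "i \<in> I" and pos: "M i i > 0"
    and psd: "psd_on (I - {i}) (\<lambda>j k. M i i * M j k - M i j * M i k)"
    and sym: "\<And>j k. j \<in> I \<Longrightarrow> k \<in> I \<Longrightarrow> M j k = M k j"
  shows "psd_on I M"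
  unfolding psd_on_def
proof
  fix x
  let ?b = "\<Sum>j\<in>I-{i}. x j * M i j" and ?c = "\<Sum>j\<in>I-{i}. \<Sum>k\<in>I-{i}. x j * x k * M j k"
  have "M i i * ?c - ?b\<^sup>2 \<ge> 0"
    using psd_onD[OF psd, of x] unfolding schur_quadratic_form .
  moreover have "M i i * (M i i * (x i)\<^sup>2 + 2 * x i * ?b + ?c)
      = (M i i * x i + ?b)\<^sup>2 + (M i i * ?c - ?b\<^sup>2)"
    by (simp add: power2_eq_square algebra_simps)
  ultimately have "M i i * (M i i * (x i)\<^sup>2 + 2 * x i * ?b + ?c) \<ge> 0" by simp
  then show "(\<Sum>j\<in>I. \<Sum>k\<in>I. x j * x k * M j k) \<ge> 0"
    using pos quadratic_form_split[OF fin i, of M x] sym i by (simp add: zero_le_mult_iff)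
qed

text \<open>The minor is the diagonal entry at \<open>j\<close> of the scaled Schur complement at
  \<open>i\<close>.\<close>

lemma psd_on_minor:
  assumes "finite I" "psd_on I M" "i \<in> I" "j \<in> I" "i \<noteq> j"
    and "\<And>j k. j \<in> I \<Longrightarrow> k \<in> I \<Longrightarrow> M j k = M k j"
  shows "M i i * M j j - M i j * M i j \<ge> 0"
  using psd_on_diag[OF _ psd_on_schur[OF assms(1-3,6)], of j] assms by auto

text \<open>For the converse one positive pivot is enough. If the whole diagonal is zero, the Schur
  diagonal entries are \<open>- (M i j)\<^sup>2\<close>, so their nonnegativity forces
  \<open>M\<close> to vanish on \<open>I\<close>.\<close>

lemma psd_on_pivots:
  assumes fin: "finite I" and sym: "\<And>j k. j \<in> I \<Longrightarrow> k \<in> I \<Longrightarrow> M j k = M k j"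
  shows "psd_on I M \<longleftrightarrow>
    (\<forall>i\<in>I. M i i \<ge> 0 \<and> psd_on (I - {i}) (\<lambda>j k. M i i * M j k - M i j * M i k))"
proof
  assume "psd_on I M"
  then show "\<forall>i\<in>I. M i i \<ge> 0 \<and> psd_on (I - {i}) (\<lambda>j k. M i i * M j k - M i j * M i k)"
    using psd_on_diag[of I M] psd_on_schur[of I M] fin sym by simp
next
  assume *: "\<forall>i\<in>I. M i i \<ge> 0 \<and> psd_on (I - {i}) (\<lambda>j k. M i i * M j k - M i j * M i k)"
  show "psd_on I M"
  proof (cases "\<exists>i\<in>I. M i i > 0")
    case True
    then obtain i where "i \<in> I" "M i i > 0" by blast
    then show ?thesis using * psd_on_of_schur[of I i M] fin sym by simp
  next
    case False
    then have diag: "M i i = 0" if "i \<in> I" for i using * that by force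
    have "M i j = 0" if "i \<in> I" "j \<in> I" for i j
    proof (cases "i = j")
      case False
      then have "M i i * M j j - M i j * M i j \<ge> 0"
        using psd_on_diag[of "I - {i}" "\<lambda>j k. M i i * M j k - M i j * M i k" j] * fin that by simp
      then have "M i j * M i j \<le> 0" using diag that by simp
      then show ?thesis by (auto simp: mult_le_0_iff)
    qed (simp add: diag that)
    then show ?thesis by (simp add: psd_on_def)
  qed
qed

text \<open>With \<open>z i = \<bar>x i\<bar> * r i\<close>, \<open>card I\<close> times the form is
  at least \<open>card I\<close> times the sum of the \<open>(z i)\<^sup>2\<close> minus the square
  of the sum of the \<open>z i\<close>. Cauchy-Schwarz makes this nonnegative.\<close>

lemma psd_on_diagonally_dominant:
  fixes M :: "'i \<Rightarrow> 'i \<Rightarrow> real"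
  assumes fin: "finite I" and diag: "\<And>i. i \<in> I \<Longrightarrow> M i i = (r i)\<^sup>2"
    and off: "\<And>i j. i \<in> I \<Longrightarrow> j \<in> I \<Longrightarrow> i \<noteq> j \<Longrightarrow> \<bar>M i j\<bar> * card I \<le> r i * r j"
    and r: "\<And>i. i \<in> I \<Longrightarrow> r i \<ge> 0"
  shows "psd_on I M"
  unfolding psd_on_def
proof
  fix x
  let ?n = "real (card I)" and ?z = "\<lambda>i. \<bar>x i\<bar> * r i"
  have pt: "?n * (x i * x j * M i j) \<ge> of_bool (i = j) * (?n * (?z i)\<^sup>2) - ?z i * ?z j"
    if "i \<in> I" "j \<in> I" for i j
  proof (cases "i = j")
    case True
    then show ?thesis using diag that zero_le_square[of "r j * x j"]
      by (simp add: power2_eq_square algebra_simps)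
  next
    case False
    have "\<bar>?n * (x i * x j * M i j)\<bar> = \<bar>x i * x j\<bar> * (\<bar>M i j\<bar> * ?n)"
      by (simp add: abs_mult)
    also have "\<dots> \<le> \<bar>x i * x j\<bar> * (r i * r j)"
      by (intro mult_left_mono off that False) auto
    also have "\<dots> = ?z i * ?z j" by (simp add: abs_mult algebra_simps)
    finally show ?thesis using False by (simp add: abs_le_iff)
  qed
  have "(\<Sum>i\<in>I. ?z i)\<^sup>2 \<le> ?n * (\<Sum>i\<in>I. (?z i)\<^sup>2)"
    using sum_squared_le_sum_of_squares[of ?z I] by (simp add: mult.commute)
  then have "0 \<le> ?n * (\<Sum>i\<in>I. (?z i)\<^sup>2) - (\<Sum>i\<in>I. ?z i)\<^sup>2" by simp
  also have "\<dots> = (\<Sum>i\<in>I. \<Sum>j\<in>I. of_bool (i = j) * (?n * (?z i)\<^sup>2) - ?z i * ?z j)"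
  proof -
    have "(\<Sum>j\<in>I. of_bool (i = j) * (?n * (?z i)\<^sup>2)) = ?n * (?z i)\<^sup>2" if "i \<in> I" for i
      using fin that by (simp add: sum_distrib_right[symmetric] of_bool_def)
    then show ?thesis
      by (simp add: sum_subtractf sum_product[symmetric] power2_eq_square[of "sum _ _"] sum_distrib_left
          del: power_mult_distrib)
  qed
  also have "\<dots> \<le> (\<Sum>i\<in>I. \<Sum>j\<in>I. ?n * (x i * x j * M i j))"
    by (intro sum_mono pt)
  also have "\<dots> = ?n * (\<Sum>i\<in>I. \<Sum>j\<in>I. x i * x j * M i j)"
    by (simp add: sum_distrib_left)
  finally show "(\<Sum>i\<in>I. \<Sum>j\<in>I. x i * x j * M i j) \<ge> 0"
    using fin by (cases "I = {}") (auto simp: zero_le_mult_iff card_gt_0_iff)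
qed

text \<open>Lagrange's identity: the gap is half the sum of all squared determinants
  \<open>p i * q j - p j * q i\<close>, so one nonzero determinant makes it positive.\<close>

lemma strict_Cauchy_Schwarz_sum:
  fixes p q :: "'i \<Rightarrow> real"
  assumes fin: "finite I" and ab: "a \<in> I" "b \<in> I" "p a * q b \<noteq> p b * q a"
  shows "(\<Sum>i\<in>I. p i * q i)\<^sup>2 < (\<Sum>i\<in>I. p i * p i) * (\<Sum>i\<in>I. q i * q i)"
proof -
  have "0 < (p a * q b - p b * q a)\<^sup>2" using ab by simp
  also have "\<dots> \<le> (\<Sum>j\<in>I. (p a * q j - p j * q a)\<^sup>2)"
    by (rule member_le_sum[of b]) (use fin ab in auto)
  also have "\<dots> \<le> (\<Sum>i\<in>I. \<Sum>j\<in>I. (p i * q j - p j * q i)\<^sup>2)"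
    by (rule member_le_sum[of a]) (use fin ab in \<open>auto intro: sum_nonneg\<close>)
  also have "\<dots> = (\<Sum>i\<in>I. \<Sum>j\<in>I. (p i * p i) * (q j * q j)) + (\<Sum>i\<in>I. \<Sum>j\<in>I. (q i * q i) * (p j * p j))
      - 2 * (\<Sum>i\<in>I. \<Sum>j\<in>I. (p i * q i) * (p j * q j))"
    unfolding sum_distrib_left sum.distrib[symmetric] sum_subtractf[symmetric]
    by (intro sum.cong refl) (simp add: power2_eq_square algebra_simps)
  also have "\<dots> = 2 * ((\<Sum>i\<in>I. p i * p i) * (\<Sum>i\<in>I. q i * q i) - (\<Sum>i\<in>I. p i * q i)\<^sup>2)"
    unfolding sum_product[symmetric] power2_eq_square by simp
  finally show ?thesis by simp
qed

section \<open>Real functions given by polynomials in the variables of a set\<close>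

definition polynomial_fun :: "'v set \<Rightarrow> (('v \<Rightarrow> real) \<Rightarrow> real) \<Rightarrow> bool" where
  "polynomial_fun V f \<longleftrightarrow> (\<exists>p. (\<forall>m\<in>Poly_Mapping.keys p. Poly_Mapping.keys m \<subseteq> V)
     \<and> (\<forall>v. f v = eval_poly p v))"

definition power_product :: "('v \<Rightarrow>\<^sub>0 nat) \<Rightarrow> ('v \<Rightarrow> real) \<Rightarrow> real" where
  "power_product m v = (\<Prod>x\<in>Poly_Mapping.keys m. v x ^ Poly_Mapping.lookup m x)"

lemma power_product_superset:
  assumes "finite X" "Poly_Mapping.keys m \<subseteq> X"
  shows "power_product m v = (\<Prod>x\<in>X. v x ^ Poly_Mapping.lookup m x)"
  unfolding power_product_def
  by (rule prod.mono_neutral_left) (use assms in \<open>auto simp: in_keys_iff\<close>)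

lemma power_product_add: "power_product (m + m') v = power_product m v * power_product m' v"
proof -
  let ?X = "Poly_Mapping.keys m \<union> Poly_Mapping.keys m'"
  have "Poly_Mapping.keys (m + m') \<subseteq> ?X" by (rule Poly_Mapping.keys_add)
  then show ?thesis
    using power_product_superset[of ?X]
    by (simp add: lookup_add power_add prod.distrib)
qed

lemma eval_poly_superset:
  assumes "finite X" "Poly_Mapping.keys p \<subseteq> X"
  shows "eval_poly p v = (\<Sum>m\<in>X. Poly_Mapping.lookup p m * power_product m v)"
  unfolding eval_poly_def power_product_def[symmetric]
  by (rule sum.mono_neutral_left) (use assms in \<open>auto simp: in_keys_iff\<close>)

lemma polynomial_fun_add:
  assumes "polynomial_fun V f" "polynomial_fun V g"
  shows "polynomial_fun V (\<lambda>v. f v + g v)"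
proof -
  from assms obtain p q where p: "\<forall>m\<in>Poly_Mapping.keys p. Poly_Mapping.keys m \<subseteq> V" "\<And>v. f v = eval_poly p v"
    and q: "\<forall>m\<in>Poly_Mapping.keys q. Poly_Mapping.keys m \<subseteq> V" "\<And>v. g v = eval_poly q v"
    unfolding polynomial_fun_def by blast
  let ?X = "Poly_Mapping.keys p \<union> Poly_Mapping.keys q"
  have sub: "Poly_Mapping.keys (p + q) \<subseteq> ?X" by (rule Poly_Mapping.keys_add)
  have "f v + g v = eval_poly (p + q) v" for v
    using sub eval_poly_superset[of ?X]
    by (simp add: p q lookup_add sum.distrib algebra_simps)
  then show ?thesis using sub p(1) q(1) unfolding polynomial_fun_def by blast
qed

lemma polynomial_fun_term:
  assumes "Poly_Mapping.keys m \<subseteq> V"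
  shows "polynomial_fun V (\<lambda>v. c * power_product m v)"
  unfolding polynomial_fun_def
  by (rule exI[of _ "Poly_Mapping.single m c"])
    (use assms eval_poly_superset[of "{m}" "Poly_Mapping.single m c"] in auto)

lemma polynomial_fun_const: "polynomial_fun V (\<lambda>v. c)"
  using polynomial_fun_term[of 0 V c] by (simp add: power_product_def)

lemma polynomial_fun_var: "x \<in> V \<Longrightarrow> polynomial_fun V (\<lambda>v. v x)"
  using polynomial_fun_term[of "Poly_Mapping.single x 1" V 1] by (simp add: power_product_def)

lemma polynomial_fun_sum:
  "(\<And>i. i \<in> I \<Longrightarrow> polynomial_fun V (f i)) \<Longrightarrow> polynomial_fun V (\<lambda>v. \<Sum>i\<in>I. f i v)"
  by (induction I rule: infinite_finite_induct) (auto intro: polynomial_fun_const polynomial_fun_add)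

text \<open>The product is expanded into a double sum of terms \<open>c * power_product m v\<close>,
  so closure under sums suffices and the coefficients of the product polynomial are never
  computed.\<close>

lemma polynomial_fun_mult:
  assumes "polynomial_fun V f" "polynomial_fun V g"
  shows "polynomial_fun V (\<lambda>v. f v * g v)"
proof -
  from assms obtain p q where p: "\<forall>m\<in>Poly_Mapping.keys p. Poly_Mapping.keys m \<subseteq> V" "\<And>v. f v = eval_poly p v"
    and q: "\<forall>m\<in>Poly_Mapping.keys q. Poly_Mapping.keys m \<subseteq> V" "\<And>v. g v = eval_poly q v"
    unfolding polynomial_fun_def by blast
  have "f v * g v = (\<Sum>m\<in>Poly_Mapping.keys p. \<Sum>m'\<in>Poly_Mapping.keys q.
      (Poly_Mapping.lookup p m * Poly_Mapping.lookup q m') * power_product (m + m') v)" for v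
    by (simp add: p q eval_poly_def power_product_def[symmetric] sum_product power_product_add
        algebra_simps)
  moreover have "Poly_Mapping.keys (m + m') \<subseteq> V"
    if "m \<in> Poly_Mapping.keys p" "m' \<in> Poly_Mapping.keys q" for m m'
    using p(1) q(1) that Poly_Mapping.keys_add[of m m'] by blast
  ultimately show ?thesis
    by (auto intro!: polynomial_fun_sum polynomial_fun_term)
qed

lemma polynomial_fun_diff:
  assumes "polynomial_fun V f" "polynomial_fun V g"
  shows "polynomial_fun V (\<lambda>v. f v - g v)"
  using polynomial_fun_add[OF assms(1) polynomial_fun_mult[OF polynomial_fun_const[of V "-1"] assms(2)]]
  by simp

text \<open>Recursing over all pivots at once turns Gaussian elimination into a conjunction of polynomial
  inequalities, with no case distinction on which pivots vanish.\<close>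

lemma psd_on_polynomial_inequalities:
  assumes "finite I"
    and "\<And>i j. i \<in> I \<Longrightarrow> j \<in> I \<Longrightarrow> polynomial_fun V (\<lambda>v. M v i j)"
    and "\<And>v i j. i \<in> I \<Longrightarrow> j \<in> I \<Longrightarrow> M v i j = M v j i"
  shows "\<exists>F. finite F \<and> (\<forall>f\<in>F. polynomial_fun V f) \<and> (\<forall>v. psd_on I (M v) \<longleftrightarrow> (\<forall>f\<in>F. f v \<ge> 0))"
  using assms
proof (induction "card I" arbitrary: I M)
  case 0
  then have "I = {}" by simp
  then show ?case by (intro exI[of _ "{}"]) (simp add: psd_on_def)
next
  case (Suc n)
  have "\<exists>F. finite F \<and> (\<forall>f\<in>F. polynomial_fun V f) \<and>
      (\<forall>v. psd_on (I - {i}) (\<lambda>j k. M v i i * M v j k - M v i j * M v i k) \<longleftrightarrow> (\<forall>f\<in>F. f v \<ge> 0))"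
    if i: "i \<in> I" for i
  proof (rule Suc.hyps(1))
    show "n = card (I - {i})" using Suc.hyps(2) Suc.prems(1) i by simp
    show "polynomial_fun V (\<lambda>v. M v i i * M v j k - M v i j * M v i k)"
      if "j \<in> I - {i}" "k \<in> I - {i}" for j k
      using that i by (intro polynomial_fun_diff polynomial_fun_mult Suc.prems(2)) auto
    show "M v i i * M v j k - M v i j * M v i k = M v i i * M v k j - M v i k * M v i j"
      if "j \<in> I - {i}" "k \<in> I - {i}" for v j k
      using that Suc.prems(3)[of j k v] by simp
  qed (use Suc.prems in auto)
  then have "\<forall>i\<in>I. \<exists>F. finite F \<and> (\<forall>f\<in>F. polynomial_fun V f) \<and>
      (\<forall>v. psd_on (I - {i}) (\<lambda>j k. M v i i * M v j k - M v i j * M v i k) \<longleftrightarrow> (\<forall>f\<in>F. f v \<ge> 0))"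
    by blast
  from bchoice[OF this] obtain F where F: "\<forall>i\<in>I. finite (F i) \<and> (\<forall>f\<in>F i. polynomial_fun V f) \<and>
      (\<forall>v. psd_on (I - {i}) (\<lambda>j k. M v i i * M v j k - M v i j * M v i k) \<longleftrightarrow> (\<forall>f\<in>F i. f v \<ge> 0))"
    by blast
  let ?F = "(\<lambda>i v. M v i i) ` I \<union> (\<Union>i\<in>I. F i)"
  have "psd_on I (M v) \<longleftrightarrow> (\<forall>f\<in>?F. f v \<ge> 0)" for v
    using psd_on_pivots[of I "M v"] Suc.prems(1,3) F by auto
  moreover have "finite ?F" using Suc.prems(1) F by auto
  moreover have "\<forall>f\<in>?F. polynomial_fun V f" using Suc.prems(2) F by auto
  ultimately show ?case by blast
qed


section \<open>Components and products of partially labeled graphs\<close>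

lemma pl_iso_refl: "pl_edges E \<Longrightarrow> pl_iso E E"
  using pl_iso_via_id by (auto simp: pl_iso_def)

lemma abs_plgraph_eqI:
  "pl_edges E \<Longrightarrow> pl_edges F \<Longrightarrow> pl_iso_via f E F \<Longrightarrow> abs_plgraph E = abs_plgraph F"
  by (rule Quotient3_rel_abs[OF Quotient3_plgraph]) (auto simp: pl_iso_def)

lemma abs_plgraph_eqD:
  assumes "pl_edges E" "pl_edges F" "abs_plgraph E = abs_plgraph F"
  shows "\<exists>f. pl_iso_via f E F"
proof -
  have "pl_iso E F"
    using assms Quotient3_rel[OF Quotient3_plgraph, of E F] pl_iso_refl by blast
  then show ?thesis by (simp add: pl_iso_def)
qed

lemma abs_rep_plgraph: "abs_plgraph (rep_plgraph A) = A"
  by (rule Quotient3_abs_rep[OF Quotient3_plgraph])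

lemma pl_edges_rep: "pl_edges (rep_plgraph A)"
  using Quotient3_rep_reflp[OF Quotient3_plgraph, of A] by (simp add: pl_iso_def)

lemma pl_edges_subset: "pl_edges E \<Longrightarrow> F \<subseteq> E \<Longrightarrow> pl_edges F"
  unfolding pl_edges_def by (meson Union_mono finite_subset subsetD)

lemma pl_edges_finite_Union: "pl_edges E \<Longrightarrow> finite (\<Union>E)"
  unfolding pl_edges_def by (metis card.infinite finite_Union zero_neq_numeral)

lemma pl_edges_nonempty: "pl_edges E \<Longrightarrow> e \<in> E \<Longrightarrow> e \<noteq> {}"
  unfolding pl_edges_def by force

lemma pl_edges_doubleton: "pl_edges E \<Longrightarrow> e \<in> E \<Longrightarrow> u \<in> e \<Longrightarrow> \<exists>w. e = {u, w}"
  unfolding pl_edges_def by (metis card_2_iff doubleton_eq_iff insertE singletonD)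

lemma pl_edges_Un: "pl_edges E \<Longrightarrow> pl_edges F \<Longrightarrow> pl_edges (E \<union> F)"
  by (auto simp: pl_edges_def)

section \<open>Reachability and connected components of edge sets\<close>

lemma reach_sym: "(u, v) \<in> reach E \<Longrightarrow> (v, u) \<in> reach E"
proof -
  have "sym {(u, v). {u, v} \<in> E}" by (auto simp: sym_def insert_commute)
  then show "(u, v) \<in> reach E \<Longrightarrow> (v, u) \<in> reach E"
    unfolding reach_def by (meson sym_rtrancl symD)
qed

lemma reach_trans: "(u, v) \<in> reach E \<Longrightarrow> (v, w) \<in> reach E \<Longrightarrow> (u, w) \<in> reach E"
  unfolding reach_def by (rule rtrancl_trans)

lemma reach_refl: "(u, u) \<in> reach E"
  by (simp add: reach_def)

lemma reach_edge: "{u, v} \<in> E \<Longrightarrow> (u, v) \<in> reach E"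
  by (auto simp: reach_def)

lemma reach_same_edge: "pl_edges E \<Longrightarrow> e \<in> E \<Longrightarrow> u \<in> e \<Longrightarrow> v \<in> e \<Longrightarrow> (u, v) \<in> reach E"
  using pl_edges_doubleton[of E e u] reach_edge[of u v E] reach_refl[of u E] by auto

lemma reach_mono: "E \<subseteq> F \<Longrightarrow> (u, v) \<in> reach E \<Longrightarrow> (u, v) \<in> reach F"
  unfolding reach_def using rtrancl_mono[of "{(u, v). {u, v} \<in> E}" "{(u, v). {u, v} \<in> F}"] by blast

text \<open>A path that starts in \<open>X\<close> never leaves it, so all its edges are edges of
  \<open>F\<close>. This transfers reachability from a graph to one of its components or to one side
  of a disjoint union.\<close>

lemma reach_in_closed_part:
  assumes "(u, v) \<in> reach E" "u \<in> X"
    and closed: "\<And>x y. x \<in> X \<Longrightarrow> {x, y} \<in> E \<Longrightarrow> y \<in> X \<and> {x, y} \<in> F"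
  shows "(u, v) \<in> reach F \<and> v \<in> X"
  using assms(1) unfolding reach_def
proof (induction rule: rtrancl_induct)
  case base
  then show ?case using assms(2) by simp
next
  case (step y z)
  then have "z \<in> X" "{y, z} \<in> F" using closed by auto
  then show ?case using step.IH by (auto intro: rtrancl_into_rtrancl)
qed

text \<open>Taking the image as a set keeps one copy of each component, although every vertex of the
  component generates it.\<close>

abbreviation comps :: "vertex set set \<Rightarrow> vertex set set set" where
  "comps E \<equiv> component_edges E ` \<Union>E"

lemma component_edges_self:
  assumes "pl_edges E" "e \<in> E" "u \<in> e"
  shows "e \<in> component_edges E u"
  using assms reach_same_edge by (auto simp: component_edges_def)

lemma component_edges_eq:
  assumes "w \<in> \<Union>(component_edges E u)"
  shows "component_edges E w = component_edges E u"
proof -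
  have "(u, w) \<in> reach E" using assms by (auto simp: component_edges_def)
  then have "(u, x) \<in> reach E \<longleftrightarrow> (w, x) \<in> reach E" for x
    using reach_sym reach_trans by blast
  then show ?thesis by (simp add: component_edges_def)
qed

lemma comps_subset: "c \<in> comps E \<Longrightarrow> c \<subseteq> E"
  by (auto simp: component_edges_def)

lemma Union_comps:
  assumes "pl_edges E"
  shows "\<Union>(comps E) = E"
proof
  show "\<Union>(comps E) \<subseteq> E" using comps_subset by blast
  show "E \<subseteq> \<Union>(comps E)"
  proof
    fix e assume e: "e \<in> E"
    then obtain u where "u \<in> e" using pl_edges_nonempty[OF assms] by blast
    then show "e \<in> \<Union>(comps E)" using e component_edges_self[OF assms] by blast
  qed
qed

lemma comps_nonempty: "pl_edges E \<Longrightarrow> c \<in> comps E \<Longrightarrow> c \<noteq> {}"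
  using component_edges_self by blast

lemma comps_eq_or_disjoint:
  assumes "c \<in> comps E" "c' \<in> comps E" "c \<noteq> c'"
  shows "\<Union>c \<inter> \<Union>c' = {}"
proof -
  obtain u u' where c: "c = component_edges E u" "c' = component_edges E u'" using assms by blast
  show ?thesis
  proof (rule ccontr)
    assume "\<Union>c \<inter> \<Union>c' \<noteq> {}"
    then obtain w where "w \<in> \<Union>c" "w \<in> \<Union>c'" by blast
    then show False using component_edges_eq assms(3) unfolding c by metis
  qed
qed

lemma component_edges_connected:
  assumes E: "pl_edges E" and c: "c \<in> comps E" and uv: "u \<in> \<Union>c" "v \<in> \<Union>c"
  shows "(u, v) \<in> reach c"
proof -
  obtain r where r: "c = component_edges E r" using c by blast
  have cu: "c = component_edges E u" using component_edges_eq uv(1) r by metis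
  have "(u, v) \<in> reach E" using uv(2) unfolding cu by (auto simp: component_edges_def)
  \<comment> \<open>The closed set is the set of vertices reachable from \<open>u\<close>; every
    edge of \<open>E\<close> that meets it belongs to \<open>c\<close>.\<close>
  moreover have "y \<in> {x. (u, x) \<in> reach E} \<and> {x, y} \<in> c"
    if "x \<in> {x. (u, x) \<in> reach E}" "{x, y} \<in> E" for x y
    using that reach_trans[OF _ reach_edge] by (auto simp: cu component_edges_def)
  ultimately show ?thesis
    using reach_in_closed_part[of u v E "{x. (u, x) \<in> reach E}" c] reach_refl by blast
qed

lemma comps_Un_disjoint:
  assumes E: "pl_edges E" and F: "pl_edges F" and disj: "\<Union>E \<inter> \<Union>F = {}"
  shows "comps (E \<union> F) = comps E \<union> comps F"
proof -
  have one: "component_edges (E \<union> F) u = component_edges E u"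
    if u: "u \<in> \<Union>E" and disj: "\<Union>E \<inter> \<Union>F = {}" and F: "pl_edges F" for u E F
  proof -
    have cl: "y \<in> \<Union>E \<and> {x, y} \<in> E" if "x \<in> \<Union>E" "{x, y} \<in> E \<union> F" for x y
    proof -
      have "{x, y} \<notin> F" using that(1) disj by blast
      then show ?thesis using that(2) by blast
    qed
    have r: "(u, w) \<in> reach (E \<union> F) \<longleftrightarrow> (u, w) \<in> reach E" for w
      using reach_in_closed_part[of u w "E \<union> F" "\<Union>E" E] u cl reach_mono[of E "E \<union> F" u w] by blast
    \<comment> \<open>An empty edge would satisfy the condition vacuously; edges being nonempty is
      what excludes those of \<open>F\<close>.\<close>
    have "e \<notin> F" if "\<forall>w\<in>e. (u, w) \<in> reach E" for e
    proof
      assume e: "e \<in> F"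
      then obtain w where w: "w \<in> e" using pl_edges_nonempty[OF F] by blast
      then have "(u, w) \<in> reach E" using that by blast
      then have "w \<in> \<Union>E"
        using reach_in_closed_part[of u w E "\<Union>E" E] u by blast
      then show False using disj e w by blast
    qed
    then show ?thesis unfolding component_edges_def r by blast
  qed
  have "component_edges (E \<union> F) ` \<Union>E = comps E"
    by (rule image_cong[OF refl]) (rule one[OF _ disj F])
  moreover have "component_edges (E \<union> F) ` \<Union>F = comps F"
    by (rule image_cong[OF refl]) (metis one[OF _ _ E] disj Int_commute Un_commute)
  ultimately show ?thesis by (simp add: Union_Un_distrib image_Un)
qed

lemma graph_components_abs:
  "pl_edges E \<Longrightarrow> graph_components (abs_plgraph E) = image_mset abs_plgraph (mset_set (comps E))"
  by (rule graph_components.abs_eq) (rule pl_iso_refl)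

lemma finite_comps: "pl_edges E \<Longrightarrow> finite (comps E)"
  using pl_edges_finite_Union by blast

text \<open>As edge sets, the components of the two sides are different, so \<open>mset_set\<close>
  loses nothing. Isomorphic components are identified only afterwards, where they count with
  multiplicity.\<close>

lemma graph_components_Un_disjoint:
  assumes E: "pl_edges E" and F: "pl_edges F" and disj: "\<Union>E \<inter> \<Union>F = {}"
  shows "graph_components (abs_plgraph (E \<union> F)) =
    graph_components (abs_plgraph E) + graph_components (abs_plgraph F)"
proof -
  have "comps E \<inter> comps F = {}"
  proof (rule ccontr)
    assume "comps E \<inter> comps F \<noteq> {}"
    then obtain c where c: "c \<in> comps E" "c \<in> comps F" by blast
    then have "c \<subseteq> E \<inter> F" using comps_subset by blast
    moreover obtain e where "e \<in> c" using comps_nonempty[OF E c(1)] by blast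
    ultimately have "e \<in> E" "e \<in> F" "e \<noteq> {}" using pl_edges_nonempty[OF E] by auto
    then show False using disj by blast
  qed
  then show ?thesis
    using E F by (simp only: graph_components_abs pl_edges_Un comps_Un_disjoint[OF assms]
        mset_set_Union finite_comps image_mset_union)
qed

lemma set_graph_components_abs:
  "pl_edges E \<Longrightarrow> set_mset (graph_components (abs_plgraph E)) = abs_plgraph ` comps E"
  using finite_comps by (simp add: graph_components_abs)

section \<open>Products on representatives and finiteness of the basis\<close>

lemma glue_abs:
  "pl_edges E \<Longrightarrow> pl_edges F \<Longrightarrow> glue (abs_plgraph E) (abs_plgraph F) = abs_plgraph (glue_edges E F)"
  by (intro glue.abs_eq pl_iso_refl)

abbreviation unl_edges :: "vertex set set \<Rightarrow> vertex set set" where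
  "unl_edges E \<equiv> (\<lambda>e. unl ` e) ` E"

lemma unlabel_abs: "pl_edges E \<Longrightarrow> unlabel (abs_plgraph E) = abs_plgraph (unl_edges E)"
  by (intro unlabel.abs_eq pl_iso_refl)

lemma moment_matrix_abs:
  "pl_edges E \<Longrightarrow> pl_edges F \<Longrightarrow> moment_matrix (abs_plgraph E) (abs_plgraph F) =
     graph_components (abs_plgraph (unl_edges (glue_edges E F)))"
  by (simp add: moment_matrix_def glue_abs unlabel_abs pl_edges_glue)

lemma num_edges_abs: "pl_edges E \<Longrightarrow> num_edges (abs_plgraph E) = card E"
  by (intro num_edges.abs_eq pl_iso_refl)

lemma labels_abs: "pl_edges E \<Longrightarrow> labels (abs_plgraph E) = {i. Lab i \<in> \<Union>E}"
  by (intro labels.abs_eq pl_iso_refl)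

lemma pl_edges_empty: "pl_edges {}"
  by (simp add: pl_edges_def)

lemma basis_iff: "A \<in> basis d l \<longleftrightarrow> num_edges A \<le> d \<and> labels A \<subseteq> {1..l}"
  using num_edges_abs[OF pl_edges_empty] labels_abs[OF pl_edges_empty]
  by (auto simp: basis_def empty_graph_def)

lemma basis_abs:
  "pl_edges E \<Longrightarrow> abs_plgraph E \<in> basis d l \<longleftrightarrow> card E \<le> d \<and> (\<forall>i. Lab i \<in> \<Union>E \<longrightarrow> i \<in> {1..l})"
  by (auto simp: basis_iff num_edges_abs labels_abs)

lemma basis_mono_edges:
  assumes "pl_edges E" "F \<subseteq> E" "abs_plgraph E \<in> basis d l"
  shows "abs_plgraph F \<in> basis d l"
proof -
  have "card F \<le> card E" using assms(1,2) by (intro card_mono) (auto simp: pl_edges_def)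
  moreover have "\<Union>F \<subseteq> \<Union>E" using assms(2) by blast
  ultimately show ?thesis
    using assms(3) unfolding basis_abs[OF assms(1)] basis_abs[OF pl_edges_subset[OF assms(1,2)]]
    by (meson le_trans subsetD)
qed

lemma moment_matrix_commute: "moment_matrix A B = moment_matrix B A"
proof -
  let ?E = "rep_plgraph A" and ?F = "rep_plgraph B"
  \<comment> \<open>Exchanges \<open>2 * j\<close> and \<open>2 * j + 1\<close>, the values that
    \<open>tag0\<close> and \<open>tag1\<close> give to unlabeled vertices, and fixes the
    labels.\<close>
  define h where "h v = (case v of Lab i \<Rightarrow> Lab i | Unl j \<Rightarrow> if even j then Unl (j + 1) else Unl (j - 1))" for v
  have h0: "h (tag0 v) = tag1 v" and h1: "h (tag1 v) = tag0 v" for v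
    by (cases v; simp add: h_def)+
  have "inj h"
    by (rule injI) (auto simp: h_def split: vertex.splits if_splits, presburger+)
  moreover have "h v = Lab i \<longleftrightarrow> v = Lab i" for v i by (auto simp: h_def split: vertex.splits)
  moreover have "glue_edges ?F ?E = (\<lambda>e. h ` e) ` glue_edges ?E ?F"
    by (simp add: glue_edges_def image_Un image_image h0 h1 Un_commute)
  ultimately have "pl_iso_via h (glue_edges ?E ?F) (glue_edges ?F ?E)"
    by (auto simp: pl_iso_via_def intro: inj_on_subset)
  then have "glue (abs_plgraph ?E) (abs_plgraph ?F) = glue (abs_plgraph ?F) (abs_plgraph ?E)"
    by (simp add: glue_abs pl_edges_rep abs_plgraph_eqI[OF pl_edges_glue pl_edges_glue])
  then show ?thesis by (simp add: abs_rep_plgraph moment_matrix_def)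
qed

text \<open>A component of [[AB]] is itself an unlabeled product: keep those edges of
  \<open>A\<close> and of \<open>B\<close> whose copies lie in it. Deleting edges does not leave the
  basis.\<close>

lemma component_of_product_in_variables:
  assumes A: "A \<in> basis d l" and B: "B \<in> basis d l"
  shows "set_mset (moment_matrix A B) \<subseteq> variables d l"
proof -
  let ?E = "rep_plgraph A" and ?F = "rep_plgraph B"
  let ?G = "unl_edges (glue_edges ?E ?F)"
  have E: "pl_edges ?E" "abs_plgraph ?E \<in> basis d l" and F: "pl_edges ?F" "abs_plgraph ?F \<in> basis d l"
    using assms by (simp_all add: pl_edges_rep abs_rep_plgraph)
  have G: "pl_edges ?G" by (intro pl_edges_unl pl_edges_glue E F)
  have "abs_plgraph c \<in> variables d l" if c: "c \<in> comps ?G" for c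
  proof -
    define E1 F1 where "E1 = {e \<in> ?E. unl ` tag0 ` e \<in> c}" and "F1 = {e \<in> ?F. unl ` tag1 ` e \<in> c}"
    have E1: "pl_edges E1" "abs_plgraph E1 \<in> basis d l" and F1: "pl_edges F1" "abs_plgraph F1 \<in> basis d l"
      using pl_edges_subset[OF E(1), of E1] basis_mono_edges[OF E(1) _ E(2), of E1]
        pl_edges_subset[OF F(1), of F1] basis_mono_edges[OF F(1) _ F(2), of F1]
      by (auto simp: E1_def F1_def)
    have "c \<subseteq> ?G" using comps_subset[OF c] .
    then have ceq: "c = unl_edges (glue_edges E1 F1)"
      unfolding E1_def F1_def glue_edges_def by auto
    then have eq: "abs_plgraph c = unlabel (glue (abs_plgraph E1) (abs_plgraph F1))"
      by (simp add: glue_abs unlabel_abs pl_edges_glue E1 F1)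
    have pc: "pl_edges c" using pl_edges_subset[OF G comps_subset[OF c]] .
    then have "connected_graph (abs_plgraph c)"
      using connected_graph.abs_eq[OF pl_iso_refl[OF pc]] component_edges_connected[OF G c] by simp
    moreover have "abs_plgraph c \<noteq> empty_graph"
    proof
      assume "abs_plgraph c = empty_graph"
      then obtain f where "pl_iso_via f c {}"
        using abs_plgraph_eqD[OF pc pl_edges_empty] by (auto simp: empty_graph_def)
      then show False using comps_nonempty[OF G c] by (simp add: pl_iso_via_def)
    qed
    ultimately show ?thesis using E1(2) F1(2) unfolding variables_def eq by blast
  qed
  then show ?thesis
    using moment_matrix_abs[OF E(1) F(1)] set_graph_components_abs[OF G] by (auto simp: abs_rep_plgraph)
qed

text \<open>At most \<open>d\<close> edges touch at most \<open>2 * d\<close> vertices, so the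
  unlabeled ones can be renamed into a fixed finite set. This is the source of the finiteness of the
  basis.\<close>

lemma pl_edges_canonical_representative:
  assumes "pl_edges E" "card E \<le> d"
  shows "\<exists>F. pl_edges F \<and> \<Union>F \<subseteq> {v \<in> \<Union>E. \<exists>i. v = Lab i} \<union> Unl ` {..<2 * d} \<and> abs_plgraph F = abs_plgraph E"
proof -
  let ?U = "{v \<in> \<Union>E. \<exists>j. v = Unl j}"
  have fin: "finite (\<Union>E)" by (rule pl_edges_finite_Union[OF assms(1)])
  have "card (\<Union>E) \<le> (\<Sum>e\<in>E. card e)" by (rule card_Union_le_sum_card)
  also have "\<dots> = 2 * card E" using assms(1) by (simp add: pl_edges_def)
  finally have "card ?U \<le> 2 * d"
    using card_mono[OF fin, of ?U] assms(2) by fastforce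
  moreover have "finite ?U" by (rule finite_subset[OF _ fin]) blast
  ultimately obtain g where g: "inj_on g ?U" "g ` ?U \<subseteq> {..<2 * d}"
    using inj_on_iff_card_le[of ?U "{..<2 * d}"] by auto
  define f where "f v = (case v of Lab i \<Rightarrow> Lab i | Unl j \<Rightarrow> Unl (g v))" for v
  let ?F = "(\<lambda>e. f ` e) ` E"
  have inj: "inj_on f (\<Union>E)"
  proof (rule inj_onI)
    fix u v assume "u \<in> \<Union>E" "v \<in> \<Union>E" "f u = f v"
    then show "u = v" using inj_onD[OF g(1), of u v] by (auto simp: f_def split: vertex.splits)
  qed
  have lab: "f v = Lab i \<longleftrightarrow> v = Lab i" for v i by (auto simp: f_def split: vertex.splits)
  have via: "pl_iso_via f E ?F" using inj lab by (simp add: pl_iso_via_def)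
  have "card (f ` e) = 2" if "e \<in> E" for e
    using card_image[OF inj_on_subset[OF inj], of e] that assms(1) by (auto simp: pl_edges_def)
  moreover have "Lab 0 \<notin> \<Union>?F"
    using assms(1) lab unfolding pl_iso_via_Union[OF via] pl_edges_def by (metis imageE)
  ultimately have F: "pl_edges ?F" using assms(1) by (auto simp: pl_edges_def)
  have "\<Union>?F \<subseteq> {v \<in> \<Union>E. \<exists>i. v = Lab i} \<union> Unl ` {..<2 * d}"
    unfolding pl_iso_via_Union[OF via]
  proof
    fix w assume "w \<in> f ` \<Union>E"
    then obtain v where v: "v \<in> \<Union>E" "w = f v" by blast
    then show "w \<in> {v \<in> \<Union>E. \<exists>i. v = Lab i} \<union> Unl ` {..<2 * d}"
      using g(2) by (cases v) (auto simp: f_def)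
  qed
  then show ?thesis using F abs_plgraph_eqI[OF assms(1) F via] by metis
qed

lemma finite_basis: "finite (basis d l)"
proof -
  let ?X = "Lab ` {1..l} \<union> Unl ` {..<2 * d}"
  have "basis d l \<subseteq> abs_plgraph ` Pow (Pow ?X)"
  proof
    fix A assume A: "A \<in> basis d l"
    let ?E = "rep_plgraph A"
    have c: "card ?E \<le> d" and l: "\<forall>i. Lab i \<in> \<Union>?E \<longrightarrow> i \<in> {1..l}"
      using A basis_abs[OF pl_edges_rep[of A]] by (simp_all add: abs_rep_plgraph)
    obtain F where F: "pl_edges F \<and> \<Union>F \<subseteq> {v \<in> \<Union>?E. \<exists>i. v = Lab i} \<union> Unl ` {..<2 * d}
        \<and> abs_plgraph F = abs_plgraph ?E"
      using pl_edges_canonical_representative[OF pl_edges_rep c] by (rule exE)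
    have "{v \<in> \<Union>?E. \<exists>i. v = Lab i} \<subseteq> Lab ` {1..l}" using l by (auto simp del: atLeastAtMost_iff)
    then have "\<Union>F \<subseteq> ?X" using F by (meson Un_mono order_refl order_trans)
    then have "F \<in> Pow (Pow ?X)" by (metis PowI Union_upper order_trans subsetI)
    then show "A \<in> abs_plgraph ` Pow (Pow ?X)" using F by (metis abs_rep_plgraph image_eqI)
  qed
  then show ?thesis by (rule finite_subset) simp
qed

lemma finite_variables: "finite (variables d l)"
proof -
  have "variables d l \<subseteq> (\<lambda>(A, B). unlabel (glue A B)) ` (basis d l \<times> basis d l)"
    unfolding variables_def by auto
  then show ?thesis by (rule finite_subset) (simp add: finite_basis)
qed

lemma reduced_basis_subset: "reduced_basis d l \<subseteq> basis d l"
  by (auto simp: reduced_basis_def basis_def)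

text \<open>\<open>E1\<close> collects the components of a representative that carry a label,
  \<open>E2\<close> the others. A component of \<open>E1\<close> is a component of the whole graph,
  hence one of those selected for having a label.\<close>

lemma split_unlabeled_components:
  "\<exists>E1 E2. pl_edges (E1 \<union> E2) \<and> \<Union>E1 \<inter> \<Union>E2 = {} \<and> (\<forall>i. Lab i \<notin> \<Union>E2)
     \<and> A = abs_plgraph (E1 \<union> E2) \<and> (A \<in> basis d l \<longrightarrow> abs_plgraph E1 \<in> reduced_basis d l)"
proof -
  let ?E = "rep_plgraph A"
  define K where "K = comps ?E"
  define E1 E2 where "E1 = \<Union>{c \<in> K. \<exists>i. Lab i \<in> \<Union>c}" and "E2 = \<Union>{c \<in> K. \<not> (\<exists>i. Lab i \<in> \<Union>c)}"
  have "E1 \<union> E2 = \<Union>K" unfolding E1_def E2_def by blast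
  then have un: "E1 \<union> E2 = ?E" using Union_comps[OF pl_edges_rep] by (simp add: K_def)
  have disj: "\<Union>E1 \<inter> \<Union>E2 = {}"
  proof (rule ccontr)
    assume "\<Union>E1 \<inter> \<Union>E2 \<noteq> {}"
    then obtain w where w: "w \<in> \<Union>E1" "w \<in> \<Union>E2" by blast
    obtain c where c: "c \<in> K" "w \<in> \<Union>c" "\<exists>i. Lab i \<in> \<Union>c" using w(1) unfolding E1_def by blast
    obtain c' where c': "c' \<in> K" "w \<in> \<Union>c'" "\<not> (\<exists>i. Lab i \<in> \<Union>c')" using w(2) unfolding E2_def by blast
    have "c \<noteq> c'" using c(3) c'(3) by metis
    then have "\<Union>c \<inter> \<Union>c' = {}" using comps_eq_or_disjoint c(1) c'(1) unfolding K_def by metis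
    then show False using c(2) c'(2) by blast
  qed
  have nolab: "\<forall>i. Lab i \<notin> \<Union>E2" unfolding E2_def by blast
  have p: "pl_edges E1" "pl_edges E2"
    using pl_edges_subset[OF pl_edges_rep] un by blast+
  have "abs_plgraph E1 \<in> reduced_basis d l" if A: "A \<in> basis d l"
  proof -
    have "abs_plgraph E1 \<in> basis d l"
      using basis_mono_edges[OF pl_edges_rep, of E1 A] un A by (auto simp: abs_rep_plgraph)
    moreover have "labels C \<noteq> {}" if "C \<in># graph_components (abs_plgraph E1)" for C
    proof -
      have "C \<in> abs_plgraph ` comps E1"
        using that unfolding set_graph_components_abs[OF p(1)] .
      then obtain c where c: "c \<in> comps E1" "C = abs_plgraph c" by (metis imageE)
      have c': "c \<in> comps ?E" using UnI1[OF c(1), of "comps E2"] comps_Un_disjoint[OF p disj] un by metis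
      obtain e where e: "e \<in> c" using comps_nonempty[OF p(1) c(1)] by (meson ex_in_conv)
      then have "e \<in> E1" using comps_subset[OF c(1)] by (meson subsetD)
      then obtain c'' where c'': "c'' \<in> K" "e \<in> c''" "\<exists>i. Lab i \<in> \<Union>c''"
        unfolding E1_def by blast
      have "e \<noteq> {}" using pl_edges_nonempty[OF p(1) \<open>e \<in> E1\<close>] .
      then have "c = c''" 
        using comps_eq_or_disjoint[OF c' c''(1)[unfolded K_def]] e c''(2) by blast
      then show ?thesis
        using c''(3) labels_abs[OF pl_edges_subset[OF p(1) comps_subset[OF c(1)]]] c(2) by auto
    qed
    ultimately show ?thesis by (auto simp: reduced_basis_def)
  qed
  then show ?thesis
    by (intro exI[of _ E1] exI[of _ E2] conjI impI disj nolab) (simp_all add: un pl_edges_rep abs_rep_plgraph)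
qed

text \<open>Where there are no labels, an injective renaming only has to avoid creating some.
  Applied to the renamings that gluing and unlabeling perform on an unlabeled part.\<close>

lemma unlabeled_copy:
  assumes E: "pl_edges E" and nolab: "\<forall>i. Lab i \<notin> \<Union>E" and f: "inj f" and fl: "\<And>v i. f v = Lab i \<Longrightarrow> v = Lab i"
  shows "pl_edges ((\<lambda>e. f ` e) ` E) \<and> abs_plgraph ((\<lambda>e. f ` e) ` E) = abs_plgraph E"
proof -
  have via: "pl_iso_via f E ((\<lambda>e. f ` e) ` E)"
    unfolding pl_iso_via_def using inj_on_subset[OF f] nolab fl by (metis subset_UNIV)
  have "card (f ` e) = card e" for e using card_image inj_on_subset[OF f] by blast
  moreover have "Lab 0 \<notin> \<Union>((\<lambda>e. f ` e) ` E)" using nolab fl by (metis imageE pl_iso_via_Union[OF via])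
  ultimately have "pl_edges ((\<lambda>e. f ` e) ` E)" using E by (auto simp: pl_edges_def)
  then show ?thesis using abs_plgraph_eqI[OF E _ via] by simp
qed

text \<open>The images of \<open>tag0\<close> and \<open>tag1\<close> meet only in labels. The
  copies of \<open>E2\<close> and \<open>F2\<close> are therefore disjoint from each other and from
  the product of \<open>E1\<close> and \<open>F1\<close>, and split off as separate factors.\<close>

lemma moment_matrix_factor:
  assumes E: "pl_edges (E1 \<union> E2)" "\<Union>E1 \<inter> \<Union>E2 = {}" "\<forall>i. Lab i \<notin> \<Union>E2"
    and F: "pl_edges (F1 \<union> F2)" "\<Union>F1 \<inter> \<Union>F2 = {}" "\<forall>i. Lab i \<notin> \<Union>F2"
  shows "moment_matrix (abs_plgraph (E1 \<union> E2)) (abs_plgraph (F1 \<union> F2)) =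
    moment_matrix (abs_plgraph E1) (abs_plgraph F1)
      + graph_components (abs_plgraph E2) + graph_components (abs_plgraph F2)"
proof -
  have p: "pl_edges E1" "pl_edges E2" "pl_edges F1" "pl_edges F2"
    using pl_edges_subset E(1) F(1) by (meson Un_upper1 Un_upper2)+
  let ?f = "\<lambda>v. unl (tag0 v)" and ?g = "\<lambda>v. unl (tag1 v)"
  let ?X = "unl_edges (glue_edges E1 F1)" and ?Y = "(\<lambda>e. ?f ` e) ` E2" and ?Z = "(\<lambda>e. ?g ` e) ` F2"
  have inj: "inj ?f" "inj ?g"
    using inj_compose[OF unl_inj tag0_inj] inj_compose[OF unl_inj tag1_inj] by (simp_all add: comp_def)
  have nl: "unl v \<noteq> Lab i" for v i by (cases v) auto
  have Y: "pl_edges ?Y \<and> abs_plgraph ?Y = abs_plgraph E2"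
    by (rule unlabeled_copy[OF p(2) E(3) inj(1)]) (simp add: nl)
  have Z: "pl_edges ?Z \<and> abs_plgraph ?Z = abs_plgraph F2"
    by (rule unlabeled_copy[OF p(4) F(3) inj(2)]) (simp add: nl)
  have X: "pl_edges ?X" by (intro pl_edges_unl pl_edges_glue p)
  have eq: "unl_edges (glue_edges (E1 \<union> E2) (F1 \<union> F2)) = (?X \<union> ?Y) \<union> ?Z"
    unfolding glue_edges_def image_Un image_image by blast
  have UX: "\<Union>?X = ?f ` \<Union>E1 \<union> ?g ` \<Union>F1" and UY: "\<Union>?Y = ?f ` \<Union>E2" and UZ: "\<Union>?Z = ?g ` \<Union>F2"
    by (auto simp: glue_edges_def)
  have cross: "?f u = ?g w \<Longrightarrow> \<exists>i. u = Lab i \<and> w = Lab i" for u w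
    using injD[OF unl_inj] tag0_eq_tag1 by blast
  have ff: "?f u = ?f w \<Longrightarrow> u = w" and gg: "?g u = ?g w \<Longrightarrow> u = w" for u w
    using injD[OF inj(1)] injD[OF inj(2)] by blast+
  have XY: "\<Union>?X \<inter> \<Union>?Y = {}"
  proof (rule ccontr)
    assume "\<Union>?X \<inter> \<Union>?Y \<noteq> {}"
    then obtain z where z: "z \<in> ?f ` \<Union>E1 \<union> ?g ` \<Union>F1" "z \<in> ?f ` \<Union>E2"
      unfolding UX UY by (metis disjoint_iff)
    from z(2) obtain w where "w \<in> \<Union>E2" "z = ?f w" by (rule imageE)
    then have w: "w \<in> \<Union>E2" "?f w \<in> ?f ` \<Union>E1 \<or> ?f w \<in> ?g ` \<Union>F1" using z(1) by auto
    from w(2) show False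
    proof
      assume "?f w \<in> ?f ` \<Union>E1"
      then have "w \<in> \<Union>E1" using ff by blast
      then show False using E(2) w(1) by blast
    next
      assume "?f w \<in> ?g ` \<Union>F1"
      then obtain i where "w = Lab i" using cross by blast
      then show False using E(3) w(1) by blast
    qed
  qed
  have XYZ: "\<Union>(?X \<union> ?Y) \<inter> \<Union>?Z = {}"
  proof (rule ccontr)
    assume "\<Union>(?X \<union> ?Y) \<inter> \<Union>?Z \<noteq> {}"
    then obtain z where z: "z \<in> ?f ` \<Union>E1 \<union> ?g ` \<Union>F1 \<union> ?f ` \<Union>E2" "z \<in> ?g ` \<Union>F2"
      unfolding Union_Un_distrib UX UY UZ by (metis disjoint_iff)
    from z(2) obtain w where "w \<in> \<Union>F2" "z = ?g w" by (rule imageE)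
    then have w: "w \<in> \<Union>F2" "?g w \<in> ?g ` \<Union>F1 \<or> ?g w \<in> ?f ` (\<Union>E1 \<union> \<Union>E2)"
      using z(1) unfolding image_Un by auto
    from w(2) show False
    proof
      assume "?g w \<in> ?g ` \<Union>F1"
      then have "w \<in> \<Union>F1" using gg by blast
      then show False using F(2) w(1) by blast
    next
      assume "?g w \<in> ?f ` (\<Union>E1 \<union> \<Union>E2)"
      then obtain u where "?f u = ?g w" by (metis imageE)
      then obtain i where "w = Lab i" using cross by blast
      then show False using F(3) w(1) by blast
    qed
  qed
  have XYp: "pl_edges (?X \<union> ?Y)" using pl_edges_Un X Y by blast
  have "graph_components (abs_plgraph ((?X \<union> ?Y) \<union> ?Z)) =
      graph_components (abs_plgraph ?X) + graph_components (abs_plgraph ?Y) + graph_components (abs_plgraph ?Z)"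
    using graph_components_Un_disjoint[OF XYp _ XYZ] graph_components_Un_disjoint[OF X _ XY] Y Z by simp
  then show ?thesis
    unfolding moment_matrix_abs[OF E(1) F(1)] moment_matrix_abs[OF p(1,3)] eq using Y Z by simp
qed


section \<open>Densities of products as averages over the labels\<close>

definition avg :: "'a set \<Rightarrow> 'b set \<Rightarrow> (('a \<Rightarrow> 'b) \<Rightarrow> real) \<Rightarrow> real" where
  "avg X W f = (\<Sum>\<phi>\<in>X \<rightarrow>\<^sub>E W. f \<phi>) / card (X \<rightarrow>\<^sub>E W)"

abbreviation hom_ind :: "'a set set \<Rightarrow> 'b set set \<Rightarrow> ('a \<Rightarrow> 'b) \<Rightarrow> real" where
  "hom_ind E D \<phi> \<equiv> of_bool (\<forall>e\<in>E. \<phi> ` e \<in> D)"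

lemma hom_ind_cong: "(\<And>v. v \<in> \<Union>E \<Longrightarrow> \<phi> v = \<psi> v) \<Longrightarrow> hom_ind E D \<phi> = hom_ind E D \<psi>"
proof -
  assume "\<And>v. v \<in> \<Union>E \<Longrightarrow> \<phi> v = \<psi> v"
  then have "\<phi> ` e = \<psi> ` e" if "e \<in> E" for e using that by (intro image_cong) auto
  then show ?thesis by simp
qed

lemma avg_cong: "(\<And>\<phi>. \<phi> \<in> X \<rightarrow>\<^sub>E W \<Longrightarrow> f \<phi> = g \<phi>) \<Longrightarrow> avg X W f = avg X W g"
  by (simp add: avg_def cong: sum.cong)

lemma avg_cmult: "avg X W (\<lambda>\<phi>. c * f \<phi>) = c * avg X W f"
  by (simp add: avg_def sum_distrib_left)

lemma avg_mult_const: "avg X W (\<lambda>\<phi>. f \<phi> * c) = avg X W f * c"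
  by (simp add: avg_def sum_distrib_right)

lemma avg_const:
  assumes "finite X" "finite W" "W \<noteq> {}"
  shows "avg X W (\<lambda>_. c) = c"
proof -
  have "card (X \<rightarrow>\<^sub>E W) > 0" using assms by (simp add: card_PiE card_gt_0_iff)
  then show ?thesis by (simp add: avg_def)
qed

text \<open>Fubini for a uniformly random map: its restrictions to disjoint domains are independent
  and uniform.\<close>

lemma avg_Un:
  assumes "finite X" "finite Y" "X \<inter> Y = {}" "finite W"
  shows "avg (X \<union> Y) W f = avg X W (\<lambda>\<phi>. avg Y W (\<lambda>\<psi>. f (override_on \<phi> \<psi> Y)))"
proof -
  have "(\<Sum>\<phi>\<in>X \<rightarrow>\<^sub>E W. \<Sum>\<psi>\<in>Y \<rightarrow>\<^sub>E W. f (override_on \<phi> \<psi> Y)) =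
      (\<Sum>(\<phi>, \<psi>)\<in>(X \<rightarrow>\<^sub>E W) \<times> (Y \<rightarrow>\<^sub>E W). f (override_on \<phi> \<psi> Y))"
    by (rule sum.cartesian_product)
  also have "\<dots> = (\<Sum>\<eta>\<in>(X \<union> Y) \<rightarrow>\<^sub>E W. f \<eta>)"
  proof (rule sum.reindex_bij_witness[where j = "\<lambda>(\<phi>, \<psi>). override_on \<phi> \<psi> Y"
        and i = "\<lambda>\<eta>. (restrict \<eta> X, restrict \<eta> Y)"], goal_cases)
    case (1 p)
    then show ?case using assms(3)
      by (fastforce simp: fun_eq_iff override_on_def PiE_iff extensional_def)
  next
    case (2 p)
    then show ?case by (auto simp: override_on_def PiE_iff extensional_def)
  next
    case (3 \<eta>)
    then show ?case
      by (auto simp: fun_eq_iff override_on_def PiE_iff extensional_def)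
  next
    case (4 \<eta>)
    then show ?case by auto
  next
    case (5 p)
    then show ?case by auto
  qed
  finally have *: "(\<Sum>\<phi>\<in>X \<rightarrow>\<^sub>E W. \<Sum>\<psi>\<in>Y \<rightarrow>\<^sub>E W. f (override_on \<phi> \<psi> Y)) = (\<Sum>\<eta>\<in>(X \<union> Y) \<rightarrow>\<^sub>E W. f \<eta>)" .
  have "card ((X \<union> Y) \<rightarrow>\<^sub>E W) = card (X \<rightarrow>\<^sub>E W) * card (Y \<rightarrow>\<^sub>E W)"
    using assms by (simp add: card_PiE prod.union_disjoint card_Un_disjoint power_add)
  then show ?thesis
    unfolding avg_def sum_divide_distrib[symmetric] * by simp
qed

lemma avg_reindex:
  assumes "bij_betw h X Y" "finite X"
  shows "avg Y W f = avg X W (\<lambda>\<phi>. f (\<lambda>y\<in>Y. \<phi> (inv_into X h y)))"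
proof -
  have inv: "inv_into X h (h x) = x" if "x \<in> X" for x
    using assms(1) that by (simp add: bij_betw_def)
  have inv': "h (inv_into X h y) = y" "inv_into X h y \<in> X" if "y \<in> Y" for y
    using assms(1) that by (auto simp: bij_betw_def f_inv_into_f inv_into_into)
  have hY: "h x \<in> Y" if "x \<in> X" for x using assms(1) that by (auto simp: bij_betw_def)
  have "(\<Sum>\<phi>\<in>Y \<rightarrow>\<^sub>E W. f \<phi>) = (\<Sum>\<phi>\<in>X \<rightarrow>\<^sub>E W. f (\<lambda>y\<in>Y. \<phi> (inv_into X h y)))"
    by (rule sum.reindex_bij_witness[where j = "\<lambda>\<psi>. \<lambda>x\<in>X. \<psi> (h x)"
          and i = "\<lambda>\<phi>. \<lambda>y\<in>Y. \<phi> (inv_into X h y)"])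
      (use inv inv' hY in \<open>auto simp: fun_eq_iff PiE_iff extensional_def intro!: arg_cong[where f = f]\<close>)
  moreover have "card (Y \<rightarrow>\<^sub>E W) = card (X \<rightarrow>\<^sub>E W)"
    using assms bij_betw_finite[OF assms(1)] bij_betw_same_card[OF assms(1)] by (simp add: card_PiE)
  ultimately show ?thesis by (simp add: avg_def)
qed

definition edge_density :: "vertex set set \<Rightarrow> nat set \<Rightarrow> nat set set \<Rightarrow> real" where
  "edge_density E W D = avg (\<Union>E) W (hom_ind E D)"

lemma hom_density_abs:
  assumes "pl_edges E" "finite W"
  shows "hom_density (abs_plgraph E) W D = edge_density E W D"
proof -
  have "finite (\<Union>E \<rightarrow>\<^sub>E W)" by (intro finite_PiE pl_edges_finite_Union assms)
  then have "(\<Sum>\<phi>\<in>\<Union>E \<rightarrow>\<^sub>E W. hom_ind E D \<phi>) = card {\<phi> \<in> \<Union>E \<rightarrow>\<^sub>E W. \<forall>e\<in>E. \<phi> ` e \<in> D}"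
    by (simp add: of_bool_def sum.If_cases Int_def)
  then show ?thesis
    by (simp add: hom_density.abs_eq[OF pl_iso_refl[OF assms(1)]] edge_density_def avg_def)
qed

lemma edge_density_superset:
  assumes "finite X" "\<Union>E \<subseteq> X" "finite W" "W \<noteq> {}"
  shows "edge_density E W D = avg X W (hom_ind E D)"
proof -
  have "avg (\<Union>E \<union> (X - \<Union>E)) W (hom_ind E D) =
      avg (\<Union>E) W (\<lambda>\<phi>. avg (X - \<Union>E) W (\<lambda>\<psi>. hom_ind E D (override_on \<phi> \<psi> (X - \<Union>E))))"
    using assms finite_subset[OF assms(2,1)] by (intro avg_Un) auto
  also have "\<dots> = avg (\<Union>E) W (\<lambda>\<phi>. avg (X - \<Union>E) W (\<lambda>\<psi>. hom_ind E D \<phi>))"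
    by (intro avg_cong hom_ind_cong) (auto simp: override_on_def)
  also have "\<dots> = edge_density E W D"
    using assms by (simp add: avg_const edge_density_def)
  finally show ?thesis using assms(2) by (simp add: Un_absorb1)
qed

lemma edge_density_Un_disjoint:
  assumes "pl_edges E" "pl_edges F" "\<Union>E \<inter> \<Union>F = {}" "finite W"
  shows "edge_density (E \<union> F) W D = edge_density E W D * edge_density F W D"
proof -
  have "edge_density (E \<union> F) W D = avg (\<Union>E \<union> \<Union>F) W (\<lambda>\<phi>. hom_ind E D \<phi> * hom_ind F D \<phi>)"
    unfolding edge_density_def Union_Un_distrib by (rule avg_cong) auto
  also have "\<dots> = avg (\<Union>E) W (\<lambda>\<phi>. avg (\<Union>F) W (\<lambda>\<psi>. hom_ind E D (override_on \<phi> \<psi> (\<Union>F)) *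
      hom_ind F D (override_on \<phi> \<psi> (\<Union>F))))"
    by (intro avg_Un pl_edges_finite_Union assms)
  also have "\<dots> = avg (\<Union>E) W (\<lambda>\<phi>. avg (\<Union>F) W (\<lambda>\<psi>. hom_ind E D \<phi> * hom_ind F D \<psi>))"
    using assms(3)
    by (intro avg_cong arg_cong2[where f = "(*)"] hom_ind_cong) (auto simp: override_on_def)
  also have "\<dots> = edge_density E W D * edge_density F W D"
    by (simp add: avg_cmult avg_mult_const edge_density_def)
  finally show ?thesis .
qed

lemma edge_density_Union_disjoint:
  assumes "finite \<C>" "\<And>c. c \<in> \<C> \<Longrightarrow> pl_edges c" "finite W" "W \<noteq> {}"
    and "\<And>c c'. c \<in> \<C> \<Longrightarrow> c' \<in> \<C> \<Longrightarrow> c \<noteq> c' \<Longrightarrow> \<Union>c \<inter> \<Union>c' = {}"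
  shows "edge_density (\<Union>\<C>) W D = (\<Prod>c\<in>\<C>. edge_density c W D)"
  using assms
proof (induction \<C>)
  case empty
  then show ?case by (simp add: edge_density_def avg_def)
next
  case (insert c \<C>)
  have "finite \<C>" by fact
  then have "pl_edges (\<Union>\<C>)" using insert.prems(1) unfolding pl_edges_def by auto
  moreover have "\<Union>c \<inter> \<Union>(\<Union>\<C>) = {}"
  proof -
    have "\<Union>c \<inter> \<Union>c' = {}" if "c' \<in> \<C>" for c' using insert that by (metis insertCI)
    then show ?thesis by blast
  qed
  ultimately have "edge_density (c \<union> \<Union>\<C>) W D = edge_density c W D * edge_density (\<Union>\<C>) W D"
    using insert.prems by (intro edge_density_Un_disjoint) auto
  then show ?case using insert by simp
qed

text \<open>Densities are multiplicative over disjoint unions, so substituting densities for the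
  variables of a monomial returns the density of the graph that the monomial encodes.\<close>

lemma eval_monomial_hom_density:
  assumes "pl_edges E" "finite W" "W \<noteq> {}"
  shows "eval_monomial (graph_components (abs_plgraph E)) (\<lambda>C. hom_density C W D) = edge_density E W D"
proof -
  have c: "pl_edges c" if "c \<in> comps E" for c
    using pl_edges_subset[OF assms(1) comps_subset[OF that]] .
  have "eval_monomial (graph_components (abs_plgraph E)) (\<lambda>C. hom_density C W D)
      = (\<Prod>c\<in>comps E. hom_density (abs_plgraph c) W D)"
    by (simp add: eval_monomial_def graph_components_abs[OF assms(1)] image_mset.compositionality
        comp_def prod_unfold_prod_mset del: Union_iff)
  also have "\<dots> = (\<Prod>c\<in>comps E. edge_density c W D)"
    by (rule prod.cong[OF refl]) (rule hom_density_abs[OF c assms(2)])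
  also have "\<dots> = edge_density (\<Union>(comps E)) W D"
    by (rule edge_density_Union_disjoint[symmetric])
      (rule finite_comps[OF assms(1)] c assms(2,3) comps_eq_or_disjoint | assumption)+
  finally show ?thesis using Union_comps[OF assms(1)] by simp
qed

text \<open>\<open>f\<close> may move labels, since a density does not distinguish them from other
  vertices. With \<open>unl\<close> for \<open>f\<close> this says that unlabeling preserves
  densities.\<close>

lemma edge_density_inj_image:
  assumes "inj f" "pl_edges E"
  shows "edge_density ((\<lambda>e. f ` e) ` E) W D = edge_density E W D"
proof -
  let ?F = "(\<lambda>e. f ` e) ` E"
  have U: "\<Union>?F = f ` \<Union>E" by auto
  have bij: "bij_betw f (\<Union>E) (\<Union>?F)" unfolding U using assms(1) by (meson bij_betw_imageI inj_on_subset subset_UNIV)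
  have "edge_density ?F W D =
      avg (\<Union>E) W (\<lambda>\<phi>. hom_ind ?F D (\<lambda>y\<in>\<Union>?F. \<phi> (inv_into (\<Union>E) f y)))"
    unfolding edge_density_def by (rule avg_reindex[OF bij pl_edges_finite_Union[OF assms(2)]])
  also have "\<dots> = edge_density E W D"
    unfolding edge_density_def
  proof (rule avg_cong)
    fix \<phi> :: "vertex \<Rightarrow> nat"
    have "(\<lambda>y\<in>\<Union>?F. \<phi> (inv_into (\<Union>E) f y)) ` f ` e = \<phi> ` e" if "e \<in> E" for e
      unfolding image_image
    proof (rule image_cong[OF refl])
      fix v assume "v \<in> e"
      then have v: "v \<in> \<Union>E" using that by blast
      then have "inv_into (\<Union>E) f (f v) = v" using bij by (meson bij_betw_inv_into_left)
      moreover have "f v \<in> \<Union>?F" using v U by blast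
      ultimately show "(\<lambda>y\<in>\<Union>?F. \<phi> (inv_into (\<Union>E) f y)) (f v) = \<phi> v" by (simp only: restrict_apply if_True)
    qed
    then show "hom_ind ?F D (\<lambda>y\<in>\<Union>?F. \<phi> (inv_into (\<Union>E) f y)) = hom_ind E D \<phi>" by simp
  qed
  finally show ?thesis .
qed

definition unl_vertices :: "vertex set set \<Rightarrow> vertex set" where
  "unl_vertices E = \<Union>E - range Lab"

text \<open>Conditional probability of being a homomorphism, given that the labels are placed by
  \<open>\<phi>\<close>.\<close>

definition rooted_density :: "vertex set set \<Rightarrow> nat set \<Rightarrow> nat set set \<Rightarrow> (vertex \<Rightarrow> nat) \<Rightarrow> real" where
  "rooted_density E W D \<phi> =
     avg (unl_vertices E) W (\<lambda>\<psi>. hom_ind E D (override_on \<phi> \<psi> (unl_vertices E)))"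

lemma rooted_density_inj_image:
  assumes "inj f" "pl_edges E" and fLab: "\<And>i. f (Lab i) = Lab i"
  shows "rooted_density ((\<lambda>e. f ` e) ` E) W D \<phi> = rooted_density E W D \<phi>"
proof -
  let ?F = "(\<lambda>e. f ` e) ` E"
  let ?U = "unl_vertices E" and ?V = "unl_vertices ?F"
  have fl: "f v \<in> range Lab \<longleftrightarrow> v \<in> range Lab" for v
    using fLab injD[OF assms(1)] by (metis rangeE rangeI)
  have U: "?V = f ` ?U" using fl by (auto simp: unl_vertices_def)
  have bij: "bij_betw f ?U ?V" unfolding U using assms(1) by (meson bij_betw_imageI inj_on_subset subset_UNIV)
  have "finite ?U" using pl_edges_finite_Union[OF assms(2)] by (simp add: unl_vertices_def)
  then have "rooted_density ?F W D \<phi> =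
      avg ?U W (\<lambda>\<psi>. hom_ind ?F D (override_on \<phi> (\<lambda>y\<in>?V. \<psi> (inv_into ?U f y)) ?V))"
    unfolding rooted_density_def by (rule avg_reindex[OF bij])
  also have "\<dots> = rooted_density E W D \<phi>"
    unfolding rooted_density_def
  proof (rule avg_cong)
    fix \<psi> :: "vertex \<Rightarrow> nat"
    have "override_on \<phi> (\<lambda>y\<in>?V. \<psi> (inv_into ?U f y)) ?V ` f ` e = override_on \<phi> \<psi> ?U ` e" if "e \<in> E" for e
      unfolding image_image
    proof (rule image_cong[OF refl])
      fix v assume "v \<in> e"
      then have v: "v \<in> \<Union>E" using that by blast
      show "override_on \<phi> (\<lambda>y\<in>?V. \<psi> (inv_into ?U f y)) ?V (f v) = override_on \<phi> \<psi> ?U v"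
      proof (cases "v \<in> ?U")
        case True
        then have "inv_into ?U f (f v) = v" using bij by (meson bij_betw_inv_into_left)
        moreover have "f v \<in> ?V" using True U by blast
        ultimately show ?thesis using True by (simp add: override_on_def)
      next
        case False
        then obtain i where i: "v = Lab i" using v by (auto simp: unl_vertices_def)
        then have "f v = v" "f v \<notin> ?V" using fLab by (auto simp: unl_vertices_def)
        then show ?thesis using False by (simp add: override_on_def)
      qed
    qed
    then show "hom_ind ?F D (override_on \<phi> (\<lambda>y\<in>?V. \<psi> (inv_into ?U f y)) ?V) = hom_ind E D (override_on \<phi> \<psi> ?U)"
      by simp
  qed
  finally show ?thesis .
qed

text \<open>Once the labels are placed, the two factors depend on disjoint sets of unlabeled
  vertices and are independent. \<open>L\<close> may exceed the labels in use, so that one averaging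
  space serves all pairs of graphs.\<close>

lemma edge_density_unlabel_glue:
  assumes E: "pl_edges E" and F: "pl_edges F" and W: "finite W" "W \<noteq> {}"
    and L: "finite L" "L \<subseteq> range Lab" "\<Union>E \<inter> range Lab \<subseteq> L" "\<Union>F \<inter> range Lab \<subseteq> L"
  shows "edge_density (unl_edges (glue_edges E F)) W D =
    avg L W (\<lambda>\<phi>. rooted_density E W D \<phi> * rooted_density F W D \<phi>)"
proof -
  let ?E = "(\<lambda>e. tag0 ` e) ` E" and ?F = "(\<lambda>e. tag1 ` e) ` F"
  let ?U = "unl_vertices ?E" and ?V = "unl_vertices ?F"
  have UE: "\<Union>?E = tag0 ` \<Union>E" and UF: "\<Union>?F = tag1 ` \<Union>F" by auto
  have fin: "finite ?U" "finite ?V"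
    unfolding unl_vertices_def UE UF using pl_edges_finite_Union E F by auto
  have UV: "?U \<inter> ?V = {}"
  proof (rule equals0I)
    fix z assume "z \<in> ?U \<inter> ?V"
    then have z: "z \<in> tag0 ` \<Union>E" "z \<in> tag1 ` \<Union>F" "z \<notin> range Lab"
      unfolding unl_vertices_def UE UF by (simp_all only: Int_iff Diff_iff simp_thms)
    then obtain v w where "z = tag0 v" "z = tag1 w" by (metis imageE)
    then show False using tag0_eq_tag1 z(3) by (metis tag0.simps(1) rangeI)
  qed
  have LU: "L \<inter> (?U \<union> ?V) = {}" using L(2) unfolding unl_vertices_def by blast
  have t0: "tag0 v \<in> L" if "v \<in> \<Union>E" "tag0 v \<in> range Lab" for v
    using that L(3) tag0_Lab by (metis IntI rangeE subsetD rangeI)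
  have t1: "tag1 v \<in> L" if "v \<in> \<Union>F" "tag1 v \<in> range Lab" for v
    using that L(4) tag1_Lab by (metis IntI rangeE subsetD rangeI)
  have subE: "\<Union>?E \<subseteq> L \<union> ?U" 
    unfolding unl_vertices_def UE using t0 by (intro image_subsetI) (simp del: Union_iff, blast)
  have subF: "\<Union>?F \<subseteq> L \<union> ?V" 
    unfolding unl_vertices_def UF using t1 by (intro image_subsetI) (simp del: Union_iff, blast)
  have UFL: "v \<in> \<Union>?E \<Longrightarrow> v \<notin> ?V" and UEL: "v \<in> \<Union>?F \<Longrightarrow> v \<notin> ?U" for v
    using subsetD[OF subE] subsetD[OF subF] UV LU by (metis IntI UnE UnI1 UnI2 emptyE)+
  have "edge_density (unl_edges (glue_edges E F)) W D = edge_density (glue_edges E F) W D"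
    by (rule edge_density_inj_image[OF unl_inj pl_edges_glue[OF E F]])
  also have "\<dots> = avg (L \<union> (?U \<union> ?V)) W (hom_ind (?E \<union> ?F) D)"
    unfolding glue_edges_def
  proof (rule edge_density_superset)
    show "\<Union>(?E \<union> ?F) \<subseteq> L \<union> (?U \<union> ?V)"
      unfolding Union_Un_distrib using subE subF by (meson Un_least Un_mono Un_upper1 Un_upper2 order_refl order_trans)
  qed (use fin L(1) W in auto)
  also have "\<dots> = avg L W (\<lambda>\<phi>. avg (?U \<union> ?V) W (\<lambda>\<psi>. hom_ind (?E \<union> ?F) D (override_on \<phi> \<psi> (?U \<union> ?V))))"
    using fin L(1) LU W by (intro avg_Un) auto
  also have "\<dots> = avg L W (\<lambda>\<phi>. rooted_density ?E W D \<phi> * rooted_density ?F W D \<phi>)"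
  proof (rule avg_cong)
    fix \<phi> :: "vertex \<Rightarrow> nat"
    have "avg (?U \<union> ?V) W (\<lambda>\<psi>. hom_ind (?E \<union> ?F) D (override_on \<phi> \<psi> (?U \<union> ?V))) =
      avg ?U W (\<lambda>\<psi>. avg ?V W (\<lambda>\<eta>. hom_ind (?E \<union> ?F) D (override_on \<phi> (override_on \<psi> \<eta> ?V) (?U \<union> ?V))))"
      by (intro avg_Un fin UV W)
    also have "\<dots> = avg ?U W (\<lambda>\<psi>. avg ?V W (\<lambda>\<eta>. hom_ind ?E D (override_on \<phi> \<psi> ?U) * hom_ind ?F D (override_on \<phi> \<eta> ?V)))"
    proof (intro avg_cong)
      fix \<psi> \<eta> :: "vertex \<Rightarrow> nat"
      let ?g = "override_on \<phi> (override_on \<psi> \<eta> ?V) (?U \<union> ?V)"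
      have "hom_ind (?E \<union> ?F) D ?g = hom_ind ?E D ?g * hom_ind ?F D ?g" by auto
      also have "hom_ind ?E D ?g = hom_ind ?E D (override_on \<phi> \<psi> ?U)"
        by (rule hom_ind_cong) (use UFL in \<open>simp add: override_on_def del: Union_iff UN_iff\<close>)
      also have "hom_ind ?F D ?g = hom_ind ?F D (override_on \<phi> \<eta> ?V)"
        by (rule hom_ind_cong) (use UEL in \<open>simp add: override_on_def del: Union_iff UN_iff\<close>)
      finally show "hom_ind (?E \<union> ?F) D ?g = hom_ind ?E D (override_on \<phi> \<psi> ?U) * hom_ind ?F D (override_on \<phi> \<eta> ?V)" .
    qed
    also have "\<dots> = rooted_density ?E W D \<phi> * rooted_density ?F W D \<phi>"
      by (simp only: avg_cmult avg_mult_const rooted_density_def)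
    finally show "avg (?U \<union> ?V) W (\<lambda>\<psi>. hom_ind (?E \<union> ?F) D (override_on \<phi> \<psi> (?U \<union> ?V))) =
      rooted_density ?E W D \<phi> * rooted_density ?F W D \<phi>" .
  qed
  also have "\<dots> = avg L W (\<lambda>\<phi>. rooted_density E W D \<phi> * rooted_density F W D \<phi>)"
    using rooted_density_inj_image[OF tag0_inj E] rooted_density_inj_image[OF tag1_inj F] by simp
  finally show ?thesis .
qed

text \<open>The target \<open>D\<close> is allowed to contain singletons, that is, loops.\<close>

lemma eval_moment_matrix_hom_density:
  assumes A: "A \<in> basis d l" and B: "B \<in> basis d l" and W: "finite W" "W \<noteq> {}"
  shows "eval_monomial (moment_matrix A B) (\<lambda>C. hom_density C W D) =
    avg (Lab ` {1..l}) W (\<lambda>\<phi>. rooted_density (rep_plgraph A) W D \<phi> * rooted_density (rep_plgraph B) W D \<phi>)"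
proof -
  have lab: "\<Union>(rep_plgraph A) \<inter> range Lab \<subseteq> Lab ` {1..l}" if "A \<in> basis d l" for A
    using that basis_abs[OF pl_edges_rep[of A], of d l] unfolding abs_rep_plgraph by blast
  have "eval_monomial (moment_matrix (abs_plgraph (rep_plgraph A)) (abs_plgraph (rep_plgraph B)))
      (\<lambda>C. hom_density C W D) = edge_density (unl_edges (glue_edges (rep_plgraph A) (rep_plgraph B))) W D"
    unfolding moment_matrix_abs[OF pl_edges_rep pl_edges_rep]
    by (intro eval_monomial_hom_density pl_edges_unl pl_edges_glue pl_edges_rep W)
  then show ?thesis
    unfolding abs_rep_plgraph
    using edge_density_unlabel_glue[OF pl_edges_rep pl_edges_rep W _ _ lab[OF A] lab[OF B]] by auto
qed

lemma psd_on_hom_density: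
  assumes "finite I" "I \<subseteq> basis d l" and W: "finite W" "W \<noteq> {}"
  shows "psd_on I (\<lambda>A B. eval_monomial (moment_matrix A B) (\<lambda>C. hom_density C W D))"
  unfolding psd_on_def
proof
  fix x
  let ?t = "\<lambda>A. rooted_density (rep_plgraph A) W D" and ?L = "Lab ` {1..l}"
  have "(\<Sum>A\<in>I. \<Sum>B\<in>I. x A * x B * eval_monomial (moment_matrix A B) (\<lambda>C. hom_density C W D))
      = (\<Sum>A\<in>I. \<Sum>B\<in>I. x A * x B * avg ?L W (\<lambda>\<phi>. ?t A \<phi> * ?t B \<phi>))"
    using subsetD[OF assms(2)] W
    by (intro sum.cong refl arg_cong2[where f = "(*)"] eval_moment_matrix_hom_density)
  also have "\<dots> = (\<Sum>A\<in>I. \<Sum>B\<in>I. \<Sum>\<phi>\<in>?L \<rightarrow>\<^sub>E W. (x A * ?t A \<phi>) * (x B * ?t B \<phi>)) / card (?L \<rightarrow>\<^sub>E W)"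
    by (simp add: avg_def sum_divide_distrib sum_distrib_left algebra_simps)
  also have "(\<Sum>A\<in>I. \<Sum>B\<in>I. \<Sum>\<phi>\<in>?L \<rightarrow>\<^sub>E W. (x A * ?t A \<phi>) * (x B * ?t B \<phi>)) =
      (\<Sum>A\<in>I. \<Sum>\<phi>\<in>?L \<rightarrow>\<^sub>E W. \<Sum>B\<in>I. (x A * ?t A \<phi>) * (x B * ?t B \<phi>))"
    by (intro sum.cong refl sum.swap)
  also have "\<dots> = (\<Sum>\<phi>\<in>?L \<rightarrow>\<^sub>E W. \<Sum>A\<in>I. \<Sum>B\<in>I. (x A * ?t A \<phi>) * (x B * ?t B \<phi>))"
    by (rule sum.swap)
  also have "\<dots> = (\<Sum>\<phi>\<in>?L \<rightarrow>\<^sub>E W. (\<Sum>A\<in>I. x A * ?t A \<phi>)\<^sup>2)"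
    by (simp add: power2_eq_square sum_product)
  finally show "(\<Sum>A\<in>I. \<Sum>B\<in>I. x A * x B * eval_monomial (moment_matrix A B) (\<lambda>C. hom_density C W D)) \<ge> 0"
    by (simp add: sum_nonneg)
qed


section \<open>Separating partially labeled graphs by rooted homomorphism counts\<close>

text \<open>Labels become odd and unlabeled vertices positive even numbers; 0 stays free for the
  isolated looped vertex of the targets.\<close>

fun enc :: "vertex \<Rightarrow> nat" where
  "enc (Lab i) = 2 * i + 1"
| "enc (Unl j) = 2 * j + 2"

lemma inj_enc: "inj enc"
  by (rule injI, rename_tac x y, case_tac x; case_tac y; simp; presburger)

lemma enc_nonzero: "enc v \<noteq> 0"
  by (cases v) auto

text \<open>Edge-set form of the absence of unlabeled components, together with the range of the
  labels. The empty edge set qualifies.\<close>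

definition label_rooted :: "nat \<Rightarrow> vertex set set \<Rightarrow> bool" where
  "label_rooted l E \<longleftrightarrow> pl_edges E \<and> (\<forall>i. Lab i \<in> \<Union>E \<longrightarrow> i \<in> {1..l})
     \<and> (\<forall>v\<in>\<Union>E. \<exists>i. Lab i \<in> \<Union>E \<and> (Lab i, v) \<in> reach E)"

lemma label_rooted_rep:
  assumes A: "A \<in> reduced_basis d l"
  shows "label_rooted l (rep_plgraph A)"
  unfolding label_rooted_def
proof (intro conjI pl_edges_rep)
  let ?E = "rep_plgraph A"
  have "A \<in> basis d l" using A reduced_basis_subset by blast
  then show "\<forall>i. Lab i \<in> \<Union>?E \<longrightarrow> i \<in> {1..l}"
    using basis_abs[OF pl_edges_rep[of A], of d l] unfolding abs_rep_plgraph by blast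
  show "\<forall>v\<in>\<Union>?E. \<exists>i. Lab i \<in> \<Union>?E \<and> (Lab i, v) \<in> reach ?E"
  proof
    fix v assume v: "v \<in> \<Union>?E"
    let ?c = "component_edges ?E v"
    have c: "?c \<in> comps ?E" using v by (rule imageI)
    \<comment> \<open>\<open>reduced_basis\<close> inserts the empty graph separately, so its
      condition on components can be read off only after that graph is excluded.\<close>
    have "A \<noteq> empty_graph"
    proof
      assume "A = empty_graph"
      then have "card ?E = 0"
        using num_edges_abs[OF pl_edges_rep[of A]] num_edges_abs[OF pl_edges_empty]
        by (simp add: abs_rep_plgraph empty_graph_def)
      then have "?E = {}" using pl_edges_rep[of A] by (simp add: pl_edges_def)
      then show False using v by simp
    qed
    then have "\<forall>C\<in>#graph_components (abs_plgraph ?E). labels C \<noteq> {}"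
      using A by (simp add: reduced_basis_def abs_rep_plgraph)
    then have "labels (abs_plgraph ?c) \<noteq> {}"
      using imageI[OF c, of abs_plgraph] unfolding set_graph_components_abs[OF pl_edges_rep] by blast
    then obtain i where "Lab i \<in> \<Union>?c"
      unfolding labels_abs[OF pl_edges_subset[OF pl_edges_rep comps_subset[OF c]]] by auto
    then have "Lab i \<in> \<Union>?E" "(v, Lab i) \<in> reach ?E" by (auto simp: component_edges_def)
    then show "\<exists>i. Lab i \<in> \<Union>?E \<and> (Lab i, v) \<in> reach ?E" using reach_sym by blast
  qed
qed

definition rooted_homs :: "vertex set set \<Rightarrow> nat set \<Rightarrow> nat set set \<Rightarrow> (vertex \<Rightarrow> nat) \<Rightarrow> (vertex \<Rightarrow> nat) set" where
  "rooted_homs E W D \<phi> =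
     {\<psi> \<in> unl_vertices E \<rightarrow>\<^sub>E W. \<forall>e\<in>E. override_on \<phi> \<psi> (unl_vertices E) ` e \<in> D}"

lemma finite_unl_vertices: "pl_edges E \<Longrightarrow> finite (unl_vertices E)"
  using pl_edges_finite_Union by (simp add: unl_vertices_def)

lemma rooted_density_eq_card:
  assumes "pl_edges E" "finite W"
  shows "rooted_density E W D \<phi> = card (rooted_homs E W D \<phi>) / card (unl_vertices E \<rightarrow>\<^sub>E W)"
proof -
  have "finite (unl_vertices E \<rightarrow>\<^sub>E W)" by (intro finite_PiE finite_unl_vertices assms)
  then have "(\<Sum>\<psi>\<in>unl_vertices E \<rightarrow>\<^sub>E W. hom_ind E D (override_on \<phi> \<psi> (unl_vertices E))) =
      card (rooted_homs E W D \<phi>)"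
    by (simp add: of_bool_def sum.If_cases Int_def rooted_homs_def)
  then show ?thesis by (simp add: rooted_density_def avg_def)
qed

text \<open>The target graph is a copy of the subgraph of \<open>F\<close> induced on \<open>S\<close> together with an isolated
  looped vertex \<open>0\<close>. Mapping all labels to \<open>0\<close> admits exactly one extension, which normalises the
  comparison of two rooted densities.\<close>

definition target_vertices :: "nat \<Rightarrow> vertex set set \<Rightarrow> nat set" where
  "target_vertices l F = insert 0 (enc ` (Lab ` {1..l} \<union> \<Union>F))"

definition target_edges :: "vertex set set \<Rightarrow> vertex set \<Rightarrow> nat set set" where
  "target_edges F S = insert {0} ((\<lambda>e. enc ` e) ` {e \<in> F. e \<subseteq> S})"

lemma finite_target_vertices: "pl_edges F \<Longrightarrow> finite (target_vertices l F)"
  using pl_edges_finite_Union by (simp add: target_vertices_def)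

lemma target_edges_zero: "e \<in> target_edges F S \<Longrightarrow> 0 \<in> e \<Longrightarrow> e = {0}"
  using enc_nonzero by (auto simp: target_edges_def) (metis enc_nonzero)+

text \<open>Apart from its loop the vertex 0 is isolated, so the value 0 spreads along edges in both
  directions.\<close>

lemma hom_zero_reach:
  assumes "\<forall>e\<in>E. \<eta> ` e \<in> target_edges F S" "(u, v) \<in> reach E"
  shows "\<eta> u = 0 \<longleftrightarrow> \<eta> v = 0"
  using assms(2) unfolding reach_def
proof (induction rule: rtrancl_induct)
  case (step y z)
  then have "\<eta> ` {y, z} \<in> target_edges F S" using assms(1) by blast
  then have t: "0 \<in> {\<eta> y, \<eta> z} \<Longrightarrow> {\<eta> y, \<eta> z} = {0}"
    using target_edges_zero[of "{\<eta> y, \<eta> z}" F S] by simp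
  have "\<eta> y = 0 \<longleftrightarrow> \<eta> z = 0"
    by (metis t insertCI singletonD)
  then show ?case using step.IH by simp
qed simp

text \<open>Each vertex is joined to a label and the labels go to 0, so every vertex must go to 0;
  the loop makes this map a homomorphism.\<close>

lemma rooted_homs_zero:
  assumes E: "label_rooted l E"
  shows "rooted_homs E (target_vertices l F) (target_edges F S) (\<lambda>v\<in>Lab ` {1..l}. 0) = {\<lambda>v\<in>unl_vertices E. 0}"
proof (intro equalityI subsetI)
  let ?U = "unl_vertices E" and ?\<phi> = "\<lambda>v\<in>Lab ` {1..l}. 0 :: nat"
  fix \<psi> assume "\<psi> \<in> rooted_homs E (target_vertices l F) (target_edges F S) ?\<phi>"
  then have \<psi>: "\<psi> \<in> ?U \<rightarrow>\<^sub>E target_vertices l F" "\<forall>e\<in>E. override_on ?\<phi> \<psi> ?U ` e \<in> target_edges F S"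
    by (auto simp: rooted_homs_def)
  have "\<psi> v = 0" if v: "v \<in> ?U" for v
  proof -
    have "v \<in> \<Union>E" using v by (simp add: unl_vertices_def)
    then obtain i where i: "Lab i \<in> \<Union>E" "(Lab i, v) \<in> reach E"
      using E unfolding label_rooted_def by blast
    then have "override_on ?\<phi> \<psi> ?U (Lab i) = 0"
      using E by (auto simp: label_rooted_def override_on_def unl_vertices_def)
    then have "override_on ?\<phi> \<psi> ?U v = 0" using hom_zero_reach[OF \<psi>(2) i(2)] by simp
    then show ?thesis using v by (simp add: override_on_def)
  qed
  then have "\<psi> = (\<lambda>v\<in>?U. 0)" using \<psi>(1) by (auto simp: fun_eq_iff PiE_iff extensional_def)
  then show "\<psi> \<in> {\<lambda>v\<in>?U. 0}" by simp
next
  let ?U = "unl_vertices E" and ?\<phi> = "\<lambda>v\<in>Lab ` {1..l}. 0 :: nat"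
  fix \<psi> assume "\<psi> \<in> {\<lambda>v\<in>?U. 0 :: nat}"
  then have \<psi>: "\<psi> = (\<lambda>v\<in>?U. 0)" by simp
  have z: "override_on ?\<phi> \<psi> ?U v = 0" if "v \<in> \<Union>E" for v
  proof (cases v)
    case (Lab i)
    then have "i \<in> {1..l}" using E that unfolding label_rooted_def by blast
    then show ?thesis using Lab by (auto simp: override_on_def \<psi>)
  next
    case (Unl j)
    then have "v \<in> ?U" using that by (auto simp: unl_vertices_def)
    then show ?thesis by (simp add: override_on_def \<psi>)
  qed
  have "override_on ?\<phi> \<psi> ?U ` e = {0}" if e: "e \<in> E" for e
  proof -
    have "override_on ?\<phi> \<psi> ?U ` e = (\<lambda>_. 0) ` e"
      by (rule image_cong[OF refl]) (rule z, rule UnionI[OF e])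
    moreover have "e \<noteq> {}" using E pl_edges_nonempty[OF _ e] by (simp add: label_rooted_def)
    ultimately show ?thesis by (simp add: image_constant_conv)
  qed
  then show "\<psi> \<in> rooted_homs E (target_vertices l F) (target_edges F S) ?\<phi>"
    by (auto simp: rooted_homs_def \<psi> target_vertices_def target_edges_def)
qed

abbreviation label_embedding :: "nat \<Rightarrow> vertex \<Rightarrow> nat" where
  "label_embedding l \<equiv> (\<lambda>v\<in>Lab ` {1..l}. enc v)"

text \<open>Prescribing the vertex image exactly is what inclusion-exclusion needs. The edge
  condition can refer to all of \<open>F\<close>: edges whose image lies in \<open>T\<close> belong
  to the subgraph induced on any \<open>S\<close> containing \<open>T\<close>.\<close>

definition homs_onto :: "nat \<Rightarrow> vertex set set \<Rightarrow> vertex set set \<Rightarrow> vertex set \<Rightarrow> (vertex \<Rightarrow> nat) set" where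
  "homs_onto l E F T = {\<psi> \<in> unl_vertices E \<rightarrow>\<^sub>E target_vertices l F.
     (\<forall>e\<in>E. override_on (label_embedding l) \<psi> (unl_vertices E) ` e \<in> (\<lambda>e. enc ` e) ` F)
     \<and> override_on (label_embedding l) \<psi> (unl_vertices E) ` \<Union>E = enc ` T}"

lemma label_embedding_Lab:
  "label_rooted l E \<Longrightarrow> Lab i \<in> \<Union>E \<Longrightarrow> override_on (label_embedding l) \<psi> (unl_vertices E) (Lab i) = enc (Lab i)"
proof -
  assume "label_rooted l E" "Lab i \<in> \<Union>E"
  then have "i \<in> {1..l}" unfolding label_rooted_def by blast
  then show ?thesis by (simp add: override_on_def unl_vertices_def)
qed

lemma hom_to_target_iff:
  assumes E: "label_rooted l E" and lab: "\<And>i. Lab i \<in> \<Union>E \<Longrightarrow> \<eta> (Lab i) = enc (Lab i)"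
  shows "(\<forall>e\<in>E. \<eta> ` e \<in> target_edges F S) \<longleftrightarrow>
    (\<forall>e\<in>E. \<eta> ` e \<in> (\<lambda>e. enc ` e) ` F) \<and> (\<exists>T\<in>Pow S. \<eta> ` \<Union>E = enc ` T)"
proof
  assume h: "\<forall>e\<in>E. \<eta> ` e \<in> target_edges F S"
  have *: "\<exists>e'\<in>F. e' \<subseteq> S \<and> \<eta> ` e = enc ` e'" if e: "e \<in> E" for e
  proof -
    obtain v where v: "v \<in> e" using E e pl_edges_nonempty by (metis ex_in_conv label_rooted_def)
    then have "v \<in> \<Union>E" using e by blast
    then obtain i where i: "Lab i \<in> \<Union>E" "(Lab i, v) \<in> reach E"
      using E unfolding label_rooted_def by blast
    have "\<eta> v \<noteq> 0"
      using hom_zero_reach[OF h i(2)] lab[OF i(1)] enc_nonzero by simp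
    then have "\<eta> ` e \<noteq> {0}" using v by (metis imageI singletonD)
    moreover have "\<eta> ` e \<in> target_edges F S" using h e by (rule bspec)
    ultimately have "\<eta> ` e \<in> (\<lambda>e. enc ` e) ` {e \<in> F. e \<subseteq> S}"
      unfolding target_edges_def insert_iff by argo
    then obtain e' where "e' \<in> {e \<in> F. e \<subseteq> S}" "\<eta> ` e = enc ` e'" by (rule imageE)
    then show ?thesis by (intro bexI[of _ e']) auto
  qed
  have "\<eta> ` \<Union>E \<subseteq> enc ` S"
  proof (rule image_subsetI)
    fix v assume "v \<in> \<Union>E"
    then obtain e where e: "e \<in> E" "v \<in> e" by blast
    obtain e' where e': "e' \<subseteq> S" "\<eta> ` e = enc ` e'" using *[OF e(1)] by metis
    then have "\<eta> v \<in> enc ` e'" using e(2) by (metis imageI)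
    then show "\<eta> v \<in> enc ` S" by (rule subsetD[OF image_mono[OF e'(1)]])
  qed
  then have "\<exists>T\<in>Pow S. \<eta> ` \<Union>E = enc ` T" by (metis PowI subset_image_iff)
  moreover have "\<forall>e\<in>E. \<eta> ` e \<in> (\<lambda>e. enc ` e) ` F" using * by (metis image_eqI)
  ultimately show "(\<forall>e\<in>E. \<eta> ` e \<in> (\<lambda>e. enc ` e) ` F) \<and> (\<exists>T\<in>Pow S. \<eta> ` \<Union>E = enc ` T)" by simp
next
  assume h: "(\<forall>e\<in>E. \<eta> ` e \<in> (\<lambda>e. enc ` e) ` F) \<and> (\<exists>T\<in>Pow S. \<eta> ` \<Union>E = enc ` T)"
  show "\<forall>e\<in>E. \<eta> ` e \<in> target_edges F S"
  proof
    fix e assume e: "e \<in> E"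
    then obtain e' where e': "e' \<in> F" "\<eta> ` e = enc ` e'" using h by (metis imageE)
    obtain T where T: "T \<subseteq> S" "\<eta> ` \<Union>E = enc ` T" using h by (metis PowD)
    have "\<eta> ` e \<subseteq> \<eta> ` \<Union>E" using e by (intro image_mono) blast
    then have "enc ` e' \<subseteq> enc ` T" unfolding e'(2) T(2) .
    then have "e' \<subseteq> S" using inj_image_subset_iff[OF inj_enc] T(1) by (meson order_trans)
    then show "\<eta> ` e \<in> target_edges F S" 
      unfolding target_edges_def e'(2) using e'(1) by (intro insertI2 imageI) simp
  qed
qed

lemma rooted_homs_embedding:
  assumes E: "label_rooted l E"
  shows "rooted_homs E (target_vertices l F) (target_edges F S) (label_embedding l) = (\<Union>T\<in>Pow S. homs_onto l E F T)"
proof -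
  let ?\<eta> = "\<lambda>\<psi>. override_on (label_embedding l) \<psi> (unl_vertices E)"
  have "(\<forall>e\<in>E. ?\<eta> \<psi> ` e \<in> target_edges F S) \<longleftrightarrow>
      (\<forall>e\<in>E. ?\<eta> \<psi> ` e \<in> (\<lambda>e. enc ` e) ` F) \<and> (\<exists>T\<in>Pow S. ?\<eta> \<psi> ` \<Union>E = enc ` T)" for \<psi>
    by (rule hom_to_target_iff[OF E]) (rule label_embedding_Lab[OF E])
  then show ?thesis
    unfolding rooted_homs_def homs_onto_def by (intro set_eqI) (simp only: UN_iff mem_Collect_eq, metis)
qed

text \<open>The homomorphisms are partitioned by their vertex image; \<open>enc\<close> is
  injective, so different \<open>T\<close> give disjoint classes.\<close>

lemma card_rooted_homs_embedding:
  assumes E: "label_rooted l E" and F: "pl_edges F" and S: "finite S"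
  shows "card (rooted_homs E (target_vertices l F) (target_edges F S) (label_embedding l)) =
    (\<Sum>T\<in>Pow S. card (homs_onto l E F T))"
proof -
  have "finite (unl_vertices E \<rightarrow>\<^sub>E target_vertices l F)"
    using E F by (intro finite_PiE finite_unl_vertices finite_target_vertices) (auto simp: label_rooted_def)
  then have "finite (homs_onto l E F T)" for T by (simp add: homs_onto_def)
  moreover have "homs_onto l E F T \<inter> homs_onto l E F T' = {}" if "T \<noteq> T'" for T T'
    using that inj_image_eq_iff[OF inj_enc] by (auto simp: homs_onto_def)
  ultimately show ?thesis
    unfolding rooted_homs_embedding[OF E] using S by (intro card_UN_disjoint) auto
qed

text \<open>Lovasz' argument: equal numbers of homomorphisms into all induced subgraphs give, by inclusion-exclusion,
  equal numbers of surjective homomorphisms.\<close>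

lemma surjective_hom_of_equal_counts:
  assumes E: "label_rooted l E" and F: "label_rooted l F"
    and eq: "\<And>S. S \<subseteq> \<Union>F \<Longrightarrow>
      card (rooted_homs E (target_vertices l F) (target_edges F S) (label_embedding l)) =
      card (rooted_homs F (target_vertices l F) (target_edges F S) (label_embedding l))"
  shows "\<exists>g. g ` \<Union>E = \<Union>F \<and> (\<forall>i. Lab i \<in> \<Union>E \<longrightarrow> g (Lab i) = Lab i) \<and> (\<forall>e\<in>E. g ` e \<in> F)"
proof -
  have pF: "pl_edges F" using F by (simp add: label_rooted_def)
  have fin: "finite (\<Union>F)" by (rule pl_edges_finite_Union[OF pF])
  have onto: "card (homs_onto l E F S) = card (homs_onto l F F S)" if "S \<subseteq> \<Union>F" for S
  proof -
    have "finite S" using that fin by (rule finite_subset)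
    then show ?thesis using that
    proof (induction S rule: finite_psubset_induct)
      case (psubset S)
      have "(\<Sum>T\<in>Pow S. card (homs_onto l E F T)) = (\<Sum>T\<in>Pow S. card (homs_onto l F F T))"
        using eq[OF psubset.prems] card_rooted_homs_embedding[OF E pF psubset.hyps]
          card_rooted_homs_embedding[OF F pF psubset.hyps] by simp
      moreover have "(\<Sum>T\<in>Pow S - {S}. card (homs_onto l E F T)) = (\<Sum>T\<in>Pow S - {S}. card (homs_onto l F F T))"
        using psubset.IH psubset.prems by (intro sum.cong refl) auto
      ultimately show ?case
        using psubset.hyps by (simp add: sum.remove[of "Pow S" S])
    qed
  qed
  \<comment> \<open>The identity of \<open>F\<close> is a homomorphism onto all of \<open>F\<close>,
    so the count for \<open>F\<close>, and with it the count for \<open>E\<close>, is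
    nonzero.\<close>
  let ?i = "\<lambda>v\<in>unl_vertices F. enc v"
  have "override_on (label_embedding l) ?i (unl_vertices F) v = enc v" if "v \<in> \<Union>F" for v
  proof (cases "v \<in> unl_vertices F")
    case True
    then show ?thesis by (simp add: override_on_def)
  next
    case False
    then obtain i where "v = Lab i" using \<open>v \<in> \<Union>F\<close> unfolding unl_vertices_def by blast
    then show ?thesis using label_embedding_Lab[OF F] that by metis
  qed
  then have im: "override_on (label_embedding l) ?i (unl_vertices F) ` X = enc ` X" if "X \<subseteq> \<Union>F" for X
    using that by (intro image_cong refl) blast
  have "?i \<in> unl_vertices F \<rightarrow>\<^sub>E target_vertices l F"
    by (auto simp: target_vertices_def unl_vertices_def)
  then have "?i \<in> homs_onto l F F (\<Union>F)"
    using im[OF order_refl] im[OF Union_upper] by (auto simp: homs_onto_def)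
  moreover have "finite (homs_onto l F F (\<Union>F))"
    unfolding homs_onto_def using finite_PiE[OF finite_unl_vertices[OF pF] finite_target_vertices[OF pF]]
    by simp
  ultimately have "card (homs_onto l E F (\<Union>F)) \<noteq> 0" using onto[OF order_refl] by auto
  then obtain \<psi> where "\<psi> \<in> homs_onto l E F (\<Union>F)" by (metis card.empty ex_in_conv)
  then have \<psi>: "\<forall>e\<in>E. override_on (label_embedding l) \<psi> (unl_vertices E) ` e \<in> (\<lambda>e. enc ` e) ` F"
    "override_on (label_embedding l) \<psi> (unl_vertices E) ` \<Union>E = enc ` \<Union>F"
    unfolding homs_onto_def by blast+
  let ?g = "\<lambda>v. inv enc (override_on (label_embedding l) \<psi> (unl_vertices E) v)"
  have inv: "?g ` X = Y" if "override_on (label_embedding l) \<psi> (unl_vertices E) ` X = enc ` Y" for X Y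
    using that by (metis image_image image_inv_f_f[OF inj_enc])
  have "?g ` \<Union>E = \<Union>F" using inv[OF \<psi>(2)] .
  moreover have "?g (Lab i) = Lab i" if "Lab i \<in> \<Union>E" for i
    by (simp only: label_embedding_Lab[OF E that] inv_f_f[OF inj_enc])
  moreover have "?g ` e \<in> F" if "e \<in> E" for e
  proof -
    from bspec[OF \<psi>(1) that] obtain e' where
      e': "override_on (label_embedding l) \<psi> (unl_vertices E) ` e = enc ` e'" "e' \<in> F"
      by (rule imageE)
    then show ?thesis by (simp only: inv[OF e'(1)])
  qed
  ultimately show ?thesis by (intro exI[of _ ?g] conjI allI impI ballI)
qed

text \<open>Finiteness turns surjections in both directions into bijections on the vertices. Both
  are then injective on edges, so the edge numbers agree and \<open>g\<close> maps \<open>E\<close>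
  onto all of \<open>F\<close>.\<close>

lemma surjective_homs_iso:
  assumes E: "pl_edges E" and F: "pl_edges F"
    and g: "g ` \<Union>E = \<Union>F" "\<And>i. Lab i \<in> \<Union>E \<Longrightarrow> g (Lab i) = Lab i" "\<And>e. e \<in> E \<Longrightarrow> g ` e \<in> F"
    and h: "h ` \<Union>F = \<Union>E" "\<And>i. Lab i \<in> \<Union>F \<Longrightarrow> h (Lab i) = Lab i" "\<And>e. e \<in> F \<Longrightarrow> h ` e \<in> E"
  shows "abs_plgraph E = abs_plgraph F"
proof -
  have fin: "finite (\<Union>E)" "finite (\<Union>F)" "finite E" "finite F"
    using pl_edges_finite_Union E F by (auto simp: pl_edges_def)
  have "card (\<Union>F) \<le> card (\<Union>E)" "card (\<Union>E) \<le> card (\<Union>F)"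
    using card_image_le[OF fin(1), of g] card_image_le[OF fin(2), of h] g(1) h(1) by simp_all
  then have "card (g ` \<Union>E) = card (\<Union>E)" "card (h ` \<Union>F) = card (\<Union>F)" using g(1) h(1) by simp_all
  then have inj: "inj_on g (\<Union>E)" "inj_on h (\<Union>F)"
    using eq_card_imp_inj_on fin by blast+
  have "inj_on (\<lambda>e. g ` e) E" "inj_on (\<lambda>e. h ` e) F" 
    using inj_on_image[OF inj(1)] inj_on_image[OF inj(2)] by simp_all
  then have "card E \<le> card F" "card F \<le> card E" and "card ((\<lambda>e. g ` e) ` E) = card E"
    using card_inj_on_le[of "\<lambda>e. g ` e" E F] card_inj_on_le[of "\<lambda>e. h ` e" F E] fin g(3) h(3)
    by (auto simp: card_image)
  then have "(\<lambda>e. g ` e) ` E = F" using fin g(3) by (intro card_subset_eq) auto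
  moreover have "g v = Lab i \<longleftrightarrow> v = Lab i" if v: "v \<in> \<Union>E" for v i
  proof
    assume gv: "g v = Lab i"
    \<comment> \<open>A label hit by \<open>g\<close> lies in \<open>F\<close>; as \<open>h\<close>
      fixes it, it also lies in \<open>E\<close>, where \<open>g\<close> fixes it, and injectivity
      of \<open>g\<close> concludes.\<close>
    then have F': "Lab i \<in> \<Union>F" using v g(1) by (metis imageI)
    then have E': "Lab i \<in> \<Union>E" using h(1,2) by (metis imageI)
    show "v = Lab i" using inj_onD[OF inj(1) _ v E'] gv g(2)[OF E'] by simp
  next
    assume "v = Lab i"
    then show "g v = Lab i" using g(2) v by simp
  qed
  ultimately have "pl_iso_via g E F" using inj(1) by (simp add: pl_iso_via_def del: Union_iff)
  then show ?thesis by (rule abs_plgraph_eqI[OF E F])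
qed

text \<open>Equality in Cauchy-Schwarz would need proportional rooted densities. With all labels at
  0 both counts are 1, with the labels at their own copies the counts differ, and the denominators
  are the same on both sides of the cross product.\<close>

lemma strict_minor_of_unequal_counts:
  assumes A: "A \<in> reduced_basis d l" and B: "B \<in> reduced_basis d l" and F: "pl_edges F"
    and W: "W = target_vertices l F" and D: "D = target_edges F S"
    and neq: "card (rooted_homs (rep_plgraph A) W D (label_embedding l)) \<noteq>
      card (rooted_homs (rep_plgraph B) W D (label_embedding l))"
  shows "(eval_monomial (moment_matrix A B) (\<lambda>C. hom_density C W D))\<^sup>2 <
    eval_monomial (moment_matrix A A) (\<lambda>C. hom_density C W D) *
    eval_monomial (moment_matrix B B) (\<lambda>C. hom_density C W D)"
proof -
  let ?L = "Lab ` {1..l}"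
  let ?p = "rooted_density (rep_plgraph A) W D" and ?q = "rooted_density (rep_plgraph B) W D"
  let ?z = "\<lambda>v\<in>?L. 0 :: nat" and ?i = "label_embedding l"
  have fW: "finite W" "W \<noteq> {}" "0 \<in> W"
    using finite_target_vertices[OF F] by (auto simp: W target_vertices_def)
  have pos: "card (X \<rightarrow>\<^sub>E W) > 0" if "finite X" for X :: "vertex set"
    using that fW by (simp add: card_PiE card_gt_0_iff)
  have L: "?z \<in> ?L \<rightarrow>\<^sub>E W" "?i \<in> ?L \<rightarrow>\<^sub>E W"
    by (auto simp: W target_vertices_def)
  note dens = rooted_density_eq_card[OF pl_edges_rep fW(1)]
  note posU = pos[OF finite_unl_vertices[OF pl_edges_rep]]
  have z: "card (rooted_homs (rep_plgraph C) W D ?z) = 1" if "C \<in> reduced_basis d l" for C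
    unfolding W D rooted_homs_zero[OF label_rooted_rep[OF that]] by simp
  have ne: "?p ?z * ?q ?i \<noteq> ?p ?i * ?q ?z"
    unfolding dens z[OF A] z[OF B] using neq posU[of A] posU[of B] by (simp add: field_simps)
  have fin: "finite (?L \<rightarrow>\<^sub>E W)" using fW by (intro finite_PiE) auto
  have cs: "(\<Sum>\<phi>\<in>?L \<rightarrow>\<^sub>E W. ?p \<phi> * ?q \<phi>)\<^sup>2 < (\<Sum>\<phi>\<in>?L \<rightarrow>\<^sub>E W. ?p \<phi> * ?p \<phi>) * (\<Sum>\<phi>\<in>?L \<rightarrow>\<^sub>E W. ?q \<phi> * ?q \<phi>)"
    by (rule strict_Cauchy_Schwarz_sum[where p = ?p and q = ?q, OF fin L ne])
  have AB: "A \<in> basis d l" "B \<in> basis d l" using A B reduced_basis_subset by blast+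
  have c: "real (card (?L \<rightarrow>\<^sub>E W)) > 0" using pos by simp
  have "(\<Sum>\<phi>\<in>?L \<rightarrow>\<^sub>E W. ?p \<phi> * ?q \<phi>)\<^sup>2 / (real (card (?L \<rightarrow>\<^sub>E W)))\<^sup>2 <
      (\<Sum>\<phi>\<in>?L \<rightarrow>\<^sub>E W. ?p \<phi> * ?p \<phi>) * (\<Sum>\<phi>\<in>?L \<rightarrow>\<^sub>E W. ?q \<phi> * ?q \<phi>) / (real (card (?L \<rightarrow>\<^sub>E W)))\<^sup>2"
    using cs c by (intro divide_strict_right_mono) auto
  then show ?thesis
    unfolding eval_moment_matrix_hom_density[OF AB fW(1,2)] eval_moment_matrix_hom_density[OF AB(1,1) fW(1,2)]
      eval_moment_matrix_hom_density[OF AB(2,2) fW(1,2)] avg_def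
    by (simp add: power_divide power2_eq_square)
qed

text \<open>If no target works, all counts agree. Targets built from \<open>B\<close> then give a
  surjective homomorphism from \<open>A\<close> to \<open>B\<close>, and targets built from
  \<open>A\<close> one in the other direction.\<close>

lemma exists_strict_minor:
  assumes A: "A \<in> reduced_basis d l" and B: "B \<in> reduced_basis d l" and "A \<noteq> B"
  shows "\<exists>W D. finite W \<and> 0 \<in> W \<and> {0} \<in> D \<and>
    (eval_monomial (moment_matrix A B) (\<lambda>C. hom_density C W D))\<^sup>2 <
      eval_monomial (moment_matrix A A) (\<lambda>C. hom_density C W D) *
      eval_monomial (moment_matrix B B) (\<lambda>C. hom_density C W D)"
proof (rule ccontr)
  assume none: "\<not> ?thesis"
  let ?E = "rep_plgraph A" and ?F = "rep_plgraph B"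
  have eq: "card (rooted_homs ?E (target_vertices l G) (target_edges G S) (label_embedding l)) =
      card (rooted_homs ?F (target_vertices l G) (target_edges G S) (label_embedding l))"
    if "pl_edges G" for G S
  proof (rule ccontr)
    assume "\<not> ?thesis"
    from strict_minor_of_unequal_counts[OF A B that refl refl this]
    have "finite (target_vertices l G) \<and> 0 \<in> target_vertices l G \<and> {0} \<in> target_edges G S \<and>
      (eval_monomial (moment_matrix A B) (\<lambda>C. hom_density C (target_vertices l G) (target_edges G S)))\<^sup>2 <
      eval_monomial (moment_matrix A A) (\<lambda>C. hom_density C (target_vertices l G) (target_edges G S)) *
      eval_monomial (moment_matrix B B) (\<lambda>C. hom_density C (target_vertices l G) (target_edges G S))"
      using finite_target_vertices[OF that] by (simp add: target_vertices_def target_edges_def)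
    then show False using none by blast
  qed
  note lr = label_rooted_rep[OF A] label_rooted_rep[OF B]
  obtain g where g: "g ` \<Union>?E = \<Union>?F \<and> (\<forall>i. Lab i \<in> \<Union>?E \<longrightarrow> g (Lab i) = Lab i) \<and> (\<forall>e\<in>?E. g ` e \<in> ?F)"
    using surjective_hom_of_equal_counts[OF lr eq[OF pl_edges_rep]] by (rule exE)
  obtain h where h: "h ` \<Union>?F = \<Union>?E \<and> (\<forall>i. Lab i \<in> \<Union>?F \<longrightarrow> h (Lab i) = Lab i) \<and> (\<forall>e\<in>?F. h ` e \<in> ?E)"
    using surjective_hom_of_equal_counts[OF lr(2,1) eq[OF pl_edges_rep, symmetric]] by (rule exE)
  have "abs_plgraph ?E = abs_plgraph ?F"
    using surjective_homs_iso[OF pl_edges_rep pl_edges_rep, of g A B h] g h by simp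
  then show False using \<open>A \<noteq> B\<close> by (simp add: abs_rep_plgraph)
qed

text \<open>The constant map to the looped vertex is a homomorphism from every graph, so logarithms
  of densities can be taken.\<close>

lemma hom_density_pos:
  assumes "finite W" "0 \<in> W" "{0} \<in> D"
  shows "hom_density C W D > 0"
proof -
  let ?E = "rep_plgraph C"
  let ?z = "\<lambda>v\<in>\<Union>?E. 0 :: nat"
  have fin: "finite (\<Union>?E \<rightarrow>\<^sub>E W)" by (intro finite_PiE pl_edges_finite_Union pl_edges_rep assms)
  have z: "?z \<in> \<Union>?E \<rightarrow>\<^sub>E W" using assms(2) by auto
  have "?z ` e = {0}" if "e \<in> ?E" for e
  proof -
    have "?z ` e = (\<lambda>_. 0) ` e" using that by (intro image_cong refl) auto
    then show ?thesis using pl_edges_nonempty[OF pl_edges_rep that] by auto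
  qed
  then have "hom_ind ?E D ?z = 1" using assms(3) by simp
  then have "(\<Sum>\<phi>\<in>\<Union>?E \<rightarrow>\<^sub>E W. hom_ind ?E D \<phi>) > 0"
    using fin z by (intro sum_pos2[of _ ?z]) auto
  moreover have "card (\<Union>?E \<rightarrow>\<^sub>E W) > 0" using fin z by (metis card_gt_0_iff emptyE)
  ultimately have "edge_density ?E W D > 0" by (simp add: edge_density_def avg_def)
  then show ?thesis using hom_density_abs[OF pl_edges_rep assms(1), of C D] by (simp add: abs_rep_plgraph)
qed


section \<open>The sums-of-squares profile and its tropicalization\<close>

definition comb_lin :: "(plgraph \<Rightarrow> real) \<Rightarrow> graph_comb \<Rightarrow> real" where
  "comb_lin f a = (\<Sum>H\<in>Poly_Mapping.keys a. Poly_Mapping.lookup a H * f H)"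

lemma comb_lin_superset:
  assumes "finite X" "Poly_Mapping.keys a \<subseteq> X"
  shows "comb_lin f a = (\<Sum>H\<in>X. Poly_Mapping.lookup a H * f H)"
  unfolding comb_lin_def by (rule sum.mono_neutral_left) (use assms in \<open>auto simp: in_keys_iff\<close>)

lemma comb_lin_add: "comb_lin f (a + b) = comb_lin f a + comb_lin f b"
  using comb_lin_superset[of "Poly_Mapping.keys a \<union> Poly_Mapping.keys b" _ f]
    Poly_Mapping.keys_add[of a b]
  by (simp add: lookup_add sum.distrib algebra_simps)

lemma comb_lin_zero: "comb_lin f 0 = 0"
  by (simp add: comb_lin_def)

lemma comb_lin_sum: "comb_lin f (\<Sum>i\<in>I. a i) = (\<Sum>i\<in>I. comb_lin f (a i))"
  by (induction I rule: infinite_finite_induct) (simp_all add: comb_lin_add comb_lin_zero)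

lemma comb_lin_single: "comb_lin f (Poly_Mapping.single H c) = c * f H"
  using comb_lin_superset[of "{H}" "Poly_Mapping.single H c" f] by simp

text \<open>\<open>eval_comb\<close> is the linear extension of the component monomials, and
  linearity carries it through \<open>comb_unlabel\<close> and \<open>comb_mult\<close>.\<close>

lemma eval_comb_sos:
  "eval_comb (sos_comb bs) v = (\<Sum>b\<leftarrow>bs. \<Sum>A\<in>Poly_Mapping.keys b. \<Sum>B\<in>Poly_Mapping.keys b.
     Poly_Mapping.lookup b A * Poly_Mapping.lookup b B * eval_monomial (moment_matrix A B) v)"
proof -
  let ?m = "\<lambda>H. eval_monomial (graph_components H) v"
  have un: "comb_lin ?m (comb_unlabel a) = comb_lin (\<lambda>H. ?m (unlabel H)) a" for a
    unfolding comb_unlabel_def comb_lin_sum comb_lin_single by (simp add: comb_lin_def)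
  have "comb_lin ?m (comb_unlabel (comb_mult b b)) = (\<Sum>A\<in>Poly_Mapping.keys b. \<Sum>B\<in>Poly_Mapping.keys b.
     Poly_Mapping.lookup b A * Poly_Mapping.lookup b B * eval_monomial (moment_matrix A B) v)" for b
    unfolding un comb_mult_def comb_lin_sum comb_lin_single moment_matrix_def ..
  then have "comb_lin ?m (sos_comb bs) = (\<Sum>b\<leftarrow>bs. \<Sum>A\<in>Poly_Mapping.keys b. \<Sum>B\<in>Poly_Mapping.keys b.
     Poly_Mapping.lookup b A * Poly_Mapping.lookup b B * eval_monomial (moment_matrix A B) v)"
    unfolding sos_comb_def by (induction bs) (simp_all add: comb_lin_add comb_lin_zero)
  then show ?thesis by (simp add: eval_comb_def comb_lin_def)
qed

lemma quadratic_form_superset: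
  fixes b :: "'i \<Rightarrow>\<^sub>0 real"
  assumes "finite I" "Poly_Mapping.keys b \<subseteq> I"
  shows "(\<Sum>A\<in>Poly_Mapping.keys b. \<Sum>B\<in>Poly_Mapping.keys b. Poly_Mapping.lookup b A * Poly_Mapping.lookup b B * M A B)
    = (\<Sum>A\<in>I. \<Sum>B\<in>I. Poly_Mapping.lookup b A * Poly_Mapping.lookup b B * M A B)"
proof -
  have "(\<Sum>B\<in>Poly_Mapping.keys b. Poly_Mapping.lookup b A * Poly_Mapping.lookup b B * M A B)
      = (\<Sum>B\<in>I. Poly_Mapping.lookup b A * Poly_Mapping.lookup b B * M A B)" for A
    by (rule sum.mono_neutral_left) (use assms in \<open>auto simp: in_keys_iff\<close>)
  then show ?thesis
    by (simp, intro sum.mono_neutral_left) (use assms in \<open>auto simp: in_keys_iff\<close>)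
qed

text \<open>Pullback along \<open>r\<close>, which may identify indices, followed by diagonal
  scaling with \<open>u\<close>. The new form at \<open>x\<close> is the form of \<open>M\<close> at
  the vector \<open>z\<close> of weighted fibre sums.\<close>

lemma psd_on_congruence:
  fixes M :: "'j \<Rightarrow> 'j \<Rightarrow> real"
  assumes psd: "psd_on J M" and fin: "finite I" "finite J" and r: "r ` I \<subseteq> J"
  shows "psd_on I (\<lambda>A B. u A * u B * M (r A) (r B))"
  unfolding psd_on_def
proof
  fix x
  define z where "z P = (\<Sum>A\<in>{A \<in> I. r A = P}. x A * u A)" for P
  have "(\<Sum>A\<in>I. \<Sum>B\<in>I. x A * x B * (u A * u B * M (r A) (r B))) =
      (\<Sum>A\<in>I. x A * u A * (\<Sum>B\<in>I. x B * u B * M (r A) (r B)))"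
    by (simp add: sum_distrib_left algebra_simps)
  also have "\<dots> = (\<Sum>A\<in>I. x A * u A * (\<Sum>Q\<in>J. z Q * M (r A) Q))"
  proof (intro sum.cong refl arg_cong2[where f = "(*)"])
    fix A
    have "(\<Sum>B\<in>I. x B * u B * M (r A) (r B)) = (\<Sum>Q\<in>J. \<Sum>B\<in>{B \<in> I. r B = Q}. x B * u B * M (r A) (r B))"
      by (rule sum.group[symmetric, OF fin r])
    also have "\<dots> = (\<Sum>Q\<in>J. z Q * M (r A) Q)"
      unfolding z_def sum_distrib_right by (intro sum.cong refl) auto
    finally show "(\<Sum>B\<in>I. x B * u B * M (r A) (r B)) = (\<Sum>Q\<in>J. z Q * M (r A) Q)" .
  qed
  also have "\<dots> = (\<Sum>P\<in>J. \<Sum>A\<in>{A \<in> I. r A = P}. x A * u A * (\<Sum>Q\<in>J. z Q * M (r A) Q))"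
    by (rule sum.group[symmetric, OF fin r])
  also have "\<dots> = (\<Sum>P\<in>J. z P * (\<Sum>Q\<in>J. z Q * M P Q))"
    unfolding z_def[of "_ :: 'j"] sum_distrib_right by (intro sum.cong refl) auto
  also have "\<dots> = (\<Sum>P\<in>J. \<Sum>Q\<in>J. z P * z Q * M P Q)"
    by (simp add: sum_distrib_left mult.assoc)
  finally show "(\<Sum>A\<in>I. \<Sum>B\<in>I. x A * x B * (u A * u B * M (r A) (r B))) \<ge> 0"
    using psd_onD[OF psd] by simp
qed

lemma finite_reduced_basis: "finite (reduced_basis d l)"
  using finite_subset[OF reduced_basis_subset finite_basis] .

lemma psd_on_basis_of_reduced:
  assumes psd: "psd_on (reduced_basis d l) (\<lambda>A B. eval_monomial (moment_matrix A B) v)"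
  shows "psd_on (basis d l) (\<lambda>A B. eval_monomial (moment_matrix A B) v)"
proof -
  have "\<forall>A. \<exists>E. pl_edges (fst E \<union> snd E) \<and> \<Union>(fst E) \<inter> \<Union>(snd E) = {} \<and> (\<forall>i. Lab i \<notin> \<Union>(snd E))
     \<and> A = abs_plgraph (fst E \<union> snd E) \<and> (A \<in> basis d l \<longrightarrow> abs_plgraph (fst E) \<in> reduced_basis d l)"
    using split_unlabeled_components by simp
  from choice[OF this] obtain E where E: "\<And>A. pl_edges (fst (E A) \<union> snd (E A))"
    "\<And>A. \<Union>(fst (E A)) \<inter> \<Union>(snd (E A)) = {}" "\<And>A. \<forall>i. Lab i \<notin> \<Union>(snd (E A))"
    "\<And>A. A = abs_plgraph (fst (E A) \<union> snd (E A))"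
    "\<And>A. A \<in> basis d l \<Longrightarrow> abs_plgraph (fst (E A)) \<in> reduced_basis d l"
    by metis
  \<comment> \<open>\<open>?r\<close> strips the unlabeled components, and \<open>?u\<close> is the
    value of the monomial they contribute to every product.\<close>
  let ?r = "\<lambda>A. abs_plgraph (fst (E A))"
    and ?u = "\<lambda>A. eval_monomial (graph_components (abs_plgraph (snd (E A)))) v"
  have mm: "moment_matrix A B = moment_matrix (?r A) (?r B) + graph_components (abs_plgraph (snd (E A)))
      + graph_components (abs_plgraph (snd (E B)))" for A B
    using moment_matrix_factor[OF E(1-3)[of A] E(1-3)[of B]] E(4)[of A] E(4)[of B] by simp
  have ev: "eval_monomial (moment_matrix A B) v = ?u A * ?u B * eval_monomial (moment_matrix (?r A) (?r B)) v" for A B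
    unfolding mm[of A B] by (simp add: eval_monomial_def)
  have "psd_on (basis d l) (\<lambda>A B. eval_monomial (moment_matrix A B) v) \<longleftrightarrow>
      psd_on (basis d l) (\<lambda>A B. ?u A * ?u B * eval_monomial (moment_matrix (?r A) (?r B)) v)"
    by (rule psd_on_cong) (rule ev)
  moreover have "?r ` basis d l \<subseteq> reduced_basis d l" using E(5) by blast
  ultimately show ?thesis
    using psd_on_congruence[OF psd finite_basis finite_reduced_basis] by simp
qed

lemma sos_profile_eq:
  assumes "label_bound d l"
  shows "sos_profile d l = {v \<in> nonneg_orthant (variables d l).
    psd_on (reduced_basis d l) (\<lambda>A B. eval_monomial (moment_matrix A B) v)}"
proof -
  have "(\<forall>a. is_sos d a \<longrightarrow> eval_comb a v \<ge> 0) \<longleftrightarrow>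
      psd_on (reduced_basis d l) (\<lambda>A B. eval_monomial (moment_matrix A B) v)" for v
  proof
    let ?M = "\<lambda>A B. eval_monomial (moment_matrix A B) v" and ?R = "reduced_basis d l"
    assume sos: "\<forall>a. is_sos d a \<longrightarrow> eval_comb a v \<ge> 0"
    show "psd_on ?R ?M"
      unfolding psd_on_def
    proof
      fix x :: "plgraph \<Rightarrow> real"
      \<comment> \<open>The test vector \<open>x\<close> as a graph combination: the single square
        of \<open>b\<close> evaluates to the quadratic form at \<open>x\<close>.\<close>
      define b where "b = (\<Sum>A\<in>?R. Poly_Mapping.single A (x A))"
      have lb: "Poly_Mapping.lookup b A = (if A \<in> ?R then x A else 0)" for A
        using finite_reduced_basis by (simp add: b_def lookup_sum lookup_single when_def)
      have keys: "Poly_Mapping.keys b \<subseteq> ?R"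
        by (auto simp: in_keys_iff lb split: if_splits)
      have "is_sos d (sos_comb [b])"
        unfolding is_sos_def using keys reduced_basis_subset[of d l]
        by (intro exI[of _ "[b]"]) (auto simp: basis_iff)
      then have "0 \<le> eval_comb (sos_comb [b]) v" using sos by blast
      also have "\<dots> = (\<Sum>A\<in>?R. \<Sum>B\<in>?R. Poly_Mapping.lookup b A * Poly_Mapping.lookup b B * ?M A B)"
        unfolding eval_comb_sos using quadratic_form_superset[OF finite_reduced_basis keys, of ?M] by simp
      also have "\<dots> = (\<Sum>A\<in>?R. \<Sum>B\<in>?R. x A * x B * ?M A B)"
        by (intro sum.cong refl) (simp add: lb)
      finally show "(\<Sum>A\<in>?R. \<Sum>B\<in>?R. x A * x B * ?M A B) \<ge> 0" .
    qed
  next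
    let ?M = "\<lambda>A B. eval_monomial (moment_matrix A B) v"
    assume "psd_on (reduced_basis d l) ?M"
    then have psd: "psd_on (basis d l) ?M" by (rule psd_on_basis_of_reduced)
    show "\<forall>a. is_sos d a \<longrightarrow> eval_comb a v \<ge> 0"
    proof (intro allI impI)
      fix a assume "is_sos d a"
      \<comment> \<open>Here the label bound is used: the squares given by \<open>is_sos\<close> may
        carry arbitrary labels, these are built from graphs of the finite basis.\<close>
      then obtain bs where bs: "\<forall>b\<in>set bs. \<forall>H\<in>Poly_Mapping.keys b. num_edges H \<le> d \<and> labels H \<subseteq> {1..l}"
        "a = sos_comb bs"
        using assms unfolding label_bound_def by blast
      have "(\<Sum>A\<in>Poly_Mapping.keys b. \<Sum>B\<in>Poly_Mapping.keys b.
          Poly_Mapping.lookup b A * Poly_Mapping.lookup b B * ?M A B) \<ge> 0" if "b \<in> set bs" for b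
      proof -
        have "Poly_Mapping.keys b \<subseteq> basis d l" using bs(1) that by (auto simp: basis_iff)
        then show ?thesis
          unfolding quadratic_form_superset[OF finite_basis \<open>Poly_Mapping.keys b \<subseteq> basis d l\<close>]
          using psd_onD[OF psd] by blast
      qed
      then show "eval_comb a v \<ge> 0"
        unfolding bs(2) eval_comb_sos by (intro sum_list_nonneg) auto
    qed
  qed
  then show ?thesis by (simp add: sos_profile_def)
qed

section \<open>The profile as a closed semialgebraic set containing the graph profile\<close>

lemma moment_matrix_variables:
  "A \<in> reduced_basis d l \<Longrightarrow> B \<in> reduced_basis d l \<Longrightarrow> set_mset (moment_matrix A B) \<subseteq> variables d l"
  using component_of_product_in_variables reduced_basis_subset by blast

lemma polynomial_fun_eval_monomial:
  "set_mset m \<subseteq> V \<Longrightarrow> polynomial_fun V (eval_monomial m)"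
proof (induction m)
  case empty
  then show ?case using polynomial_fun_const[of V 1] by (simp add: eval_monomial_def[abs_def])
next
  case (add C m)
  then show ?case
    using polynomial_fun_mult[OF polynomial_fun_var[of C V], of "eval_monomial m"]
    by (simp add: eval_monomial_def[abs_def])
qed

lemma basic_semialgebraic_sos_profile:
  assumes "label_bound d l"
  shows "basic_semialgebraic (variables d l) (sos_profile d l)"
proof -
  let ?V = "variables d l"
  obtain F where F: "finite F" "\<forall>f\<in>F. polynomial_fun ?V f"
    "\<And>v. psd_on (reduced_basis d l) (\<lambda>A B. eval_monomial (moment_matrix A B) v) \<longleftrightarrow> (\<forall>f\<in>F. f v \<ge> 0)"
    using psd_on_polynomial_inequalities[OF finite_reduced_basis, of d l ?V "\<lambda>v A B. eval_monomial (moment_matrix A B) v"]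
      polynomial_fun_eval_monomial[OF moment_matrix_variables] moment_matrix_commute by auto
  from F(2) obtain p where p: "\<forall>f\<in>F. (\<forall>m\<in>Poly_Mapping.keys (p f). Poly_Mapping.keys m \<subseteq> ?V)
      \<and> (\<forall>v. f v = eval_poly (p f) v)"
    unfolding polynomial_fun_def by metis
  show ?thesis
    unfolding basic_semialgebraic_def sos_profile_eq[OF assms] F(3)
    by (rule exI[of _ "p ` F"]) (use F(1) p in auto)
qed

lemma eval_monomial_cong:
  "(\<And>C. C \<in># m \<Longrightarrow> v C = w C) \<Longrightarrow> eval_monomial m v = eval_monomial m w"
  unfolding eval_monomial_def by (intro arg_cong[where f = prod_mset] image_mset_cong)

lemma continuous_map_eval_monomial:
  "set_mset m \<subseteq> V \<Longrightarrow> continuous_map (powertop_real V) euclideanreal (eval_monomial m)"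
proof (induction m)
  case empty
  then show ?case by (simp add: eval_monomial_def[abs_def])
next
  case (add C m)
  then have "continuous_map (powertop_real V) euclideanreal (\<lambda>v. v C * eval_monomial m v)"
    by (intro continuous_map_real_mult continuous_map_product_projection) auto
  then show ?case by (simp add: eval_monomial_def[abs_def])
qed

text \<open>Needed because the graph profile is a closure. Positive semidefiniteness is an
  intersection of closed conditions, one polynomial inequality for each test vector
  \<open>x\<close>.\<close>

lemma closedin_sos_profile:
  assumes "label_bound d l"
  shows "closedin (powertop_real (variables d l)) (sos_profile d l)"
proof -
  let ?V = "variables d l" and ?R = "reduced_basis d l"
  let ?q = "\<lambda>x v. \<Sum>A\<in>?R. \<Sum>B\<in>?R. x A * x B * eval_monomial (moment_matrix A B) v"
  let ?T = "(\<lambda>C v. v C) ` ?V \<union> range ?q"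
  have q: "continuous_map (powertop_real ?V) euclideanreal (?q x)" for x
    by (intro continuous_map_sum continuous_map_real_mult continuous_map_eval_monomial
        moment_matrix_variables) (auto simp: finite_reduced_basis)
  have "continuous_map (powertop_real ?V) euclideanreal f" if "f \<in> ?T" for f
    using that q continuous_map_product_projection[of _ ?V "\<lambda>_. euclideanreal"] by auto
  then have "closedin (powertop_real ?V) {v \<in> topspace (powertop_real ?V). f v \<in> {0..}}" if "f \<in> ?T" for f
    using that by (intro closedin_continuous_map_preimage[of _ euclideanreal]) auto
  then have "closedin (powertop_real ?V) (\<Inter>f\<in>?T. {v \<in> topspace (powertop_real ?V). f v \<in> {0..}})"
    by (intro closedin_INT) auto
  moreover have "(\<Inter>f\<in>?T. {v \<in> topspace (powertop_real ?V). f v \<in> {0..}}) = sos_profile d l"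
    unfolding sos_profile_eq[OF assms] psd_on_def nonneg_orthant_def by (auto simp: PiE_iff)
  ultimately show ?thesis by simp
qed

lemma hom_density_nonneg: "finite W \<Longrightarrow> hom_density C W D \<ge> 0"
  using hom_density_abs[OF pl_edges_rep, of W C D]
  by (simp add: abs_rep_plgraph edge_density_def avg_def sum_nonneg)

lemma graph_profile_subset_sos_profile:
  assumes "label_bound d l"
  shows "graph_profile (variables d l) \<subseteq> sos_profile d l"
  unfolding graph_profile_def
proof (rule closure_of_minimal[OF _ closedin_sos_profile[OF assms]], rule subsetI)
  let ?V = "variables d l"
  fix v assume "v \<in> {(\<lambda>C\<in>?V. hom_density C W D) | W D. simple_graph W D}"
  then obtain W D where v: "v = (\<lambda>C\<in>?V. hom_density C W D)" and W: "finite W" "W \<noteq> {}"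
    by (auto simp: simple_graph_def)
  have "eval_monomial (moment_matrix A B) v = eval_monomial (moment_matrix A B) (\<lambda>C. hom_density C W D)"
    if "A \<in> reduced_basis d l" "B \<in> reduced_basis d l" for A B
    using moment_matrix_variables[OF that] by (intro eval_monomial_cong) (auto simp: v)
  then have "psd_on (reduced_basis d l) (\<lambda>A B. eval_monomial (moment_matrix A B) v)"
    using psd_on_hom_density[OF finite_reduced_basis reduced_basis_subset W] psd_on_cong by (metis (no_types, lifting))
  then show "v \<in> sos_profile d l"
    using hom_density_nonneg[OF W(1)] by (auto simp: sos_profile_eq[OF assms] nonneg_orthant_def v)
qed

section \<open>Logarithmic coordinates and the tropicalization\<close>

definition lin_monomial :: "plgraph multiset \<Rightarrow> (plgraph \<Rightarrow> real) \<Rightarrow> real" where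
  "lin_monomial m y = (\<Sum>C\<in>#m. y C)"

lemma lin_monomial_sum_count:
  assumes "finite V" "set_mset m \<subseteq> V"
  shows "lin_monomial m y = (\<Sum>C\<in>V. real (count m C) * y C)"
  using assms(2)
proof (induction m)
  case empty
  then show ?case by (simp add: lin_monomial_def)
next
  case (add D m)
  have "(\<Sum>C\<in>V. real (count (add_mset D m) C) * y C) = (\<Sum>C\<in>V. real (count m C) * y C + (if C = D then y D else 0))"
    by (intro sum.cong refl) (auto simp: algebra_simps)
  also have "\<dots> = (\<Sum>C\<in>V. real (count m C) * y C) + y D"
    using assms(1) add.prems by (simp add: sum.distrib)
  finally show ?case using add by (simp add: lin_monomial_def)
qed

lemma lin_monomial_add: "lin_monomial m (\<lambda>C. y C + z C) = lin_monomial m y + lin_monomial m z"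
  by (simp add: lin_monomial_def sum_mset.distrib)

lemma lin_monomial_cmult: "lin_monomial m (\<lambda>C. c * y C) = c * lin_monomial m y"
  by (simp add: lin_monomial_def sum_mset_distrib_left)

lemma lin_monomial_sum: "lin_monomial m (\<lambda>C. \<Sum>i\<in>I. y i C) = (\<Sum>i\<in>I. lin_monomial m (y i))"
  by (induction m) (simp_all add: lin_monomial_def sum.distrib)

lemma eval_monomial_exp: "eval_monomial m (\<lambda>C. exp (y C)) = exp (lin_monomial m y)"
  by (induction m) (simp_all add: lin_monomial_def eval_monomial_def exp_add)

lemma eval_monomial_restrict_exp:
  "set_mset m \<subseteq> V \<Longrightarrow> eval_monomial m (\<lambda>C\<in>V. exp (y C)) = exp (lin_monomial m y)"
  unfolding eval_monomial_exp[symmetric] by (intro eval_monomial_cong) auto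

lemma lin_monomial_ln:
  "(\<And>C. v C > 0) \<Longrightarrow> eval_monomial m v > 0 \<and> lin_monomial m (\<lambda>C. ln (v C)) = ln (eval_monomial m v)"
proof (induction m)
  case (add D m)
  then have "v D > 0" "eval_monomial m v > 0" by blast+
  then have "ln (v D * eval_monomial m v) = ln (v D) + ln (eval_monomial m v)" by (rule ln_mult_pos)
  then show ?case using add by (simp add: lin_monomial_def eval_monomial_def)
qed (simp add: lin_monomial_def eval_monomial_def)

lemma log_set_eq: "log_set V S = {y \<in> V \<rightarrow>\<^sub>E UNIV. (\<lambda>C\<in>V. exp (y C)) \<in> S}"
proof (intro equalityI subsetI)
  fix y assume "y \<in> log_set V S"
  then obtain v where v: "v \<in> S" "v \<in> pos_orthant V" "y = (\<lambda>C\<in>V. ln (v C))" by (auto simp: log_set_def)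
  have "(\<lambda>C\<in>V. exp (y C)) = v"
    using v(2) by (fastforce simp: v(3) pos_orthant_def fun_eq_iff PiE_iff extensional_def)
  then show "y \<in> {y \<in> V \<rightarrow>\<^sub>E UNIV. (\<lambda>C\<in>V. exp (y C)) \<in> S}" using v by auto
next
  fix y assume y: "y \<in> {y \<in> V \<rightarrow>\<^sub>E UNIV. (\<lambda>C\<in>V. exp (y C)) \<in> S}"
  then have "y = (\<lambda>C\<in>V. ln ((\<lambda>C\<in>V. exp (y C)) C))"
    by (auto simp: fun_eq_iff PiE_iff extensional_def)
  moreover have "(\<lambda>C\<in>V. exp (y C)) \<in> S \<inter> pos_orthant V" using y by (auto simp: pos_orthant_def)
  ultimately show "y \<in> log_set V S" unfolding log_set_def by (rule image_eqI)
qed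

lemma log_minors22_eq:
  "log_set (variables d l) (minors22 (variables d l) (reduced_basis d l) moment_matrix) =
    {y \<in> variables d l \<rightarrow>\<^sub>E UNIV. \<forall>A\<in>reduced_basis d l. \<forall>B\<in>reduced_basis d l. A \<noteq> B \<longrightarrow>
      2 * lin_monomial (moment_matrix A B) y \<le>
      lin_monomial (moment_matrix A A) y + lin_monomial (moment_matrix B B) y}"
proof -
  let ?V = "variables d l"
  have "(\<lambda>C\<in>?V. exp (y C)) \<in> nonneg_orthant ?V" for y :: "plgraph \<Rightarrow> real"
    by (auto simp: nonneg_orthant_def)
  moreover have "eval_monomial (moment_matrix A A) (\<lambda>C\<in>?V. exp (y C)) * eval_monomial (moment_matrix B B) (\<lambda>C\<in>?V. exp (y C))
       - eval_monomial (moment_matrix A B) (\<lambda>C\<in>?V. exp (y C)) * eval_monomial (moment_matrix B A) (\<lambda>C\<in>?V. exp (y C)) \<ge> 0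
     \<longleftrightarrow> 2 * lin_monomial (moment_matrix A B) y \<le> lin_monomial (moment_matrix A A) y + lin_monomial (moment_matrix B B) y"
    if "A \<in> reduced_basis d l" "B \<in> reduced_basis d l" for A B and y :: "plgraph \<Rightarrow> real"
    by (simp add: eval_monomial_restrict_exp moment_matrix_variables that moment_matrix_commute[of B A]
        exp_add[symmetric])
  ultimately show ?thesis unfolding log_set_eq minors22_def by auto
qed

text \<open>Each coefficient vector is the difference of the exponent vectors of the two terms of a
  minor, hence integral.\<close>

lemma rational_polyhedral_cone_log_minors22:
  "rational_polyhedral_cone (variables d l)
     (log_set (variables d l) (minors22 (variables d l) (reduced_basis d l) moment_matrix))"
proof -
  let ?V = "variables d l" and ?R = "reduced_basis d l"
  define c :: "plgraph \<times> plgraph \<Rightarrow> plgraph \<Rightarrow> rat" where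
    "c = (\<lambda>(A, B) C. of_nat (count (moment_matrix A A) C) + of_nat (count (moment_matrix B B) C)
      - 2 * of_nat (count (moment_matrix A B) C))"
  let ?P = "{(A, B). A \<in> ?R \<and> B \<in> ?R \<and> A \<noteq> B}"
  have "?P \<subseteq> ?R \<times> ?R" by auto
  then have fin: "finite (c ` ?P)"
    using finite_subset[of ?P] finite_reduced_basis by blast
  have "(\<Sum>C\<in>?V. of_rat (c (A, B) C) * y C) = lin_monomial (moment_matrix A A) y + lin_monomial (moment_matrix B B) y
      - 2 * lin_monomial (moment_matrix A B) y" if "A \<in> ?R" "B \<in> ?R" for A B and y :: "plgraph \<Rightarrow> real"
    using that
    by (simp add: lin_monomial_sum_count[OF finite_variables moment_matrix_variables] c_def of_rat_add of_rat_diff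
        of_rat_mult sum_distrib_left sum.distrib[symmetric] sum_subtractf[symmetric] algebra_simps)
  then show ?thesis
    unfolding rational_polyhedral_cone_def log_minors22_eq using fin
    by (intro exI[of _ "c ` ?P"]) auto
qed

text \<open>The factors \<open>- 1 / ln (\<tau> k)\<close> are nonnegative, so rescaled logarithms
  stay in the cone, and weak linear inequalities survive the limit.\<close>

lemma trop_subset_cone:
  assumes V: "finite V" and K: "rational_polyhedral_cone V K" and sub: "log_set V S \<subseteq> K"
  shows "trop V S \<subseteq> K"
proof
  fix y assume "y \<in> trop V S"
  then obtain \<tau> w where \<tau>: "\<And>k. \<tau> k \<in> {0<..<1}" and w: "\<And>k. w k \<in> S \<inter> pos_orthant V"
    and lim: "limitin (powertop_real V) (\<lambda>k. \<lambda>C\<in>V. (- 1 / ln (\<tau> k)) * ln (w k C)) y sequentially"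
    by (auto simp: trop_def)
  obtain F :: "(plgraph \<Rightarrow> rat) set" where F: "K = {y \<in> V \<rightarrow>\<^sub>E UNIV. \<forall>c\<in>F. (\<Sum>C\<in>V. of_rat (c C) * y C) \<ge> 0}"
    using K unfolding rational_polyhedral_cone_def by blast
  have y: "y \<in> V \<rightarrow>\<^sub>E UNIV" using limitin_topspace[OF lim] by simp
  have comp: "(\<lambda>k. (- 1 / ln (\<tau> k)) * ln (w k C)) \<longlonglongrightarrow> y C" if "C \<in> V" for C
    using lim that unfolding limitin_componentwise by auto
  have "(\<Sum>C\<in>V. of_rat (c C) * y C) \<ge> 0" if c: "c \<in> F" for c
  proof (rule LIMSEQ_le_const)
    show "(\<lambda>k. \<Sum>C\<in>V. of_rat (c C) * ((- 1 / ln (\<tau> k)) * ln (w k C))) \<longlonglongrightarrow> (\<Sum>C\<in>V. of_rat (c C) * y C)"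
      by (intro tendsto_sum tendsto_mult tendsto_const comp)
    have "(\<Sum>C\<in>V. of_rat (c C) * ((- 1 / ln (\<tau> k)) * ln (w k C))) \<ge> 0" for k
    proof -
      have "(\<lambda>C\<in>V. ln (w k C)) \<in> K" using sub w[of k] unfolding log_set_def by blast
      then have "(\<Sum>C\<in>V. of_rat (c C) * ln (w k C)) \<ge> 0" using c F by auto
      moreover have "- 1 / ln (\<tau> k) \<ge> 0" using \<tau>[of k] by (simp add: divide_nonpos_nonpos)
      ultimately have "(- 1 / ln (\<tau> k)) * (\<Sum>C\<in>V. of_rat (c C) * ln (w k C)) \<ge> 0"
        by (intro mult_nonneg_nonneg)
      then show ?thesis by (simp only: sum_distrib_left mult.left_commute)
    qed
    then show "\<exists>N. \<forall>k\<ge>N. 0 \<le> (\<Sum>C\<in>V. of_rat (c C) * ((- 1 / ln (\<tau> k)) * ln (w k C)))" by blast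
  qed
  then show "y \<in> K" using y F by blast
qed

lemma sos_profile_subset_minors22:
  assumes "label_bound d l"
  shows "sos_profile d l \<subseteq> minors22 (variables d l) (reduced_basis d l) moment_matrix"
proof
  fix v assume "v \<in> sos_profile d l"
  then have v: "v \<in> nonneg_orthant (variables d l)"
    and psd: "psd_on (reduced_basis d l) (\<lambda>A B. eval_monomial (moment_matrix A B) v)"
    by (simp_all add: sos_profile_eq[OF assms])
  show "v \<in> minors22 (variables d l) (reduced_basis d l) moment_matrix"
    unfolding minors22_def
    using v psd_on_minor[OF finite_reduced_basis psd] moment_matrix_commute by simp
qed

lemma exists_strictly_feasible_exponents:
  "\<exists>y. \<forall>A\<in>reduced_basis d l. \<forall>B\<in>reduced_basis d l. A \<noteq> B \<longrightarrow>
     2 * lin_monomial (moment_matrix A B) y <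
     lin_monomial (moment_matrix A A) y + lin_monomial (moment_matrix B B) y"
proof -
  let ?R = "reduced_basis d l"
  let ?P = "{p \<in> ?R \<times> ?R. fst p \<noteq> snd p}"
  let ?e = "\<lambda>A B T. eval_monomial (moment_matrix A B) (\<lambda>C. hom_density C (fst T) (snd T))"
  have "\<forall>p\<in>?P. \<exists>T. finite (fst T) \<and> 0 \<in> fst T \<and> {0} \<in> snd T \<and>
      (?e (fst p) (snd p) T)\<^sup>2 < ?e (fst p) (fst p) T * ?e (snd p) (snd p) T"
    using exists_strict_minor by auto
  from bchoice[OF this] obtain T where T: "\<forall>p\<in>?P. finite (fst (T p)) \<and> 0 \<in> fst (T p) \<and> {0} \<in> snd (T p) \<and>
      (?e (fst p) (snd p) (T p))\<^sup>2 < ?e (fst p) (fst p) (T p) * ?e (snd p) (snd p) (T p)"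
    by blast
  have "?P \<subseteq> ?R \<times> ?R" by blast
  then have fin: "finite ?P" using finite_subset finite_reduced_basis by blast
  define y where "y C = (\<Sum>p\<in>?P. ln (hom_density C (fst (T p)) (snd (T p))))" for C
  have pos: "?e A B (T p) > 0 \<and>
      lin_monomial (moment_matrix A B) (\<lambda>C. ln (hom_density C (fst (T p)) (snd (T p)))) = ln (?e A B (T p))"
    if "p \<in> ?P" for A B p
    using that T by (intro lin_monomial_ln hom_density_pos) blast+
  have y: "lin_monomial (moment_matrix A B) y = (\<Sum>p\<in>?P. ln (?e A B (T p)))" for A B
    unfolding y_def[abs_def] lin_monomial_sum by (intro sum.cong refl) (use pos in blast)
  have log: "2 * ln (?e A B (T p)) = ln ((?e A B (T p))\<^sup>2)"
    "ln (?e A A (T p)) + ln (?e B B (T p)) = ln (?e A A (T p) * ?e B B (T p))"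
    "(?e A B (T p))\<^sup>2 > 0" "?e A A (T p) * ?e B B (T p) > 0"
    if p: "p \<in> ?P" for A B p
    using pos[OF p, of A B] pos[OF p, of A A] pos[OF p, of B B]
    by (simp_all add: ln_realpow ln_mult)
  show ?thesis
  proof (intro exI[of _ y] ballI impI)
    fix A B assume AB: "A \<in> ?R" "B \<in> ?R" "A \<noteq> B"
    have "(\<Sum>p\<in>?P. 2 * ln (?e A B (T p))) < (\<Sum>p\<in>?P. ln (?e A A (T p)) + ln (?e B B (T p)))"
    proof (rule sum_strict_mono_ex1[OF fin])
      show "\<forall>p\<in>?P. 2 * ln (?e A B (T p)) \<le> ln (?e A A (T p)) + ln (?e B B (T p))"
      proof
        fix p assume p: "p \<in> ?P"
        have W: "finite (fst (T p))" "fst (T p) \<noteq> {}" using T p by blast+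
        have "(?e A B (T p))\<^sup>2 \<le> ?e A A (T p) * ?e B B (T p)"
          using psd_on_minor[OF finite_reduced_basis psd_on_hom_density[OF finite_reduced_basis reduced_basis_subset W] AB]
            moment_matrix_commute by (simp add: power2_eq_square)
        then show "2 * ln (?e A B (T p)) \<le> ln (?e A A (T p)) + ln (?e B B (T p))"
          unfolding log(1,2)[OF p] using log(3,4)[OF p] by (subst ln_le_cancel_iff) auto
      qed
      \<comment> \<open>The target chosen for this very pair supplies the one strict
        summand.\<close>
      have p: "(A, B) \<in> ?P" using AB by simp
      have "(?e A B (T (A, B)))\<^sup>2 < ?e A A (T (A, B)) * ?e B B (T (A, B))" using bspec[OF T p] by simp
      then have "2 * ln (?e A B (T (A, B))) < ln (?e A A (T (A, B))) + ln (?e B B (T (A, B)))"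
        unfolding log(1,2)[OF p] using log(3,4)[OF p] by (subst ln_less_cancel_iff) auto
      then show "\<exists>p\<in>?P. 2 * ln (?e A B (T p)) < ln (?e A A (T p)) + ln (?e B B (T p))" using p by blast
    qed
    then show "2 * lin_monomial (moment_matrix A B) y <
        lin_monomial (moment_matrix A A) y + lin_monomial (moment_matrix B B) y"
      unfolding y by (simp add: sum_distrib_left sum.distrib)
  qed
qed

text \<open>Scaling makes the gaps in the strict inequalities exponentially large, which beats the
  fixed factor required by diagonal dominance. \<open>c\<close> is a free lower bound, so that the
  scale can be sent to infinity.\<close>

lemma strict_exponents_scale_into_sos_profile:
  assumes lb: "label_bound d l"
    and strict: "\<And>A B. A \<in> reduced_basis d l \<Longrightarrow> B \<in> reduced_basis d l \<Longrightarrow> A \<noteq> B \<Longrightarrow>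
      2 * lin_monomial (moment_matrix A B) y <
      lin_monomial (moment_matrix A A) y + lin_monomial (moment_matrix B B) y"
  shows "\<exists>s\<ge>c. (\<lambda>C\<in>variables d l. exp (s * y C)) \<in> sos_profile d l"
proof -
  let ?R = "reduced_basis d l" and ?V = "variables d l"
  let ?f = "\<lambda>A B. lin_monomial (moment_matrix A B) y" and ?n = "real (card (reduced_basis d l))"
  \<comment> \<open>\<open>exp (s * \<delta> (A, B))\<close> is the ratio of the geometric mean of
    the two diagonal entries to the off-diagonal entry at scale \<open>s\<close>.\<close>
  define \<delta> where "\<delta> p = (?f (fst p) (fst p) + ?f (snd p) (snd p)) / 2 - ?f (fst p) (snd p)" for p
  let ?P = "{p \<in> ?R \<times> ?R. fst p \<noteq> snd p}"
  have "?P \<subseteq> ?R \<times> ?R" by blast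
  then have fin: "finite ?P" using finite_subset finite_reduced_basis by blast
  have \<delta>: "\<delta> p > 0" if "p \<in> ?P" for p
    using strict[of "fst p" "snd p"] that by (auto simp: \<delta>_def)
  \<comment> \<open>The sum dominates each \<open>?n / \<delta> p\<close>, so
    \<open>s * \<delta> p \<ge> ?n\<close> for all pairs; this suffices because
    \<open>exp t \<ge> t\<close>.\<close>
  define s where "s = \<bar>c\<bar> + (\<Sum>p\<in>?P. ?n / \<delta> p)"
  have sum0: "(\<Sum>p\<in>?P. ?n / \<delta> p) \<ge> 0" using \<delta> by (intro sum_nonneg) (simp add: less_imp_le)
  have s: "s \<ge> c" using sum0 by (simp add: s_def)
  have sd: "?n \<le> s * \<delta> p" if p: "p \<in> ?P" for p
  proof -
    have "?n / \<delta> p \<le> (\<Sum>p\<in>?P. ?n / \<delta> p)"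
      using fin p \<delta> by (intro member_le_sum) (auto simp: less_imp_le)
    then have "?n / \<delta> p \<le> s" by (simp add: s_def)
    then show ?thesis using \<delta>[OF p] by (simp add: pos_divide_le_eq)
  qed
  let ?v = "\<lambda>C\<in>?V. exp (s * y C)"
  have ev: "eval_monomial (moment_matrix A B) ?v = exp (s * ?f A B)" if "A \<in> ?R" "B \<in> ?R" for A B
    by (simp add: eval_monomial_restrict_exp[OF moment_matrix_variables[OF that]] lin_monomial_cmult)
  have "psd_on ?R (\<lambda>A B. eval_monomial (moment_matrix A B) ?v)"
  proof (rule psd_on_diagonally_dominant[where r = "\<lambda>A. exp (s * ?f A A / 2)"])
    fix A assume "A \<in> ?R"
    then show "eval_monomial (moment_matrix A A) ?v = (exp (s * ?f A A / 2))\<^sup>2"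
      by (simp add: ev exp_double[symmetric])
  next
    fix A B assume AB: "A \<in> ?R" "B \<in> ?R" "A \<noteq> B"
    then have "?n \<le> s * \<delta> (A, B)" by (intro sd) simp
    also have "\<dots> \<le> exp (s * \<delta> (A, B))" using exp_ge_add_one_self[of "s * \<delta> (A, B)"] by linarith
    finally have "exp (s * ?f A B) * ?n \<le> exp (s * ?f A B) * exp (s * \<delta> (A, B))" by simp
    also have "\<dots> = exp (s * ?f A A / 2) * exp (s * ?f B B / 2)"
      by (simp add: exp_add[symmetric] \<delta>_def field_simps)
    finally show "\<bar>eval_monomial (moment_matrix A B) ?v\<bar> * ?n \<le> exp (s * ?f A A / 2) * exp (s * ?f B B / 2)"
      using AB by (simp add: ev)
  qed (simp_all add: finite_reduced_basis)
  then have "?v \<in> sos_profile d l" by (auto simp: sos_profile_eq[OF lb] nonneg_orthant_def)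
  then show ?thesis using s by blast
qed

lemma log_minors22_subset_trop:
  assumes lb: "label_bound d l"
  shows "log_set (variables d l) (minors22 (variables d l) (reduced_basis d l) moment_matrix)
    \<subseteq> trop (variables d l) (sos_profile d l)"
proof
  let ?R = "reduced_basis d l" and ?V = "variables d l"
  fix y assume y: "y \<in> log_set ?V (minors22 ?V ?R moment_matrix)"
  obtain y0 where y0: "\<forall>A\<in>?R. \<forall>B\<in>?R. A \<noteq> B \<longrightarrow>
     2 * lin_monomial (moment_matrix A B) y0 <
     lin_monomial (moment_matrix A A) y0 + lin_monomial (moment_matrix B B) y0"
    using exists_strictly_feasible_exponents by blast
  \<comment> \<open>A shrinking multiple of the strict point turns the weak inequalities at
    \<open>y\<close> into strict ones, while \<open>z k\<close> still tends to
    \<open>y\<close>.\<close>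
  define z where "z k C = y C + (1 / real (Suc k)) * y0 C" for k C
  have "\<exists>s\<ge>real (Suc k). (\<lambda>C\<in>?V. exp (s * z k C)) \<in> sos_profile d l" for k
  proof (rule strict_exponents_scale_into_sos_profile[OF lb])
    fix A B assume AB: "A \<in> ?R" "B \<in> ?R" "A \<noteq> B"
    have "2 * lin_monomial (moment_matrix A B) y \<le> lin_monomial (moment_matrix A A) y + lin_monomial (moment_matrix B B) y"
      using y AB unfolding log_minors22_eq by blast
    moreover have "(1 / real (Suc k)) * (2 * lin_monomial (moment_matrix A B) y0) <
        (1 / real (Suc k)) * (lin_monomial (moment_matrix A A) y0 + lin_monomial (moment_matrix B B) y0)"
      using y0 AB by (intro mult_strict_left_mono) auto
    ultimately show "2 * lin_monomial (moment_matrix A B) (z k) <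
        lin_monomial (moment_matrix A A) (z k) + lin_monomial (moment_matrix B B) (z k)"
      unfolding z_def[abs_def] lin_monomial_add lin_monomial_cmult by argo
  qed
  then obtain s where s: "\<And>k. s k \<ge> real (Suc k)" "\<And>k. (\<lambda>C\<in>?V. exp (s k * z k C)) \<in> sos_profile d l"
    by metis
  have spos: "s k > 0" for k using s(1)[of k] by linarith
  show "y \<in> trop ?V (sos_profile d l)"
    unfolding trop_def
  proof (intro CollectI exI conjI allI)
    \<comment> \<open>With \<open>\<tau> k = exp (- s k)\<close> the factor
      \<open>- 1 / ln (\<tau> k)\<close> is \<open>1 / s k\<close>, so the normalised logarithms are
      exactly \<open>z k\<close>; the bound \<open>s k \<ge> real (Suc k)\<close> sends
      \<open>\<tau> k\<close> to 0.\<close>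
    show "exp (- s k) \<in> {0<..<1}" for k using spos[of k] by simp
    have "filterlim s at_top sequentially"
    proof (rule filterlim_at_top_mono)
      show "filterlim (\<lambda>k. real (Suc k)) at_top sequentially"
        using filterlim_compose[OF filterlim_real_sequentially filterlim_Suc] .
    qed (use s(1) in simp)
    then show "(\<lambda>k. exp (- s k)) \<longlonglongrightarrow> 0"
      by (intro filterlim_compose[OF exp_at_bot] filterlim_compose[OF filterlim_uminus_at_bot_at_top])
    show "(\<lambda>C\<in>?V. exp (s k * z k C)) \<in> sos_profile d l \<inter> pos_orthant ?V" for k
      using s(2)[of k] by (auto simp: pos_orthant_def)
    have "y \<in> extensional ?V" using y unfolding log_minors22_eq by (auto simp: PiE_iff)
    moreover have "(\<lambda>k. (\<lambda>C\<in>?V. (- 1 / ln (exp (- s k))) * ln ((\<lambda>C\<in>?V. exp (s k * z k C)) C)) C) \<longlonglongrightarrow> y C"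
      if "C \<in> ?V" for C
    proof -
      have "(\<lambda>k. y C + (1 / real (Suc k)) * y0 C) \<longlonglongrightarrow> y C + 0 * y0 C"
        by (intro tendsto_intros LIMSEQ_Suc[OF lim_1_over_n])
      then show ?thesis using that spos by (simp add: z_def less_imp_neq[symmetric])
    qed
    ultimately show "limitin (powertop_real ?V)
        (\<lambda>k. \<lambda>C\<in>?V. (- 1 / ln (exp (- s k))) * ln ((\<lambda>C\<in>?V. exp (s k * z k C)) C)) y sequentially"
      unfolding limitin_componentwise by auto
  qed
qed

theorem theorem4p12:
  fixes d l :: nat
  assumes "d > 0" and "label_bound d l"
  shows "finite (variables d l)
    \<and> basic_semialgebraic (variables d l) (sos_profile d l)
    \<and> graph_profile (variables d l) \<subseteq> sos_profile d l
    \<and> trop (variables d l) (sos_profile d l)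
        = log_set (variables d l) (minors22 (variables d l) (reduced_basis d l) moment_matrix)
    \<and> rational_polyhedral_cone (variables d l)
        (log_set (variables d l) (minors22 (variables d l) (reduced_basis d l) moment_matrix))"
proof (intro conjI finite_variables basic_semialgebraic_sos_profile[OF assms(2)]
    graph_profile_subset_sos_profile[OF assms(2)] rational_polyhedral_cone_log_minors22 equalityI
    log_minors22_subset_trop[OF assms(2)])
  have "log_set (variables d l) (sos_profile d l)
      \<subseteq> log_set (variables d l) (minors22 (variables d l) (reduced_basis d l) moment_matrix)"
    using sos_profile_subset_minors22[OF assms(2)] unfolding log_set_eq by blast
  then show "trop (variables d l) (sos_profile d l)
      \<subseteq> log_set (variables d l) (minors22 (variables d l) (reduced_basis d l) moment_matrix)"
    by (rule trop_subset_cone[OF finite_variables rational_polyhedral_cone_log_minors22])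
qed

end
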